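(* Let $\mathbb{G}\mathrm{el}$ be the space of 2D photoelasticity (or Eshelby) tensors and write $\boldsymbol{\Pi}=(\xi,\lambda,\mu,\mathbf{h}_1,\mathbf{h}_2,\mathbf{H})$, with $\xi\in\mathbb{H}^{-1}(\mathbb{R}^2)$, $\lambda,\mu\in\mathbb{H}^0(\mathbb{R}^2)$, $\mathbf{h}_1,\mathbf{h}_2\in\mathbb{H}^2(\mathbb{R}^2)$, $\mathbf{H}\in\mathbb{H}^4(\mathbb{R}^2)$, in a fixed explicit harmonic decomposition $\mathbb{G}\mathrm{el}\simeq\mathbb{H}^{-1}\oplus2\mathbb{H}^0\oplus2\mathbb{H}^2\oplus\mathbb{H}^4$ under $\mathrm{O}(2)$. Consider the three families: (A) $\lambda$, $\mu$, $\mathbf{h}_1:\mathbf{h}_1$, $\mathbf{h}_2:\mathbf{h}_2$, $\mathbf{H}::\mathbf{H}$, $\mathbf{h}_1:\mathbf{h}_2$, $\mathbf{h}_1:\mathbf{H}:\mathbf{h}_1$, $\mathbf{h}_2:\mathbf{H}:\mathbf{h}_2$, $\mathbf{h}_1:\mathbf{H}:\mathbf{h}_2$ (order 0); $\mathbf{1}$, $\mathbf{h}_1$, $\mathbf{h}_2$, $\mathbf{H}:\mathbf{h}_1$, $\mathbf{H}:\mathbf{h}_2$ (order 2); $\mathbf{H}$ (order 4); (B) $\xi$, $\mathbf{h}_1:(\mathbf{1}\times\mathbf{h}_2)$, $\mathbf{h}_1:\mathbf{H}:(\mathbf{1}\times\mathbf{h}_1)$, $\mathbf{h}_2:\mathbf{H}:(\mathbf{1}\times\mathbf{h}_2)$,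 $\mathbf{h}_1:\mathbf{H}:(\mathbf{1}\times\mathbf{h}_2)$ (order 0); $\mathbf{1}\times\mathbf{h}_1$, $\mathbf{1}\times\mathbf{h}_2$, $\mathbf{H}:(\mathbf{1}\times\mathbf{h}_1)$, $\mathbf{H}:(\mathbf{1}\times\mathbf{h}_2)$ (order 2); $\mathbf{1}\times\mathbf{H}$ (order 4); (C) $\xi^2$, $\xi\,\mathbf{h}_1:(\mathbf{1}\times\mathbf{h}_2)$, $\xi\,\mathbf{h}_1:\mathbf{H}:(\mathbf{1}\times\mathbf{h}_1)$, $\xi\,\mathbf{h}_2:\mathbf{H}:(\mathbf{1}\times\mathbf{h}_2)$, $\xi\,\mathbf{h}_1:\mathbf{H}:(\mathbf{1}\times\mathbf{h}_2)$ (order 0); $\xi\,\mathbf{1}\times\mathbf{h}_1$, $\xi\,\mathbf{1}\times\mathbf{h}_2$, $\xi\,\mathbf{H}:(\mathbf{1}\times\mathbf{h}_1)$, $\xi\,\mathbf{H}:(\mathbf{1}\times\mathbf{h}_2)$ (order 2); $\xi\,\mathbf{1}\times\mathbf{H}$ (order 4). Then a minimal integrity basis for $\mathrm{Cov}(\mathbb{G}\mathrm{el},\mathrm{SO}(2))$ consists of the $25$ covariants ($14$ invariants) of (A) and (B), and a minimal integrity basis for $\mathrm{Cov}(\mathbb{G}\mathrm{el},\mathrm{O}(2))$ consists of the $25$ covariants ($14$ invariants) of (A) and (C). In complex form (up to non-zero constant factors, in the same order): (A) is $\lambda$, $\mu$, $z_{2a}\overline{z}_{2a}$, $z_{2b}\overline{z}_{2b}$,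 $z_4\overline{z}_4$, $\mathrm{Re}(z_{2a}\overline{z}_{2b})$, $\mathrm{Re}(z_{2a}^2\overline{z}_4)$, $\mathrm{Re}(z_{2b}^2\overline{z}_4)$, $\mathrm{Re}(z_{2a}z_{2b}\overline{z}_4)$; $z\overline{z}$, $\mathrm{Re}(\overline{z}_{2a}z^2)$, $\mathrm{Re}(\overline{z}_{2b}z^2)$, $\mathrm{Re}(z_{2a}\overline{z}_4z^2)$, $\mathrm{Re}(z_{2b}\overline{z}_4z^2)$; $\mathrm{Re}(\overline{z}_4z^4)$. (B) is $\xi$, $\mathrm{Im}(z_{2a}\overline{z}_{2b})$, $\mathrm{Im}(z_{2a}^2\overline{z}_4)$, $\mathrm{Im}(z_{2b}^2\overline{z}_4)$, $\mathrm{Im}(z_{2a}z_{2b}\overline{z}_4)$; $\mathrm{Im}(\overline{z}_{2a}z^2)$, $\mathrm{Im}(\overline{z}_{2b}z^2)$, $\mathrm{Im}(z_{2a}\overline{z}_4z^2)$, $\mathrm{Im}(z_{2b}\overline{z}_4z^2)$; $\mathrm{Im}(\overline{z}_4z^4)$. (C) is obtained by multiplying each element of (B) by $\xi$.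
   Context: $\mathbb{G}\mathrm{el}$ is the space of fourth-order tensors on $\mathbb{R}^2$ with $\Pi_{ijkl}=\Pi_{jikl}=\Pi_{ijlk}$, with the standard tensorial action of $\mathrm{O}(2)$. $\mathbb{H}^0=\mathbb{R}$ is the trivial representation, $\mathbb{H}^{-1}=\mathbb{R}$ the sign representation ($g$ acts by $\det g$; trivial when restricted to $\mathrm{SO}(2)$), and for $n\ge1$, $\mathbb{H}^n(\mathbb{R}^2)$ is the space of totally symmetric traceless tensors of order $n$. An explicit harmonic decomposition is a choice of $\mathrm{O}(2)$-equivariant linear isomorphism with the indicated direct sum. Complex coordinates: $\mathbf{h}_1(\mathbf{x},\mathbf{x})=\mathrm{Re}(\overline{z}_{2a}z^2)$, $\mathbf{h}_2(\mathbf{x},\mathbf{x})=\mathrm{Re}(\overline{z}_{2b}z^2)$, $\mathbf{H}(\mathbf{x},\mathbf{x},\mathbf{x},\mathbf{x})=\mathrm{Re}(\overline{z}_4z^4)$, $\mathbf{x}=(x,y)$, $z=x+iy$. $\mathrm{Inv}(\mathbb{V},G)$ is the algebra of $G$-invariant real polynomials on $\mathbb{V}$; $\mathrm{Cov}(\mathbb{V},G):=\mathrm{Inv}(\mathbb{V}\oplus\mathbb{R}^2,G)$ with standard action on $\mathbf{x}\in\mathbb{R}^2$. A tensor-valued covariant $\mathbf{c}$ of order $o$ is identified with the polynomial $\mathbf{c}(\mathbf{x},\dots,\mathbf{x})$; the order is the degree in $\mathbf{x}$; invariants are covariants of order $0$. An integrity basis is a finite set of homogeneous generators; it is minimal if no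 proper subset generates. $:$ and $::$ are contractions over two and four indices; $\mathbf{1}$ is the identity second-order tensor; $\mathbf{S}_1\times\mathbf{S}_2=-(\mathbf{S}_1\cdot\boldsymbol{\varepsilon}\cdot\mathbf{S}_2)^s$, with $\boldsymbol{\varepsilon}$ the Levi-Civita tensor ($\varepsilon_{12}=1$) and $(\cdot)^s$ total symmetrization. *)

theory Defs
  imports "HOL-Analysis.Analysis"
begin

type_synonym tensor2 = "real^2^2"
type_synonym tensor4 = "real^2^2^2^2"

definition O2 :: "(real^2^2) set" where
  "O2 = {g. orthogonal_matrix g}"

definition SO2 :: "(real^2^2) set" where
  "SO2 = {g. rotation_matrix g}"

definition act2 :: "real^2^2 \<Rightarrow> tensor2 \<Rightarrow> tensor2" where
  "act2 g T = (\<chi> i j. \<Sum>p\<in>UNIV. \<Sum>q\<in>UNIV. g$i$p * g$j$q * T$p$q)"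

definition act4 :: "real^2^2 \<Rightarrow> tensor4 \<Rightarrow> tensor4" where
  "act4 g T = (\<chi> i j k l. \<Sum>p\<in>UNIV. \<Sum>q\<in>UNIV. \<Sum>r\<in>UNIV. \<Sum>s\<in>UNIV.
      g$i$p * g$j$q * g$k$r * g$l$s * T$p$q$r$s)"

definition permute2 :: "(nat \<Rightarrow> nat) \<Rightarrow> tensor2 \<Rightarrow> tensor2" where
  "permute2 p T = (\<chi> i j. let v = [i, j] in T$(v ! p 0)$(v ! p 1))"

definition permute4 :: "(nat \<Rightarrow> nat) \<Rightarrow> tensor4 \<Rightarrow> tensor4" where
  "permute4 p T = (\<chi> i j k l. let v = [i, j, k, l] in T$(v ! p 0)$(v ! p 1)$(v ! p 2)$(v ! p 3))"

definition symmetrize2 :: "tensor2 \<Rightarrow> tensor2" where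
  "symmetrize2 T = (1 / fact 2) *\<^sub>R (\<Sum>p | p permutes {..<2}. permute2 p T)"

definition symmetrize4 :: "tensor4 \<Rightarrow> tensor4" where
  "symmetrize4 T = (1 / fact 4) *\<^sub>R (\<Sum>p | p permutes {..<4}. permute4 p T)"

definition Harm2 :: "tensor2 set" where
  "Harm2 = {h. (\<forall>p. p permutes {..<2} \<longrightarrow> permute2 p h = h) \<and> (\<Sum>i\<in>UNIV. h$i$i) = 0}"

definition Harm4 :: "tensor4 set" where
  "Harm4 = {H. (\<forall>p. p permutes {..<4} \<longrightarrow> permute4 p H = H) \<and>
               (\<forall>k l. (\<Sum>i\<in>UNIV. H$i$i$k$l) = 0)}"

definition contract2 :: "tensor2 \<Rightarrow> tensor2 \<Rightarrow> real" (infixl "\<bullet>\<^sub>2" 70) where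
  "a \<bullet>\<^sub>2 b = (\<Sum>i\<in>UNIV. \<Sum>j\<in>UNIV. a$i$j * b$i$j)"

definition contract4 :: "tensor4 \<Rightarrow> tensor4 \<Rightarrow> real" (infixl "\<bullet>\<^sub>4" 70) where
  "A \<bullet>\<^sub>4 B = (\<Sum>i\<in>UNIV. \<Sum>j\<in>UNIV. \<Sum>k\<in>UNIV. \<Sum>l\<in>UNIV. A$i$j$k$l * B$i$j$k$l)"

text \<open>The contraction \<open>H : h\<close> of a fourth-order with a second-order tensor over two indices.\<close>

definition contract42 :: "tensor4 \<Rightarrow> tensor2 \<Rightarrow> tensor2" (infixr "\<odot>" 75) where
  "H \<odot> h = (\<chi> i j. \<Sum>k\<in>UNIV. \<Sum>l\<in>UNIV. H$i$j$k$l * h$k$l)"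

definition levi_civita :: tensor2 where
  "levi_civita = (\<chi> i j. if i = 1 \<and> j = 2 then 1 else if i = 2 \<and> j = 1 then -1 else 0)"

text \<open>The generalized cross product \<open>S\<^sub>1 \<times> S\<^sub>2 = - (S\<^sub>1 \<cdot> \<epsilon> \<cdot> S\<^sub>2)\<^sup>s\<close>, for \<open>S\<^sub>1\<close> of order two
  and \<open>S\<^sub>2\<close> of order two, respectively four.\<close>

definition cross2 :: "tensor2 \<Rightarrow> tensor2 \<Rightarrow> tensor2" where
  "cross2 S T = - symmetrize2
     (\<chi> i j. \<Sum>m\<in>UNIV. \<Sum>n\<in>UNIV. S$i$m * levi_civita$m$n * T$n$j)"

definition cross4 :: "tensor2 \<Rightarrow> tensor4 \<Rightarrow> tensor4" where
  "cross4 S T = - symmetrize4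
     (\<chi> i j k l. \<Sum>m\<in>UNIV. \<Sum>n\<in>UNIV. S$i$m * levi_civita$m$n * T$n$j$k$l)"

definition form2 :: "tensor2 \<Rightarrow> real^2 \<Rightarrow> real" where
  "form2 T x = (\<Sum>i\<in>UNIV. \<Sum>j\<in>UNIV. T$i$j * x$i * x$j)"

definition form4 :: "tensor4 \<Rightarrow> real^2 \<Rightarrow> real" where
  "form4 T x = (\<Sum>i\<in>UNIV. \<Sum>j\<in>UNIV. \<Sum>k\<in>UNIV. \<Sum>l\<in>UNIV. T$i$j$k$l * x$i * x$j * x$k * x$l)"

definition Gel :: "tensor4 set" where
  "Gel = {P. \<forall>i j k l. P$i$j$k$l = P$j$i$k$l \<and> P$i$j$k$l = P$i$j$l$k}"

text \<open>Elements of \<open>H\<^sup>-\<^sup>1 \<oplus> 2 H\<^sup>0 \<oplus> 2 H\<^sup>2 \<oplus> H\<^sup>4\<close> are tuples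
  \<open>(\<xi>, \<lambda>, \<mu>, h\<^sub>1, h\<^sub>2, H)\<close>.\<close>

type_synonym harm = "real \<times> real \<times> real \<times> tensor2 \<times> tensor2 \<times> tensor4"

definition Harm_sum :: "harm set" where
  "Harm_sum = UNIV \<times> UNIV \<times> UNIV \<times> Harm2 \<times> Harm2 \<times> Harm4"

definition act_harm :: "real^2^2 \<Rightarrow> harm \<Rightarrow> harm" where
  "act_harm g = (\<lambda>(\<xi>, l, m, h1, h2, H). (det g * \<xi>, l, m, act2 g h1, act2 g h2, act4 g H))"

text \<open>Only the values on \<^const>\<open>Gel\<close> matter: linearity, bijectivity and equivariance are
  required there.\<close>

definition harmonic_decomposition :: "(tensor4 \<Rightarrow> harm) \<Rightarrow> bool" where
  "harmonic_decomposition \<Phi> \<longleftrightarrow>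
     (\<forall>P\<in>Gel. \<forall>Q\<in>Gel. \<Phi> (P + Q) = \<Phi> P + \<Phi> Q) \<and>
     (\<forall>c. \<forall>P\<in>Gel. \<Phi> (c *\<^sub>R P) = c *\<^sub>R \<Phi> P) \<and>
     bij_betw \<Phi> Gel Harm_sum \<and>
     (\<forall>g\<in>O2. \<forall>P\<in>Gel. \<Phi> (act4 g P) = act_harm g (\<Phi> P))"

lemma Harm2_iff: "h \<in> Harm2 \<longleftrightarrow> h$2$1 = h$1$2 \<and> h$2$2 = - h$1$1"
proof
  assume h: "h \<in> Harm2"
  have "Transposition.transpose 0 1 permutes {..<2::nat}" by (intro permutes_swap_id) auto
  then have "permute2 (Transposition.transpose 0 1) h = h" using h unfolding Harm2_def by blast
  from arg_cong[OF this, of "\<lambda>T. T$1$2"] have "h$2$1 = h$1$2" by (simp add: permute2_def)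
  moreover have "h$1$1 + h$2$2 = 0" using h unfolding Harm2_def sum_2 by blast
  ultimately show "h$2$1 = h$1$2 \<and> h$2$2 = - h$1$1" by linarith
next
  assume R: "h$2$1 = h$1$2 \<and> h$2$2 = - h$1$1"
  have "permute2 p h = h" if p: "p permutes {..<2}" for p
  proof -
    have "p 0 < 2" "p 1 < 2" "p 0 \<noteq> p 1"
      using permutes_in_image[OF p] permutes_inj[OF p] by (auto simp: inj_eq)
    then have "p 0 = 0 \<and> p 1 = 1 \<or> p 0 = 1 \<and> p 1 = 0" by (auto simp: less_2_cases_iff)
    then show ?thesis using R by (auto simp: permute2_def vec_eq_iff forall_2)
  qed
  moreover have "(\<Sum>i\<in>UNIV. h$i$i) = 0" using R by (simp add: sum_2)
  ultimately show "h \<in> Harm2" unfolding Harm2_def by blast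
qed

definition idx :: "2 \<Rightarrow> nat" where "idx i = (if i = 2 then 1 else 0)"

lemma idx [simp]: "idx 1 = 0" "idx 2 = 1" by (auto simp: idx_def)

lemma Harm4I:
  assumes "\<And>i j k l. H$i$j$k$l = [a, b, - a, - b, a] ! (idx i + idx j + idx k + idx l)"
  shows "H \<in> Harm4"
proof -
  have "permute4 p H = H" if p: "p permutes {..<4}" for p
  proof -
    have 4: "{..<4::nat} = {0, 1, 2, 3}" by auto
    have "(\<Sum>q<4. idx (v ! p q)) = (\<Sum>q<4. idx (v ! q))" for v
      using sum.permute[OF p, of "\<lambda>q. idx (v ! q)"] by (simp add: o_def)
    then have "idx (v ! p 0) + idx (v ! p 1) + idx (v ! p 2) + idx (v ! p 3) =
        idx (v ! 0) + idx (v ! 1) + idx (v ! 2) + idx (v ! 3)" for v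
      by (simp add: 4 add.assoc)
    from this[of "[_,_,_,_]"] show ?thesis
      by (simp add: permute4_def vec_eq_iff assms)
  qed
  moreover have "\<forall>k l. (\<Sum>i\<in>UNIV. H$i$i$k$l) = 0" by (simp add: assms forall_2 sum_2)
  ultimately show ?thesis unfolding Harm4_def by blast
qed

lemma Harm4D:
  assumes H: "H \<in> Harm4"
  shows "H$i$j$k$l = [H$1$1$1$1, H$1$1$1$2, - H$1$1$1$1, - H$1$1$1$2, H$1$1$1$1] !
    (idx i + idx j + idx k + idx l)"
proof -
  have "permute4 (Transposition.transpose m (Suc m)) H = H" if "m < 3" for m
  proof -
    have "Transposition.transpose m (Suc m) permutes {..<4}" using that by (intro permutes_swap_id) auto
    then show ?thesis using H unfolding Harm4_def by blast
  qed
  from this[of 0] this[of 1] this[of 2]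
  have s: "H$j$i$k$l = H$i$j$k$l" "H$i$k$j$l = H$i$j$k$l" "H$i$j$l$k = H$i$j$k$l" for i j k l
    by (simp_all add: permute4_def vec_eq_iff Transposition.transpose_def eval_nat_numeral)
  have "H$2$1$k$l = H$1$2$k$l" "H$i$2$1$l = H$i$1$2$l" "H$i$j$2$1 = H$i$j$1$2" for i j k l
    by (simp_all only: s(1)[of 1 2] s(2)[of _ 1 2] s(3)[of _ _ 1 2])
  moreover have t: "H$2$2$k$l = - H$1$1$k$l" for k l
  proof -
    have "H$1$1$k$l + H$2$2$k$l = 0" using H unfolding Harm4_def sum_2 by blast
    then show ?thesis by linarith
  qed
  moreover have "H$1$1$2$2 = - H$1$1$1$1" "H$1$2$2$2 = - H$1$1$1$2"
    using t[of 1 1] t[of 1 2] calculation(1,2,3) by simp_all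
  ultimately show ?thesis
    by (cases i rule: exhaust_2[THEN disjE]; cases j rule: exhaust_2[THEN disjE];
        cases k rule: exhaust_2[THEN disjE]; cases l rule: exhaust_2[THEN disjE]) simp_all
qed

definition harm2 :: "real \<Rightarrow> real \<Rightarrow> tensor2" where
  "harm2 a b = (\<chi> i j. [a, b, - a] ! (idx i + idx j))"

definition harm4 :: "real \<Rightarrow> real \<Rightarrow> tensor4" where
  "harm4 a b = (\<chi> i j k l. [a, b, - a, - b, a] ! (idx i + idx j + idx k + idx l))"

lemma harm2: "harm2 a b \<in> Harm2" "h \<in> Harm2 \<Longrightarrow> h = harm2 (h$1$1) (h$1$2)"
  by (auto simp: Harm2_iff harm2_def vec_eq_iff forall_2)

lemma harm4: "harm4 a b \<in> Harm4" "H \<in> Harm4 \<Longrightarrow> H = harm4 (H$1$1$1$1) (H$1$1$1$2)"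
  subgoal by (rule Harm4I) (simp add: harm4_def)
  subgoal by (simp only: harm4_def vec_eq_iff vec_lambda_beta) (intro allI Harm4D)
  done

lemma harm2_eq [simp]: "harm2 a b = harm2 a' b' \<longleftrightarrow> a = a' \<and> b = b'"
  by (auto simp: harm2_def vec_eq_iff forall_2)

lemma harm4_eq [simp]: "harm4 a b = harm4 a' b' \<longleftrightarrow> a = a' \<and> b = b'"
  by (auto simp: harm4_def vec_eq_iff forall_2)

lemma Gel_iff:
  "P \<in> Gel \<longleftrightarrow> (\<forall>i j. P$2$1$i$j = P$1$2$i$j \<and> P$i$j$2$1 = P$i$j$1$2)"
  by (auto simp: Gel_def forall_2)

text \<open>Harmonic decompositions exist: \<open>witness_decomposition\<close> is obtained from the two
  traces \<open>P\<^sub>i\<^sub>i\<^sub>j\<^sub>j\<close>, \<open>P\<^sub>i\<^sub>j\<^sub>i\<^sub>j\<close>, the deviators of \<open>P\<^sub>i\<^sub>j\<^sub>k\<^sub>k\<close> and \<open>P\<^sub>k\<^sub>k\<^sub>i\<^sub>j\<close>, the pseudo-scalar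
  \<open>\<epsilon>\<^sub>j\<^sub>l P\<^sub>i\<^sub>j\<^sub>i\<^sub>l\<close> and (a multiple of) the harmonic part of order four.\<close>

definition witness_decomposition :: "tensor4 \<Rightarrow> harm" where
  "witness_decomposition P =
     (P$1$1$1$2 + P$1$2$2$2 - P$1$2$1$1 - P$2$2$1$2,
      P$1$1$1$1 + P$1$1$2$2 + P$2$2$1$1 + P$2$2$2$2,
      P$1$1$1$1 + 2 * P$1$2$1$2 + P$2$2$2$2,
      harm2 ((P$1$1$1$1 + P$1$1$2$2 - P$2$2$1$1 - P$2$2$2$2) / 2) (P$1$2$1$1 + P$1$2$2$2),
      harm2 ((P$1$1$1$1 + P$2$2$1$1 - P$1$1$2$2 - P$2$2$2$2) / 2) (P$1$1$1$2 + P$2$2$1$2),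
      harm4 (P$1$1$1$1 - P$1$1$2$2 - P$2$2$1$1 + P$2$2$2$2 - 4 * P$1$2$1$2)
          (2 * (P$1$1$1$2 - P$2$2$1$2 + P$1$2$1$1 - P$1$2$2$2)))"

lemma witness_decomposition_inj: "inj_on witness_decomposition Gel"
proof (rule inj_onI)
  fix P Q assume PQ: "P \<in> Gel" "Q \<in> Gel" and eq: "witness_decomposition P = witness_decomposition Q"
  have e: "P$1$1$1$2 + P$1$2$2$2 - P$1$2$1$1 - P$2$2$1$2 = Q$1$1$1$2 + Q$1$2$2$2 - Q$1$2$1$1 - Q$2$2$1$2"
    "P$1$1$1$1 + P$1$1$2$2 + P$2$2$1$1 + P$2$2$2$2 = Q$1$1$1$1 + Q$1$1$2$2 + Q$2$2$1$1 + Q$2$2$2$2"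
    "P$1$1$1$1 + 2 * P$1$2$1$2 + P$2$2$2$2 = Q$1$1$1$1 + 2 * Q$1$2$1$2 + Q$2$2$2$2"
    "P$1$1$1$1 + P$1$1$2$2 - P$2$2$1$1 - P$2$2$2$2 = Q$1$1$1$1 + Q$1$1$2$2 - Q$2$2$1$1 - Q$2$2$2$2"
    "P$1$2$1$1 + P$1$2$2$2 = Q$1$2$1$1 + Q$1$2$2$2"
    "P$1$1$1$1 + P$2$2$1$1 - P$1$1$2$2 - P$2$2$2$2 = Q$1$1$1$1 + Q$2$2$1$1 - Q$1$1$2$2 - Q$2$2$2$2"
    "P$1$1$1$2 + P$2$2$1$2 = Q$1$1$1$2 + Q$2$2$1$2"
    "P$1$1$1$1 - P$1$1$2$2 - P$2$2$1$1 + P$2$2$2$2 - 4 * P$1$2$1$2 =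
     Q$1$1$1$1 - Q$1$1$2$2 - Q$2$2$1$1 + Q$2$2$2$2 - 4 * Q$1$2$1$2"
    "P$1$1$1$2 - P$2$2$1$2 + P$1$2$1$1 - P$1$2$2$2 = Q$1$1$1$2 - Q$2$2$1$2 + Q$1$2$1$1 - Q$1$2$2$2"
    using eq by (auto simp: witness_decomposition_def)
  have 1: "P$1$1$1$1 = Q$1$1$1$1" using e(2,3,4,6,8) by linarith
  have 2: "P$1$1$2$2 = Q$1$1$2$2" "P$2$2$1$1 = Q$2$2$1$1"
    "P$2$2$2$2 = Q$2$2$2$2" "P$1$2$1$2 = Q$1$2$1$2" using e(2,3,4,6,8) by linarith+
  have 3: "P$1$1$1$2 = Q$1$1$1$2" "P$2$2$1$2 = Q$2$2$1$2" "P$1$2$1$1 = Q$1$2$1$1" "P$1$2$2$2 = Q$1$2$2$2"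
    using e(1,5,7,9) by linarith+
  show "P = Q" using PQ by (simp add: Gel_iff vec_eq_iff forall_2 1 2 3)
qed

lemma witness_decomposition_bij: "bij_betw witness_decomposition Gel Harm_sum"
proof (rule bij_betw_imageI[OF witness_decomposition_inj])
  show "witness_decomposition ` Gel = Harm_sum"
  proof (intro equalityI subsetI)
    fix w assume "w \<in> witness_decomposition ` Gel"
    then show "w \<in> Harm_sum"
      by (auto simp: witness_decomposition_def Harm_sum_def harm2 harm4)
  next
    fix w assume "w \<in> Harm_sum"
    then obtain \<xi> l m p q r t a b where
      w: "w = (\<xi>, l, m, harm2 p q, harm2 r t, harm4 a b)"
      by (auto simp: Harm_sum_def dest!: harm2(2) harm4(2))
    define S where "S = (a + l + 2 * m) / 4"
    define u where "u = (b / 2 + \<xi>) / 2"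
    define v where "v = (b / 2 - \<xi>) / 2"
    define P :: tensor4 where "P =
      (\<chi> i j k n.
         if i = j \<and> k = n then
           if i = 1 then if k = 1 then (S + p + r) / 2 else (l - S + p - r) / 2
           else if k = 1 then (l - S - p + r) / 2 else (S - p - r) / 2
         else if i = j then if i = 1 then (t + u) / 2 else (t - u) / 2
         else if k = n then if k = 1 then (q + v) / 2 else (q - v) / 2
         else (m - S) / 2)"
    have "P \<in> Gel" by (auto simp: Gel_def P_def)
    moreover have "witness_decomposition P = w"
      by (simp add: w witness_decomposition_def P_def) (simp add: S_def u_def v_def field_simps)
    ultimately show "w \<in> witness_decomposition ` Gel" by blast
  qed
qed

lemma O2_cases:
  assumes "g \<in> O2"
  obtains c s where "c\<^sup>2 + s\<^sup>2 = 1" "g$1$1 = c" "g$2$1 = s" "g$1$2 = - s" "g$2$2 = c"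
  | c s where "c\<^sup>2 + s\<^sup>2 = 1" "g$1$1 = c" "g$2$1 = s" "g$1$2 = s" "g$2$2 = - c"
proof -
  have 1: "g$1$1^2 + g$2$1^2 = 1" "g$1$2^2 + g$2$2^2 = 1" "g$1$1 * g$1$2 + g$2$1 * g$2$2 = 0"
    using assms
    by (auto simp: O2_def orthogonal_matrix matrix_matrix_mult_def transpose_def mat_def
        vec_eq_iff sum_2 forall_2 power2_eq_square)
  have "(g$1$2 = - g$2$1 \<and> g$2$2 = g$1$1) \<or> (g$1$2 = g$2$1 \<and> g$2$2 = - g$1$1)"
    using 1 by algebra
  then show ?thesis using 1 that by metis
qed

lemma act2_harm2:
  assumes "g \<in> O2"
  shows "act2 g (harm2 a b) = harm2 ((g$1$1^2 - g$1$2^2) * a + 2 * g$1$1 * g$1$2 * b)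
   ((g$1$1 * g$2$1 - g$1$2*g$2$2) * a + (g$1$1 * g$2$2 + g$1$2*g$2$1) * b)"
  using assms
proof (cases rule: O2_cases)
  case (1 c s)
  then show ?thesis
    by (simp add: act2_def harm2_def vec_eq_iff forall_2 sum_2) (simp add: algebra_simps power2_eq_square)
next
  case (2 c s)
  then show ?thesis
    by (simp add: act2_def harm2_def vec_eq_iff forall_2 sum_2) (simp add: algebra_simps power2_eq_square)
qed

lemma witness_decomposition_equivariant:
  assumes "g \<in> O2" "P \<in> Gel"
  shows "witness_decomposition (act4 g P) = act_harm g (witness_decomposition P)"
  using assms(1)
proof (cases rule: O2_cases)
  case (1 c s)
  have G: "P$2$1$i$j = P$1$2$i$j" "P$i$j$2$1 = P$i$j$1$2" for i j
    using assms by (auto simp: Gel_iff)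
  have 4: "act4 g (harm4 a b) = harm4 ((c^4 - 6 * c^2 * s^2 + s^4) * a - 4 * c * s * (c^2 - s^2) * b)
     ((c^4 - 6 * c^2 * s^2 + s^4) * b + 4 * c * s * (c^2 - s^2) * a)" for a b
    by (simp add: act4_def harm4_def vec_eq_iff forall_2 sum_2 1(2-) power4_eq_xxxx power2_eq_square) (simp add: algebra_simps)
  show ?thesis
    unfolding witness_decomposition_def act_harm_def prod.case 4 act2_harm2[OF assms(1)]
    apply (simp add: act4_def sum_2 G 1(2-) det_2)
    using 1(1)
    apply (intro conjI)
    apply (algebra | simp add: algebra_simps power4_eq_xxxx power2_eq_square)+
    done
next
  case (2 c s)
  have G: "P$2$1$i$j = P$1$2$i$j" "P$i$j$2$1 = P$i$j$1$2" for i j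
    using assms by (auto simp: Gel_iff)
  have 4: "act4 g (harm4 a b) = harm4 ((c^4 - 6 * c^2 * s^2 + s^4) * a + 4 * c * s * (c^2 - s^2) * b)
     (- (c^4 - 6 * c^2 * s^2 + s^4) * b + 4 * c * s * (c^2 - s^2) * a)" for a b
    by (simp add: act4_def harm4_def vec_eq_iff forall_2 sum_2 2(2-) power4_eq_xxxx power2_eq_square) (simp add: algebra_simps)
  show ?thesis
    unfolding witness_decomposition_def act_harm_def prod.case 4 act2_harm2[OF assms(1)]
    apply (simp add: act4_def sum_2 G 2(2-) det_2)
    using 2(1)
    apply (intro conjI)
    apply (algebra | simp add: algebra_simps power4_eq_xxxx power2_eq_square)+
    done
qed

lemma harmonic_decomposition_exists: "\<exists>\<Phi>. harmonic_decomposition \<Phi>"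
proof
  show "harmonic_decomposition witness_decomposition"
    unfolding harmonic_decomposition_def
  proof (intro conjI)
    have [simp]: "harm2 a b + harm2 a' b' = harm2 (a + a') (b + b')" for a a' b b'
      by (simp add: harm2_def vec_eq_iff forall_2)
    have [simp]: "harm4 a b + harm4 a' b' = harm4 (a + a') (b + b')" for a a' b b'
      by (simp add: harm4_def vec_eq_iff forall_2)
    have [simp]: "c *\<^sub>R harm2 a b = harm2 (c * a) (c * b)" for a b c
      by (simp add: harm2_def vec_eq_iff forall_2)
    have [simp]: "c *\<^sub>R harm4 a b = harm4 (c * a) (c * b)" for a b c
      by (simp add: harm4_def vec_eq_iff forall_2)
    show "\<forall>P\<in>Gel. \<forall>Q\<in>Gel. witness_decomposition (P + Q) = witness_decomposition P + witness_decomposition Q"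
      by (simp add: witness_decomposition_def add_divide_distrib diff_divide_distrib algebra_simps)
    show "\<forall>c. \<forall>P\<in>Gel. witness_decomposition (c *\<^sub>R P) = c *\<^sub>R witness_decomposition P"
      by (simp add: witness_decomposition_def algebra_simps)
  qed (use witness_decomposition_bij witness_decomposition_equivariant in auto)
qed

text \<open>A polynomial on a subspace \<open>W\<close> is represented by the corresponding function on \<open>W\<close>,
  extended by \<^const>\<open>undefined\<close>.\<close>

definition polynomials_on :: "'a::real_normed_vector set \<Rightarrow> ('a \<Rightarrow> real) set" where
  "polynomials_on W = {restrict p W | p. real_polynomial_function p}"

definition Inv ::
  "'a::real_normed_vector set \<Rightarrow> ('g \<Rightarrow> 'a \<Rightarrow> 'a) \<Rightarrow> 'g set \<Rightarrow> ('a \<Rightarrow> real) set" where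
  "Inv W \<rho> G = {f \<in> polynomials_on W. \<forall>g\<in>G. \<forall>v\<in>W. f (\<rho> g v) = f v}"

definition Cov ::
  "'a::real_normed_vector set \<Rightarrow> (real^2^2 \<Rightarrow> 'a \<Rightarrow> 'a) \<Rightarrow> (real^2^2) set
     \<Rightarrow> ('a \<times> (real^2) \<Rightarrow> real) set" where
  "Cov V \<rho> G = Inv (V \<times> UNIV) (\<lambda>g (v, x). (\<rho> g v, g *v x)) G"

inductive_set generated_algebra ::
  "'a set \<Rightarrow> ('a \<Rightarrow> real) set \<Rightarrow> ('a \<Rightarrow> real) set" for W S where
  gen: "f \<in> S \<Longrightarrow> f \<in> generated_algebra W S"
| const: "restrict (\<lambda>_. c) W \<in> generated_algebra W S"
| add: "f \<in> generated_algebra W S \<Longrightarrow> g \<in> generated_algebra W S \<Longrightarrow>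
    restrict (\<lambda>v. f v + g v) W \<in> generated_algebra W S"
| mult: "f \<in> generated_algebra W S \<Longrightarrow> g \<in> generated_algebra W S \<Longrightarrow>
    restrict (\<lambda>v. f v * g v) W \<in> generated_algebra W S"

definition homogeneous_on :: "'a::real_vector set \<Rightarrow> ('a \<Rightarrow> real) \<Rightarrow> bool" where
  "homogeneous_on W f \<longleftrightarrow> (\<exists>d::nat. \<forall>v\<in>W. \<forall>t. f (t *\<^sub>R v) = t ^ d * f v)"

definition integrity_basis ::
  "'a::real_vector set \<Rightarrow> ('a \<Rightarrow> real) set \<Rightarrow> ('a \<Rightarrow> real) set \<Rightarrow> bool" where
  "integrity_basis W A S \<longleftrightarrow>
     finite S \<and> S \<subseteq> A \<and> (\<forall>f\<in>S. homogeneous_on W f) \<and> generated_algebra W S = A"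

definition minimal_integrity_basis ::
  "'a::real_vector set \<Rightarrow> ('a \<Rightarrow> real) set \<Rightarrow> ('a \<Rightarrow> real) set \<Rightarrow> bool" where
  "minimal_integrity_basis W A S \<longleftrightarrow>
     integrity_basis W A S \<and> (\<forall>T. T \<subset> S \<longrightarrow> generated_algebra W T \<noteq> A)"

definition has_order :: "'a set \<Rightarrow> nat \<Rightarrow> ('a \<times> (real^2) \<Rightarrow> real) \<Rightarrow> bool" where
  "has_order V n c \<longleftrightarrow> (\<forall>v\<in>V. \<forall>x t. c (v, t *\<^sub>R x) = t ^ n * c (v, x))"

text \<open>The value of a family at \<open>(\<xi>, \<lambda>, \<mu>, h\<^sub>1, h\<^sub>2, H)\<close> is the triple of the lists of its
  members of order 0, 2 and 4.\<close>

type_synonym family = "harm \<Rightarrow> real list \<times> tensor2 list \<times> tensor4 list"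

definition famA :: family where
  "famA = (\<lambda>(\<xi>, l, m, h1, h2, H).
     ([l, m, h1 \<bullet>\<^sub>2 h1, h2 \<bullet>\<^sub>2 h2, H \<bullet>\<^sub>4 H, h1 \<bullet>\<^sub>2 h2,
       h1 \<bullet>\<^sub>2 (H \<odot> h1), h2 \<bullet>\<^sub>2 (H \<odot> h2), h1 \<bullet>\<^sub>2 (H \<odot> h2)],
      [mat 1, h1, h2, H \<odot> h1, H \<odot> h2],
      [H]))"

definition famB :: family where
  "famB = (\<lambda>(\<xi>, l, m, h1, h2, H).
     ([\<xi>, h1 \<bullet>\<^sub>2 cross2 (mat 1) h2, h1 \<bullet>\<^sub>2 (H \<odot> cross2 (mat 1) h1),
       h2 \<bullet>\<^sub>2 (H \<odot> cross2 (mat 1) h2), h1 \<bullet>\<^sub>2 (H \<odot> cross2 (mat 1) h2)],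
      [cross2 (mat 1) h1, cross2 (mat 1) h2, H \<odot> cross2 (mat 1) h1, H \<odot> cross2 (mat 1) h2],
      [cross4 (mat 1) H]))"

definition famC :: family where
  "famC = (\<lambda>(\<xi>, l, m, h1, h2, H).
     ([\<xi>\<^sup>2, \<xi> * (h1 \<bullet>\<^sub>2 cross2 (mat 1) h2), \<xi> * (h1 \<bullet>\<^sub>2 (H \<odot> cross2 (mat 1) h1)),
       \<xi> * (h2 \<bullet>\<^sub>2 (H \<odot> cross2 (mat 1) h2)), \<xi> * (h1 \<bullet>\<^sub>2 (H \<odot> cross2 (mat 1) h2))],
      [\<xi> *\<^sub>R cross2 (mat 1) h1, \<xi> *\<^sub>R cross2 (mat 1) h2,
       \<xi> *\<^sub>R (H \<odot> cross2 (mat 1) h1), \<xi> *\<^sub>R (H \<odot> cross2 (mat 1) h2)],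
      [\<xi> *\<^sub>R cross4 (mat 1) H]))"

text \<open>A tensor-valued covariant \<open>c\<close> is identified with the polynomial \<open>c(x, \<dots>, x)\<close>.\<close>

definition form_values :: "family \<Rightarrow> harm \<Rightarrow> real^2 \<Rightarrow> real list" where
  "form_values F w x = (case F w of (c0, c2, c4) \<Rightarrow>
     c0 @ map (\<lambda>T. form2 T x) c2 @ map (\<lambda>T. form4 T x) c4)"

definition covariants ::
  "nat \<Rightarrow> family \<Rightarrow> (tensor4 \<Rightarrow> harm) \<Rightarrow> (tensor4 \<times> (real^2) \<Rightarrow> real) list" where
  "covariants n F \<Phi> =
     map (\<lambda>k. restrict (\<lambda>(P, x). form_values F (\<Phi> P) x ! k) (Gel \<times> UNIV)) [0..<n]"

definition covA :: "(tensor4 \<Rightarrow> harm) \<Rightarrow> (tensor4 \<times> (real^2) \<Rightarrow> real) list" where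
  "covA = covariants 15 famA"

definition covB :: "(tensor4 \<Rightarrow> harm) \<Rightarrow> (tensor4 \<times> (real^2) \<Rightarrow> real) list" where
  "covB = covariants 10 famB"

definition covC :: "(tensor4 \<Rightarrow> harm) \<Rightarrow> (tensor4 \<times> (real^2) \<Rightarrow> real) list" where
  "covC = covariants 10 famC"

definition z1 :: "real^2 \<Rightarrow> complex" where
  "z1 x = Complex (x$1) (x$2)"

definition z2 :: "tensor2 \<Rightarrow> complex" where
  "z2 h = (THE w. \<forall>x. form2 h x = Re (cnj w * z1 x ^ 2))"

definition z4 :: "tensor4 \<Rightarrow> complex" where
  "z4 H = (THE w. \<forall>x. form4 H x = Re (cnj w * z1 x ^ 4))"

text \<open>\<open>z * cnj z\<close> is written \<open>Re (z * cnj z)\<close>, since the values are real numbers.\<close>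

definition cplxA :: "harm \<Rightarrow> real^2 \<Rightarrow> real list" where
  "cplxA = (\<lambda>(\<xi>, l, m, h1, h2, H) x. let z = z1 x; za = z2 h1; zb = z2 h2; zH = z4 H in
     [l, m, Re (za * cnj za), Re (zb * cnj zb), Re (zH * cnj zH), Re (za * cnj zb),
      Re (za^2 * cnj zH), Re (zb^2 * cnj zH), Re (za * zb * cnj zH),
      Re (z * cnj z), Re (cnj za * z^2), Re (cnj zb * z^2),
      Re (za * cnj zH * z^2), Re (zb * cnj zH * z^2),
      Re (cnj zH * z^4)])"

definition cplxB :: "harm \<Rightarrow> real^2 \<Rightarrow> real list" where
  "cplxB = (\<lambda>(\<xi>, l, m, h1, h2, H) x. let z = z1 x; za = z2 h1; zb = z2 h2; zH = z4 H in
     [\<xi>, Im (za * cnj zb), Im (za^2 * cnj zH), Im (zb^2 * cnj zH), Im (za * zb * cnj zH),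
      Im (cnj za * z^2), Im (cnj zb * z^2), Im (za * cnj zH * z^2), Im (zb * cnj zH * z^2),
      Im (cnj zH * z^4)])"

definition cplxC :: "harm \<Rightarrow> real^2 \<Rightarrow> real list" where
  "cplxC w x = map (\<lambda>c. fst w * c) (cplxB w x)"

definition complex_form ::
  "(tensor4 \<times> (real^2) \<Rightarrow> real) list \<Rightarrow> (harm \<Rightarrow> real^2 \<Rightarrow> real list) \<Rightarrow> (tensor4 \<Rightarrow> harm) \<Rightarrow> bool" where
  "complex_form cs Z \<Phi> \<longleftrightarrow>
     (\<forall>k<length cs. \<exists>c. c \<noteq> 0 \<and> (\<forall>P\<in>Gel. \<forall>x. (cs ! k) (P, x) = c * Z (\<Phi> P) x ! k))"

end

theory Submission
  imports Defs "HOL-Computational_Algebra.Polynomial"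
begin

text \<open>In complex coordinates the rotation by a unit complex number \<open>u\<close> multiplies \<open>z\<close>
  by \<open>u\<close>, \<open>z\<^sub>2\<^sub>a\<close> and \<open>z\<^sub>2\<^sub>b\<close> by
  \<open>u\<^sup>2\<close>, and \<open>z\<^sub>4\<close> by \<open>u\<^sup>4\<close>, and fixes
  \<open>\<xi>, \<lambda>, \<mu>\<close>. Hence every monomial in the coordinates and their conjugates has a weight,
  and a polynomial is invariant under rotations iff only monomials of weight 0 occur in it
  (\<open>weight_zero_part\<close>, \<open>invariant_in_cSO2\<close>). With the letters
  \<open>z\<^sub>2\<^sub>a, z\<^sub>2\<^sub>b, z\<^sup>2\<close> of weight 2, such a monomial is a product of
  \<open>\<xi>, \<lambda>, \<mu>\<close> and of factors \<open>z * cnj z\<close>,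
  \<open>z\<^sub>4 * cnj z\<^sub>4\<close>, \<open>p * cnj q\<close>, \<open>p * q * cnj z\<^sub>4\<close> with
  letters \<open>p, q\<close>, and their conjugates (\<open>balanced_monomial\<close>). The real parts of these
  factors are generated by (A), the imaginary parts by (B), which proves that (A) and (B) generate the covariants of
  \<open>SO(2)\<close> (\<open>algSO2_eq\<close>).

  A reflection conjugates the complex coordinates and negates \<open>\<xi>\<close>, so (A) is even and (B) is odd. The
  product of two odd generators is a polynomial in (A) and (C) (\<open>polyB_mult\<close>); this uses that there are
  only three letters, so that two monomials have a letter in common or can be regrouped until they do. Therefore every
  covariant of \<open>SO(2)\<close> is an element of the algebra generated by (A) and (C) plus an odd one, and the odd
  part of a covariant of \<open>O(2)\<close> vanishes (\<open>even_odd_decomposition\<close>,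
  \<open>algO2_eq\<close>).

  For minimality, a curve with suitable weights of the coordinates turns every generator except \<open>\<xi>\<close>
  and \<open>\<xi>\<^sup>2\<close> into a monomial \<open>c * t ^ n\<close> whose exponent is not a sum of two nonzero
  exponents; the choice of phases separates real from imaginary parts, and the two exceptions are treated on the line
  where all other coordinates vanish (\<open>curve_separates\<close>, \<open>independent_generators\<close>). The same
  fact shows that the generators are distinct and nonzero, which yields the numbers 25 and 14.\<close>

section \<open>Harmonic tensors as complex numbers\<close>

text \<open>The component of order \<open>n\<close> of a harmonic tensor is a complex number: \<open>cx2 w\<close> and
  \<open>cx4 w\<close> are the tensors whose forms are \<open>Re (cnj w * z ^ n)\<close> for \<open>n = 2, 4\<close>.
  All contractions of the theorem turn into products of complex numbers.\<close>

definition cx2 :: "complex \<Rightarrow> tensor2" where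
  "cx2 w = harm2 (Re w) (Im w)"

definition cx4 :: "complex \<Rightarrow> tensor4" where
  "cx4 w = harm4 (Re w) (Im w)"

lemma Harm2_cx2: "h \<in> Harm2 \<longleftrightarrow> (\<exists>w. h = cx2 w)"
  by (metis cx2_def harm2 complex.sel)

lemma Harm4_cx4: "H \<in> Harm4 \<longleftrightarrow> (\<exists>w. H = cx4 w)"
  by (metis cx4_def harm4 complex.sel)

lemma cx2_eq [simp]: "cx2 v = cx2 w \<longleftrightarrow> v = w"
  by (simp add: cx2_def complex_eq_iff)

lemma cx4_eq [simp]: "cx4 v = cx4 w \<longleftrightarrow> v = w"
  by (simp add: cx4_def complex_eq_iff)

lemma cx2_linear: "cx2 v + cx2 w = cx2 (v + w)" "c *\<^sub>R cx2 w = cx2 (c *\<^sub>R w)"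
  by (simp_all add: cx2_def harm2_def vec_eq_iff forall_2)

lemma cx4_linear: "cx4 v + cx4 w = cx4 (v + w)" "c *\<^sub>R cx4 w = cx4 (c *\<^sub>R w)"
  by (simp_all add: cx4_def harm4_def vec_eq_iff forall_2)

lemma form2_cx2: "form2 (cx2 w) x = Re (cnj w * z1 x ^ 2)"
  by (simp add: form2_def cx2_def harm2_def sum_2 z1_def power2_eq_square) (simp add: algebra_simps)

lemma form4_cx4: "form4 (cx4 w) x = Re (cnj w * z1 x ^ 4)"
  by (simp add: form4_def cx4_def harm4_def sum_2 z1_def power4_eq_xxxx) (simp add: algebra_simps)

lemma z1_surj: "\<exists>x. z1 x = z"
  by (rule exI[of _ "vector [Re z, Im z]"]) (simp add: z1_def vector_def)

text \<open>Every complex number is an \<open>n\<close>-th power, so the form determines the linear functional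
  \<open>Re (cnj w * _)\<close> and hence \<open>w\<close>. This is the uniqueness behind the definite descriptions
  \<^const>\<open>z2\<close> and \<^const>\<open>z4\<close>.\<close>

lemma Re_cnj_power_inject:
  assumes "n > 0" and "\<And>x. Re (cnj v * z1 x ^ n) = Re (cnj w * z1 x ^ n)"
  shows "v = w"
proof -
  have "Re (cnj v * u) = Re (cnj w * u)" for u
  proof -
    obtain r where "u = r ^ n"
      by (rule exists_complex_root[of n u]) (use assms(1) in auto)
    then show ?thesis using assms(2) z1_surj[of r] by metis
  qed
  from this[of 1] this[of \<i>] show ?thesis by (simp add: complex_eq_iff)
qed

lemma z2_cx2 [simp]: "z2 (cx2 w) = w"
  unfolding z2_def form2_cx2 by (rule the_equality) (use Re_cnj_power_inject[of 2] in auto)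

lemma z4_cx4 [simp]: "z4 (cx4 w) = w"
  unfolding z4_def form4_cx4 by (rule the_equality) (use Re_cnj_power_inject[of 4] in auto)

lemma contract2_cx2: "cx2 v \<bullet>\<^sub>2 cx2 w = 2 * Re (v * cnj w)"
  by (simp add: contract2_def cx2_def harm2_def sum_2)

lemma contract4_cx4: "cx4 v \<bullet>\<^sub>4 cx4 w = 8 * Re (v * cnj w)"
  by (simp add: contract4_def cx4_def harm4_def sum_2)

lemma contract42_cx: "cx4 w \<odot> cx2 v = cx2 (2 * w * cnj v)"
  by (simp add: contract42_def cx4_def cx2_def harm4_def harm2_def sum_2 vec_eq_iff forall_2)

text \<open>The product with \<open>\<epsilon>\<close> maps harmonic tensors to harmonic, hence already symmetric,
  ones, so the symmetrization in the generalized cross product has no effect on them; what remains is multiplication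
  by \<open>\<i>\<close>.\<close>

lemma symmetrize2_Harm2:
  assumes "T \<in> Harm2"
  shows "symmetrize2 T = T"
proof -
  have "(\<Sum>p | p permutes {..<2::nat}. permute2 p T) = (\<Sum>p | p permutes {..<2::nat}. T)"
    using assms by (intro sum.cong) (auto simp: Harm2_def)
  also have "\<dots> = fact 2 *\<^sub>R T"
    by (simp add: card_permutations[of _ 2] sum_constant_scaleR fact_numeral del: sum_constant)
  finally show ?thesis by (simp add: symmetrize2_def)
qed

lemma symmetrize4_Harm4:
  assumes "T \<in> Harm4"
  shows "symmetrize4 T = T"
proof -
  have "(\<Sum>p | p permutes {..<4::nat}. permute4 p T) = (\<Sum>p | p permutes {..<4::nat}. T)"
    using assms by (intro sum.cong) (auto simp: Harm4_def)
  also have "\<dots> = fact 4 *\<^sub>R T"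
    by (simp add: card_permutations[of _ 4] sum_constant_scaleR fact_numeral del: sum_constant)
  finally show ?thesis by (simp add: symmetrize4_def)
qed

lemma cross2_cx2: "cross2 (mat 1) (cx2 w) = cx2 (\<i> * w)"
proof -
  have "(\<chi> i j. \<Sum>m\<in>UNIV. \<Sum>n\<in>UNIV. mat 1$i$m * levi_civita$m$n * cx2 w$n$j) = cx2 (- \<i> * w)"
    by (simp add: cx2_def harm2_def levi_civita_def mat_def sum_2 vec_eq_iff forall_2)
  moreover have "symmetrize2 (cx2 (- \<i> * w)) = cx2 (- \<i> * w)"
    by (rule symmetrize2_Harm2) (auto simp: Harm2_cx2)
  moreover have "- cx2 (- \<i> * w) = cx2 (\<i> * w)"
    by (simp add: cx2_def harm2_def vec_eq_iff forall_2)
  ultimately show ?thesis by (simp add: cross2_def)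
qed

lemma cross4_cx4: "cross4 (mat 1) (cx4 w) = cx4 (\<i> * w)"
proof -
  have "(\<chi> i j k l. \<Sum>m\<in>UNIV. \<Sum>n\<in>UNIV. mat 1$i$m * levi_civita$m$n * cx4 w$n$j$k$l) = cx4 (- \<i> * w)"
    by (simp add: cx4_def harm4_def levi_civita_def mat_def sum_2 vec_eq_iff forall_2)
  moreover have "symmetrize4 (cx4 (- \<i> * w)) = cx4 (- \<i> * w)"
    by (rule symmetrize4_Harm4) (auto simp: Harm4_cx4)
  moreover have "- cx4 (- \<i> * w) = cx4 (\<i> * w)"
    by (simp add: cx4_def harm4_def vec_eq_iff forall_2)
  ultimately show ?thesis by (simp add: cross4_def)
qed

text \<open>The rotation by the unit complex number \<open>u\<close> multiplies the coordinate of a harmonic tensor of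
  order \<open>n\<close> by \<open>u ^ n\<close>; a reflection conjugates it in addition.\<close>

lemma act_cx_rotation:
  assumes "g$1$1 = Re u" "g$2$1 = Im u" "g$1$2 = - Im u" "g$2$2 = Re u"
  shows "act2 g (cx2 w) = cx2 (u ^ 2 * w)" "act4 g (cx4 w) = cx4 (u ^ 4 * w)"
    and "z1 (g *v x) = u * z1 x"
  subgoal
    by (simp add: act2_def cx2_def harm2_def vec_eq_iff forall_2 sum_2 assms power2_eq_square)
       (simp add: algebra_simps)
  subgoal
    by (simp add: act4_def cx4_def harm4_def vec_eq_iff forall_2 sum_2 assms power4_eq_xxxx)
       (simp add: algebra_simps)
  subgoal by (simp add: z1_def matrix_vector_mult_def sum_2 assms complex_eq_iff)
  done

lemma act_cx_reflection:
  assumes "g$1$1 = Re u" "g$2$1 = Im u" "g$1$2 = Im u" "g$2$2 = - Re u"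
  shows "act2 g (cx2 w) = cx2 (u ^ 2 * cnj w)" "act4 g (cx4 w) = cx4 (u ^ 4 * cnj w)"
    and "z1 (g *v x) = u * cnj (z1 x)"
  subgoal
    by (simp add: act2_def cx2_def harm2_def vec_eq_iff forall_2 sum_2 assms power2_eq_square)
       (simp add: algebra_simps)
  subgoal
    by (simp add: act4_def cx4_def harm4_def vec_eq_iff forall_2 sum_2 assms power4_eq_xxxx)
       (simp add: algebra_simps)
  subgoal by (simp add: z1_def matrix_vector_mult_def sum_2 assms complex_eq_iff)
  done

definition hcx :: "real \<Rightarrow> real \<Rightarrow> real \<Rightarrow> complex \<Rightarrow> complex \<Rightarrow> complex \<Rightarrow> harm" where
  "hcx \<xi> l m a b w = (\<xi>, l, m, cx2 a, cx2 b, cx4 w)"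

lemma hcx_eq [simp]:
  "hcx \<xi> l m a b w = hcx \<xi>' l' m' a' b' w' \<longleftrightarrow>
     \<xi> = \<xi>' \<and> l = l' \<and> m = m' \<and> a = a' \<and> b = b' \<and> w = w'"
  by (simp add: hcx_def)

lemma hcx_linear:
  "hcx \<xi> l m a b w + hcx \<xi>' l' m' a' b' w' =
     hcx (\<xi> + \<xi>') (l + l') (m + m') (a + a') (b + b') (w + w')"
  "c *\<^sub>R hcx \<xi> l m a b w = hcx (c * \<xi>) (c * l) (c * m) (c *\<^sub>R a) (c *\<^sub>R b) (c *\<^sub>R w)"
  by (simp_all add: hcx_def cx2_linear cx4_linear)

lemma Harm_sum_hcx: "h \<in> Harm_sum \<longleftrightarrow> (\<exists>\<xi> l m a b w. h = hcx \<xi> l m a b w)"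
  by (auto simp: Harm_sum_def hcx_def Harm2_cx2 Harm4_cx4)

text \<open>The ratios between the contractions of tensors and the complex expressions: the 16 components of
  \<open>cx4 w\<close> are \<open>\<plusminus> Re w\<close> and \<open>\<plusminus> Im w\<close>, eight of each,
  whence the factor 8 of \<open>H :: H\<close>; an inner product of two second-order tensors gives a factor 2, and so
  does a contraction \<open>H : h\<close>. The signs in \<open>consts_B\<close> come from
  \<open>cnj (\<i> * w) = - \<i> * cnj w\<close>.\<close>

definition consts_A :: "real list" where
  "consts_A = [1, 1, 2, 2, 8, 2, 4, 4, 4, 1, 1, 1, 2, 2, 1]"

definition consts_B :: "real list" where
  "consts_B = [1, 2, -4, -4, -4, 1, 1, -2, -2, 1]"

lemma form2_mat_1: "form2 (mat 1) x = Re (z1 x * cnj (z1 x))"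
  by (simp add: form2_def mat_def sum_2 z1_def)

lemma cx_forms:
  assumes "h \<in> Harm_sum"
  shows "form_values famA h x = map2 (*) consts_A (cplxA h x)"
    and "form_values famB h x = map2 (*) consts_B (cplxB h x)"
    and "form_values famC h x = map2 (*) consts_B (cplxC h x)"
proof -
  obtain \<xi> l m a b w where h: "h = hcx \<xi> l m a b w" using assms Harm_sum_hcx by blast
  note defs = h hcx_def form_values_def famA_def famB_def famC_def cplxA_def cplxB_def cplxC_def consts_A_def consts_B_def
    Let_def cross2_cx2 cross4_cx4 contract42_cx contract2_cx2 contract4_cx4 cx2_linear cx4_linear form2_cx2 form4_cx4 form2_mat_1
  show "form_values famA h x = map2 (*) consts_A (cplxA h x)"
    by (simp add: defs) (simp add: algebra_simps power2_eq_square)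
  show "form_values famB h x = map2 (*) consts_B (cplxB h x)"
    by (simp add: defs) (simp add: algebra_simps power2_eq_square)
  show "form_values famC h x = map2 (*) consts_B (cplxC h x)"
    by (simp add: defs) (simp add: algebra_simps power2_eq_square)
qed

section \<open>Algebras of functions\<close>

text \<open>Closure under the operations of \<^const>\<open>generated_algebra\<close>. Generated algebras, polynomials
  and invariants are all instances, so membership in them is derived in the same way.\<close>

definition function_algebra :: "'a set \<Rightarrow> ('a \<Rightarrow> real) set \<Rightarrow> bool" where
  "function_algebra W A \<longleftrightarrow> (\<forall>c. restrict (\<lambda>_. c) W \<in> A) \<and>
     (\<forall>f\<in>A. \<forall>g\<in>A. restrict (\<lambda>v. f v + g v) W \<in> A \<and> restrict (\<lambda>v. f v * g v) W \<in> A)"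

lemma algebra_generated: "function_algebra W (generated_algebra W S)"
  by (auto simp: function_algebra_def intro: generated_algebra.intros)

lemma generated_algebra_subset:
  assumes "function_algebra W A" "S \<subseteq> A"
  shows "generated_algebra W S \<subseteq> A"
proof
  fix f assume "f \<in> generated_algebra W S"
  then show "f \<in> A"
    by induction (use assms in \<open>unfold function_algebra_def, blast+\<close>)
qed

lemma function_algebra_polynomials: "function_algebra W (polynomials_on W)"
proof -
  have "restrict (\<lambda>v. restrict p W v + restrict q W v) W = restrict (\<lambda>v. p v + q v) W"
    "restrict (\<lambda>v. restrict p W v * restrict q W v) W = restrict (\<lambda>v. p v * q v) W"
    for p q :: "'a \<Rightarrow> real"
    by (auto intro: restrict_ext)
  then show ?thesis
    unfolding function_algebra_def polynomials_on_def
    by (fastforce intro: real_polynomial_function.intros)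
qed

lemma function_algebra_Inv:
  assumes "\<And>g v. g \<in> G \<Longrightarrow> v \<in> W \<Longrightarrow> \<rho> g v \<in> W"
  shows "function_algebra W (Inv W \<rho> G)"
  using function_algebra_polynomials[of W] assms
  by (auto simp: function_algebra_def Inv_def)

context
  fixes W :: "'a set" and A
  assumes A: "function_algebra W A"
begin

lemma alg_const: "restrict (\<lambda>_. c) W \<in> A"
  using A by (simp add: function_algebra_def)

lemma alg_add: "restrict f W \<in> A \<Longrightarrow> restrict g W \<in> A \<Longrightarrow> restrict (\<lambda>v. f v + g v) W \<in> A"
proof -
  assume "restrict f W \<in> A" "restrict g W \<in> A"
  then have "restrict (\<lambda>v. restrict f W v + restrict g W v) W \<in> A"
    using A unfolding function_algebra_def by blast
  also have "restrict (\<lambda>v. restrict f W v + restrict g W v) W = restrict (\<lambda>v. f v + g v) W"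
    by (auto intro: restrict_ext)
  finally show ?thesis .
qed

lemma alg_mult: "restrict f W \<in> A \<Longrightarrow> restrict g W \<in> A \<Longrightarrow> restrict (\<lambda>v. f v * g v) W \<in> A"
proof -
  assume "restrict f W \<in> A" "restrict g W \<in> A"
  then have "restrict (\<lambda>v. restrict f W v * restrict g W v) W \<in> A"
    using A unfolding function_algebra_def by blast
  also have "restrict (\<lambda>v. restrict f W v * restrict g W v) W = restrict (\<lambda>v. f v * g v) W"
    by (auto intro: restrict_ext)
  finally show ?thesis .
qed

lemma alg_cmult: "restrict f W \<in> A \<Longrightarrow> restrict (\<lambda>v. c * f v) W \<in> A"
  using alg_mult[OF alg_const] .

lemma alg_uminus: "restrict f W \<in> A \<Longrightarrow> restrict (\<lambda>v. - f v) W \<in> A"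
  using alg_cmult[of f "-1"] by simp

lemma alg_diff: "restrict f W \<in> A \<Longrightarrow> restrict g W \<in> A \<Longrightarrow> restrict (\<lambda>v. f v - g v) W \<in> A"
  using alg_add[OF _ alg_uminus, of f g] by simp

end

text \<open>The tool for minimality. Along a curve on which every generator is a monomial \<open>c * t ^ n\<close>,
  the functions generated by all generators but one become polynomials in \<open>t\<close> with exponents in the
  monoid \<open>M\<close>. If the remaining generator has an exponent outside \<open>M\<close>, it is not among
  them.\<close>

lemma curve_separates:
  fixes fs :: "('a \<Rightarrow> real) list" and \<gamma> :: "real \<Rightarrow> 'a"
  assumes \<gamma>: "\<And>t. \<gamma> t \<in> W"
    and M: "0 \<in> M" "\<And>m n. m \<in> M \<Longrightarrow> n \<in> M \<Longrightarrow> m + n \<in> M"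
    and vals: "\<And>k t. k < length fs \<Longrightarrow> (fs ! k) (\<gamma> t) = cs ! k * t ^ (ns ! k)"
    and s: "s < length fs" "cs ! s \<noteq> 0" "ns ! s \<notin> M"
    and others: "\<And>k. k < length fs \<Longrightarrow> k \<noteq> s \<Longrightarrow> cs ! k = 0 \<or> ns ! k \<in> M"
  shows "fs ! s \<notin> generated_algebra W {fs ! k | k. k < length fs \<and> k \<noteq> s}"
proof
  have *: "\<exists>p. (\<forall>t. f (\<gamma> t) = poly p t) \<and> (\<forall>n. coeff p n \<noteq> 0 \<longrightarrow> n \<in> M)"
    if "f \<in> generated_algebra W {fs ! k | k. k < length fs \<and> k \<noteq> s}" for f
    using that
  proof induction
    case (gen f)
    then obtain k where k: "k < length fs" "k \<noteq> s" "f = fs ! k" by blast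
    show ?case
      by (rule exI[of _ "monom (cs ! k) (ns ! k)"])
        (use k vals others in \<open>auto simp: poly_monom coeff_monom split: if_splits\<close>)
  next
    case (const c)
    show ?case
      by (rule exI[of _ "[:c:]"]) (use \<gamma> M in \<open>auto simp: coeff_pCons split: nat.splits\<close>)
  next
    case (add f g)
    then obtain p q where pq: "\<forall>t. f (\<gamma> t) = poly p t" "\<forall>n. coeff p n \<noteq> 0 \<longrightarrow> n \<in> M"
      "\<forall>t. g (\<gamma> t) = poly q t" "\<forall>n. coeff q n \<noteq> 0 \<longrightarrow> n \<in> M" by blast
    have "n \<in> M" if "coeff (p + q) n \<noteq> 0" for n
      using that pq(2,4) by (cases "coeff p n = 0") auto
    then show ?case
      by (intro exI[of _ "p + q"]) (use \<gamma> pq in auto)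
  next
    case (mult f g)
    then obtain p q where pq: "\<forall>t. f (\<gamma> t) = poly p t" "\<forall>n. coeff p n \<noteq> 0 \<longrightarrow> n \<in> M"
      "\<forall>t. g (\<gamma> t) = poly q t" "\<forall>n. coeff q n \<noteq> 0 \<longrightarrow> n \<in> M" by blast
    have "n \<in> M" if "coeff (p * q) n \<noteq> 0" for n
    proof -
      from that have "(\<Sum>i\<le>n. coeff p i * coeff q (n - i)) \<noteq> 0" by (simp add: coeff_mult)
      then obtain i where "i \<in> {..n}" and c: "coeff p i * coeff q (n - i) \<noteq> 0"
        by (rule sum.not_neutral_contains_not_neutral)
      then have "i \<le> n" by simp
      have "i + (n - i) \<in> M" using c pq(2,4) by (intro M(2)) auto
      then show ?thesis using \<open>i \<le> n\<close> by simp
    qed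
    then show ?case
      by (intro exI[of _ "p * q"]) (use \<gamma> pq in auto)
  qed
  assume "fs ! s \<in> generated_algebra W {fs ! k | k. k < length fs \<and> k \<noteq> s}"
  from *[OF this] obtain p where p: "\<forall>t. (fs ! s) (\<gamma> t) = poly p t" "\<forall>n. coeff p n \<noteq> 0 \<longrightarrow> n \<in> M"
    by blast
  have "poly p = poly (monom (cs ! s) (ns ! s))"
    using p(1) vals s(1) by (auto simp: poly_monom fun_eq_iff)
  then have "coeff p (ns ! s) = cs ! s" by (simp add: poly_eq_poly_eq_iff)
  then show False using p(2) s by auto
qed

lemma independent_list:
  assumes "\<And>s. s < length fs \<Longrightarrow> fs ! s \<notin> generated_algebra W {fs ! k | k. k < length fs \<and> k \<noteq> s}"
  shows "distinct fs" and "\<And>T. T \<subset> set fs \<Longrightarrow> generated_algebra W T \<noteq> generated_algebra W (set fs)"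
    and "\<And>c. restrict (\<lambda>_. c) W \<notin> set fs"
proof -
  show "distinct fs"
    unfolding distinct_conv_nth
  proof (intro allI impI notI)
    fix i j assume "i < length fs" "j < length fs" "i \<noteq> j" "fs ! i = fs ! j"
    then show False using assms[of i] by (auto intro!: generated_algebra.gen)
  qed
  show "generated_algebra W T \<noteq> generated_algebra W (set fs)" if T: "T \<subset> set fs" for T
  proof
    assume eq: "generated_algebra W T = generated_algebra W (set fs)"
    obtain f where "f \<in> set fs" "f \<notin> T" using T by blast
    then obtain s where s: "s < length fs" "fs ! s \<notin> T" by (auto simp: in_set_conv_nth)
    then have "T \<subseteq> {fs ! k | k. k < length fs \<and> k \<noteq> s}"
      using T unfolding psubset_eq subset_iff in_set_conv_nth by blast
    then have "generated_algebra W T \<subseteq> generated_algebra W {fs ! k | k. k < length fs \<and> k \<noteq> s}"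
      by (intro generated_algebra_subset algebra_generated) (auto intro: generated_algebra.gen)
    moreover have "fs ! s \<in> generated_algebra W T"
      unfolding eq using s by (auto intro: generated_algebra.gen)
    ultimately show False using assms[OF s(1)] by blast
  qed
  show "restrict (\<lambda>_. c) W \<notin> set fs" for c
  proof
    assume "restrict (\<lambda>_. c) W \<in> set fs"
    then obtain s where "s < length fs" "fs ! s = restrict (\<lambda>_. c) W" by (auto simp: in_set_conv_nth)
    then show False using assms[of s] generated_algebra.const[of c W] by simp
  qed
qed

text \<open>Complex-valued functions whose real and imaginary parts both belong to \<open>A\<close>. They form an
  algebra over the complex numbers that is closed under conjugation, which allows computing with monomials instead of
  their real and imaginary parts.\<close>

definition complex_part :: "'a set \<Rightarrow> ('a \<Rightarrow> real) set \<Rightarrow> ('a \<Rightarrow> complex) set" where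
  "complex_part W A = {F. restrict (\<lambda>v. Re (F v)) W \<in> A \<and> restrict (\<lambda>v. Im (F v)) W \<in> A}"

lemma complex_partD: "F \<in> complex_part V A \<Longrightarrow> restrict (\<lambda>v. Re (F v)) V \<in> A"
  "F \<in> complex_part V A \<Longrightarrow> restrict (\<lambda>v. Im (F v)) V \<in> A"
  by (simp_all add: complex_part_def)

context
  fixes W :: "'a set" and A
  assumes A: "function_algebra W A"
begin

lemma complex_part_const: "(\<lambda>_. c) \<in> complex_part W A"
  by (simp add: complex_part_def alg_const[OF A])

lemma complex_part_of_real: "restrict f W \<in> A \<Longrightarrow> (\<lambda>v. of_real (f v)) \<in> complex_part W A"
  by (simp add: complex_part_def alg_const[OF A])

lemma complex_part_add:
  "F \<in> complex_part W A \<Longrightarrow> F' \<in> complex_part W A \<Longrightarrow> (\<lambda>v. F v + F' v) \<in> complex_part W A"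
  by (simp add: complex_part_def alg_add[OF A])

lemma complex_part_cnj: "F \<in> complex_part W A \<Longrightarrow> (\<lambda>v. cnj (F v)) \<in> complex_part W A"
  by (simp add: complex_part_def alg_uminus[OF A])

lemma complex_part_mult:
  "F \<in> complex_part W A \<Longrightarrow> F' \<in> complex_part W A \<Longrightarrow> (\<lambda>v. F v * F' v) \<in> complex_part W A"
  by (simp add: complex_part_def alg_add[OF A] alg_diff[OF A] alg_mult[OF A])

lemma complex_part_power: "F \<in> complex_part W A \<Longrightarrow> (\<lambda>v. F v ^ n) \<in> complex_part W A"
  by (induction n) (simp_all add: complex_part_const complex_part_mult)

text \<open>With letters of weight 1, their conjugates of weight -1, and \<open>w\<close>, \<open>cnj w\<close> of
  weights 2 and -2, every monomial of weight 0 is a product of the irreducible ones \<open>p * cnj q\<close>,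
  \<open>p * q * cnj w\<close>, its conjugate, and \<open>w * cnj w\<close>. Such a factor is split off as long as
  something is left: \<open>w * cnj w\<close> if both occur, otherwise two letters balance the remaining
  \<open>w\<close>, and without any \<open>w\<close> a letter is paired with a conjugate.\<close>

lemma balanced_monomial:
  assumes pq: "\<And>p q. p \<in> L \<Longrightarrow> q \<in> L \<Longrightarrow> (\<lambda>v. p v * cnj (q v)) \<in> complex_part W A"
    and pqw: "\<And>p q. p \<in> L \<Longrightarrow> q \<in> L \<Longrightarrow> (\<lambda>v. p v * q v * cnj (w v)) \<in> complex_part W A"
    and ww: "(\<lambda>v. w v * cnj (w v)) \<in> complex_part W A"
  shows "set ps \<subseteq> L \<Longrightarrow> set qs \<subseteq> L \<Longrightarrow> length ps + 2 * d = length qs + 2 * e \<Longrightarrow>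
    (\<lambda>v. (\<Prod>p\<leftarrow>ps. p v) * cnj (\<Prod>q\<leftarrow>qs. q v) * w v ^ d * cnj (w v) ^ e) \<in> complex_part W A"
proof (induction "length ps + length qs + d + e" arbitrary: ps qs d e rule: less_induct)
  case less
  let ?F = "\<lambda>ps qs d e v. (\<Prod>p\<leftarrow>ps. p v) * cnj (\<Prod>q\<leftarrow>qs. q v) * w v ^ d * cnj (w v) ^ e"
  have step: "?F ps qs d e \<in> complex_part W A"
    if "set ps' \<subseteq> L" "set qs' \<subseteq> L" "length ps' + 2 * d' = length qs' + 2 * e'"
      "length ps' + length qs' + d' + e' < length ps + length qs + d + e"
      "m \<in> complex_part W A" "\<And>v. ?F ps qs d e v = m v * ?F ps' qs' d' e' v" for m ps' qs' d' e'
  proof -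
    have "?F ps' qs' d' e' \<in> complex_part W A"
      using that by (intro less.hyps) auto
    from complex_part_mult[OF that(5) this] show ?thesis
      unfolding that(6)[symmetric] .
  qed
  consider (ww) "d > 0" "e > 0" | (bal) "d = 0" "e = 0" | (e) "d = 0" "e > 0" | (d) "d > 0" "e = 0" by auto
  then show ?case
  proof cases
    case ww
    then obtain d' e' where "d = Suc d'" "e = Suc e'" by (metis gr0_implies_Suc)
    then show ?thesis
      by (intro step[of ps qs d' e' "\<lambda>v. w v * cnj (w v)"]) (use less.prems assms(3) in auto)
  next
    case bal
    show ?thesis
    proof (cases ps)
      case Nil
      then show ?thesis using bal less.prems by (simp add: complex_part_const)
    next
      case (Cons p ps')
      then obtain q qs' where "qs = q # qs'" using less.prems bal by (cases qs) auto
      then show ?thesis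
        by (intro step[of ps' qs' d e "\<lambda>v. p v * cnj (q v)"]) (use Cons less.prems pq in auto)
    qed
  next
    case e
    then obtain e' where e': "e = Suc e'" by (metis gr0_implies_Suc)
    obtain p p' ps' where "ps = p # p' # ps'"
      using less.prems e e' by (cases ps; cases "tl ps") auto
    then show ?thesis
      by (intro step[of ps' qs d e' "\<lambda>v. p v * p' v * cnj (w v)"]) (use e e' less.prems pqw in auto)
  next
    case d
    then obtain d' where d': "d = Suc d'" by (metis gr0_implies_Suc)
    obtain q q' qs' where "qs = q # q' # qs'"
      using less.prems d d' by (cases qs; cases "tl qs") auto
    then show ?thesis
      by (intro step[of ps qs' d' e "\<lambda>v. cnj (q v * q' v * cnj (w v))"])
        (use d d' less.prems complex_part_cnj[OF pqw] in auto)
  qed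
qed

end

text \<open>A covariant with two different orders vanishes. Since no generator vanishes, its order is well defined,
  which is what counting the invariants requires.\<close>

lemma has_order_unique:
  assumes "has_order V m c" "has_order V n c" "m \<noteq> n" "v \<in> V"
  shows "c (v, x) = 0"
proof -
  have "2 ^ m * c (v, x) = 2 ^ n * c (v, x)"
    using assms unfolding has_order_def by metis
  then show ?thesis using assms(3) by simp
qed

lemma card_filter_nth:
  assumes "distinct fs" "\<And>k. k < length fs \<Longrightarrow> P (fs ! k) \<longleftrightarrow> Q (ns ! k)" "length ns = length fs"
  shows "card {f \<in> set fs. P f} = length (filter Q ns)"
proof -
  have "card {f \<in> set fs. P f} = length (filter P fs)"
    using distinct_card[of "filter P fs"] assms(1) by simp
  also have "\<dots> = length (filter Q ns)"
    unfolding length_filter_conv_card using assms(2,3)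
    by (intro arg_cong[of _ _ card]) auto
  finally show ?thesis .
qed

section \<open>Rotations and reflections\<close>

text \<open>The two components of \<open>O(2)\<close>, both parametrized by the image \<open>u\<close> of
  \<open>1\<close>: multiplication by \<open>u\<close>, and conjugation followed by multiplication by
  \<open>u\<close>.\<close>

definition rotation :: "complex \<Rightarrow> real^2^2" where
  "rotation u = (\<chi> i j. if i = j then Re u else if i = 2 then Im u else - Im u)"

definition reflection :: "complex \<Rightarrow> real^2^2" where
  "reflection u = (\<chi> i j. if i = j then if i = 1 then Re u else - Re u else Im u)"

lemma det_rotation: "det (rotation u) = (norm u)\<^sup>2"
  by (simp add: det_2 rotation_def cmod_power2) (simp add: power2_eq_square)

lemma det_reflection: "det (reflection u) = - (norm u)\<^sup>2"
  by (simp add: det_2 reflection_def cmod_power2) (simp add: power2_eq_square)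

lemma rotation_reflection_O2:
  assumes "norm u = 1"
  shows "rotation u \<in> O2" "reflection u \<in> O2"
proof -
  have "Re u * Re u + Im u * Im u = 1" using assms cmod_power2[of u] by (simp add: power2_eq_square)
  then show "rotation u \<in> O2" "reflection u \<in> O2"
    by (auto simp: O2_def orthogonal_matrix matrix_matrix_mult_def transpose_def mat_def
        vec_eq_iff sum_2 forall_2 rotation_def reflection_def)
qed

lemma rotation_SO2: "norm u = 1 \<Longrightarrow> rotation u \<in> SO2"
  using rotation_reflection_O2(1)[of u] by (simp add: SO2_def O2_def rotation_matrix_def det_rotation)

lemma O2_rotation_reflection:
  assumes "g \<in> O2"
  shows "\<exists>u. norm u = 1 \<and> (g = rotation u \<or> g = reflection u)"
  using assms
proof (cases rule: O2_cases)
  case (1 c s)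
  then show ?thesis
    by (intro exI[of _ "Complex c s"]) (auto simp: vec_eq_iff forall_2 rotation_def cmod_def)
next
  case (2 c s)
  then show ?thesis
    by (intro exI[of _ "Complex c s"]) (auto simp: vec_eq_iff forall_2 reflection_def cmod_def)
qed

lemma SO2_rotation:
  assumes "g \<in> SO2"
  shows "\<exists>u. norm u = 1 \<and> g = rotation u"
  using assms O2_rotation_reflection[of g] det_reflection
  by (force simp: SO2_def O2_def rotation_matrix_def)

lemma act4_Gel: "P \<in> Gel \<Longrightarrow> act4 g P \<in> Gel"
  by (simp add: Gel_iff act4_def sum_2 algebra_simps)

lemma unit_cancel:
  assumes "norm u = 1"
  shows "(u^2 * a) * cnj (u^2 * b) = a * cnj b" "(u^2 * a) * (u^2 * b) * cnj (u^4 * w) = a * b * cnj w"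
    "(u^4 * a) * cnj (u^4 * b) = a * cnj b" "(u * a) * cnj (u * b) = a * cnj b"
proof -
  have u: "u * cnj u = 1" using complex_norm_square[of u] assms by simp
  have "(u^2 * a) * cnj (u^2 * b) = (u * cnj u)^2 * (a * cnj b)"
    "(u^2 * a) * (u^2 * b) * cnj (u^4 * w) = (u * cnj u)^4 * (a * b * cnj w)"
    "(u^4 * a) * cnj (u^4 * b) = (u * cnj u)^4 * (a * cnj b)"
    "(u * a) * cnj (u * b) = (u * cnj u) * (a * cnj b)"
    by (simp_all add: power4_eq_xxxx power2_eq_square mult_ac)
  then show "(u^2 * a) * cnj (u^2 * b) = a * cnj b" "(u^2 * a) * (u^2 * b) * cnj (u^4 * w) = a * b * cnj w"
    "(u^4 * a) * cnj (u^4 * b) = a * cnj b" "(u * a) * cnj (u * b) = a * cnj b"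
    unfolding u by simp_all
qed

text \<open>Each monomial in the complex lists has rotation weight 0.\<close>

lemma cplx_rotation:
  assumes u: "norm u = 1" and y: "z1 y = u * z1 x"
  shows "cplxA (hcx \<xi> l m (u^2 * a) (u^2 * b) (u^4 * w)) y = cplxA (hcx \<xi> l m a b w) x"
    and "cplxB (hcx \<xi> l m (u^2 * a) (u^2 * b) (u^4 * w)) y = cplxB (hcx \<xi> l m a b w) x"
proof -
  note c = unit_cancel[OF u]
  have 1: "(u\<^sup>2 * p)^2 * cnj (u^4 * w) = p^2 * cnj w" for p
    using c(2)[of p p w] by (simp add: power2_eq_square)
  have 2: "cnj (u^2 * p) * (u * z1 x)^2 = cnj p * z1 x ^ 2" for p
    using c(1)[of "z1 x ^ 2" p] by (simp add: power_mult_distrib mult_ac)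
  have 3: "(u^2 * p) * cnj (u^4 * w) * (u * z1 x)^2 = p * cnj w * z1 x ^ 2" for p
    using c(2)[of p "z1 x ^ 2" w] by (simp add: power_mult_distrib mult_ac)
  have 4: "cnj (u^4 * w) * (u * z1 x)^4 = cnj w * z1 x ^ 4"
    using c(3)[of "z1 x ^ 4" w] by (simp add: power_mult_distrib mult_ac)
  show "cplxA (hcx \<xi> l m (u^2 * a) (u^2 * b) (u^4 * w)) y = cplxA (hcx \<xi> l m a b w) x"
    "cplxB (hcx \<xi> l m (u^2 * a) (u^2 * b) (u^4 * w)) y = cplxB (hcx \<xi> l m a b w) x"
    unfolding cplxA_def cplxB_def hcx_def Let_def prod.case z2_cx2 z4_cx4 y
    by (simp_all only: c 1 2 3 4)
qed

text \<open>Conjugating all coordinates keeps real parts and negates imaginary parts; \<open>\<xi>\<close> changes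
  sign like the latter.\<close>

lemma cplx_cnj:
  assumes y: "z1 y = cnj (z1 x)"
  shows "cplxA (hcx (-\<xi>) l m (cnj a) (cnj b) (cnj w)) y = cplxA (hcx \<xi> l m a b w) x"
    and "cplxB (hcx (-\<xi>) l m (cnj a) (cnj b) (cnj w)) y = map uminus (cplxB (hcx \<xi> l m a b w) x)"
proof -
  have c: "cnj p * q = cnj (p * cnj q)" for p q by simp
  have d: "Im (cnj p) = - Im p" "Re (cnj p) = Re p" for p by simp_all
  show "cplxA (hcx (-\<xi>) l m (cnj a) (cnj b) (cnj w)) y = cplxA (hcx \<xi> l m a b w) x"
    unfolding cplxA_def hcx_def Let_def prod.case z2_cx2 z4_cx4 y
    by (simp only: complex_cnj_mult[symmetric] complex_cnj_power[symmetric] d)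
  show "cplxB (hcx (-\<xi>) l m (cnj a) (cnj b) (cnj w)) y = map uminus (cplxB (hcx \<xi> l m a b w) x)"
    unfolding cplxB_def hcx_def Let_def prod.case z2_cx2 z4_cx4 y list.map
    by (simp only: complex_cnj_mult[symmetric] complex_cnj_power[symmetric] d)
qed

lemma cplx_reflection:
  assumes u: "norm u = 1" and y: "z1 y = u * cnj (z1 x)"
  shows "cplxA (hcx (-\<xi>) l m (u^2 * cnj a) (u^2 * cnj b) (u^4 * cnj w)) y = cplxA (hcx \<xi> l m a b w) x"
    and "cplxB (hcx (-\<xi>) l m (u^2 * cnj a) (u^2 * cnj b) (u^4 * cnj w)) y =
      map uminus (cplxB (hcx \<xi> l m a b w) x)"
proof -
  obtain x' where "z1 x' = cnj (z1 x)" using z1_surj by blast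
  with cplx_rotation[OF u, of y x'] cplx_cnj[of x' x] y
  show "cplxA (hcx (-\<xi>) l m (u^2 * cnj a) (u^2 * cnj b) (u^4 * cnj w)) y = cplxA (hcx \<xi> l m a b w) x"
    "cplxB (hcx (-\<xi>) l m (u^2 * cnj a) (u^2 * cnj b) (u^4 * cnj w)) y =
      map uminus (cplxB (hcx \<xi> l m a b w) x)"
    by simp_all
qed

section \<open>Coordinates attached to a harmonic decomposition\<close>

inductive_set sums_of :: "('a \<Rightarrow> 'b::comm_ring_1) set \<Rightarrow> ('a \<Rightarrow> 'b) set" for X where
  sums_of_base: "f \<in> X \<Longrightarrow> f \<in> sums_of X"
| sums_of_add: "f \<in> sums_of X \<Longrightarrow> g \<in> sums_of X \<Longrightarrow> (\<lambda>v. f v + g v) \<in> sums_of X"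

lemma sums_of_mult_closed:
  assumes X: "\<And>f g. f \<in> X \<Longrightarrow> g \<in> X \<Longrightarrow> (\<lambda>v. f v * g v) \<in> X"
    and "f \<in> sums_of X" "g \<in> sums_of X"
  shows "(\<lambda>v. f v * g v) \<in> sums_of X"
  using assms(2)
proof induction
  case (sums_of_base f)
  show ?case using assms(3)
  proof induction
    case (sums_of_add g h)
    then show ?case using sums_of.sums_of_add[of "\<lambda>v. f v * g v" X "\<lambda>v. f v * h v"]
      by (simp add: distrib_left)
  qed (use X sums_of_base in \<open>auto intro: sums_of.sums_of_base\<close>)
next
  case (sums_of_add f h)
  then show ?case using sums_of.sums_of_add[of "\<lambda>v. f v * g v" X "\<lambda>v. h v * g v"]
    by (simp add: distrib_right)
qed

lemma Gel_subspace: "P \<in> Gel \<Longrightarrow> Q \<in> Gel \<Longrightarrow> P + Q \<in> Gel" "P \<in> Gel \<Longrightarrow> c *\<^sub>R P \<in> Gel"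
  by (simp_all add: Gel_iff)

text \<open>A decomposition is constrained on \<^const>\<open>Gel\<close> only. Composing it with this linear
  projection yields coordinates that are linear, hence polynomial, on all fourth-order tensors.\<close>

definition Gel_projection :: "tensor4 \<Rightarrow> tensor4" where
  "Gel_projection P = (\<chi> i j k l. (P$i$j$k$l + P$j$i$k$l + P$i$j$l$k + P$j$i$l$k) / 4)"

lemma Gel_projection_in_Gel: "Gel_projection P \<in> Gel"
  by (simp add: Gel_iff Gel_projection_def)

lemma Gel_projection_id: "P \<in> Gel \<Longrightarrow> Gel_projection P = P"
  by (simp add: Gel_iff Gel_projection_def vec_eq_iff forall_2)

lemma Gel_projection_linear:
  "Gel_projection (P + Q) = Gel_projection P + Gel_projection Q"
  "Gel_projection (c *\<^sub>R P) = c *\<^sub>R Gel_projection P"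
  by (simp_all add: Gel_projection_def vec_eq_iff forall_2 field_simps)

abbreviation W :: "(tensor4 \<times> (real^2)) set" where
  "W \<equiv> Gel \<times> UNIV"

definition act :: "real^2^2 \<Rightarrow> tensor4 \<times> (real^2) \<Rightarrow> tensor4 \<times> (real^2)" where
  "act = (\<lambda>g (P, x). (act4 g P, g *v x))"

lemma act_in_W: "v \<in> W \<Longrightarrow> act g v \<in> W"
  by (auto simp: act_def act4_Gel)

lemma Cov_iff:
  "f \<in> Cov Gel act4 G \<longleftrightarrow> f \<in> polynomials_on W \<and> (\<forall>g\<in>G. \<forall>v\<in>W. f (act g v) = f v)"
  by (simp add: Cov_def Inv_def act_def)

lemma function_algebra_Cov: "function_algebra W (Cov Gel act4 G)"
  unfolding Cov_def by (rule function_algebra_Inv) (auto simp: act4_Gel)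

text \<open>The families of covariants differ from the lists of complex expressions by these factors only, and nonzero
  factors do not affect membership in an algebra.\<close>

definition scaled :: "'a set \<Rightarrow> real list \<Rightarrow> ('a \<Rightarrow> real) list \<Rightarrow> ('a \<Rightarrow> real) list" where
  "scaled V cs fs = map2 (\<lambda>c f. restrict (\<lambda>v. c * f v) V) cs fs"

lemma length_scaled: "length cs = length fs \<Longrightarrow> length (scaled V cs fs) = length fs"
  by (simp add: scaled_def)

lemma nth_scaled: "length cs = length fs \<Longrightarrow> k < length fs \<Longrightarrow>
    scaled V cs fs ! k = restrict (\<lambda>v. cs ! k * (fs ! k) v) V"
  by (simp add: scaled_def)

lemma scaled_subset_iff:
  assumes A: "function_algebra V A" and "length cs = length fs" "0 \<notin> set cs"
  shows "set (scaled V cs fs) \<subseteq> A \<longleftrightarrow> (\<forall>f\<in>set fs. restrict f V \<in> A)"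
proof -
  have "restrict (\<lambda>v. c * f v) V \<in> A \<longleftrightarrow> restrict f V \<in> A" if "c \<noteq> 0" for c f
    using alg_cmult[OF A, of f c] alg_cmult[OF A, of "\<lambda>v. c * f v" "1 / c"] that by auto
  then have "scaled V cs fs ! k \<in> A \<longleftrightarrow> restrict (fs ! k) V \<in> A" if "k < length fs" for k
    using that assms(2,3) by (metis nth_mem nth_scaled)
  then show ?thesis
    using assms(2) by (auto simp: set_conv_nth length_scaled subset_iff)
qed

locale harmonic_coordinates =
  fixes \<Phi> :: "tensor4 \<Rightarrow> harm"
  assumes decomposition: "harmonic_decomposition \<Phi>"
begin

text \<open>The coordinates of a pair of a tensor and a vector: the scalars \<open>\<xi>, \<lambda>, \<mu>\<close>,
  and the complex numbers \<open>z\<^sub>2\<^sub>a, z\<^sub>2\<^sub>b, z\<^sub>4, z\<close>.\<close>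

definition xi :: "tensor4 \<times> (real^2) \<Rightarrow> real" where "xi v = fst (\<Phi> (fst v))"
definition la :: "tensor4 \<times> (real^2) \<Rightarrow> real" where "la v = fst (snd (\<Phi> (fst v)))"
definition mu :: "tensor4 \<times> (real^2) \<Rightarrow> real" where "mu v = fst (snd (snd (\<Phi> (fst v))))"
definition za :: "tensor4 \<times> (real^2) \<Rightarrow> complex" where "za v = z2 (fst (snd (snd (snd (\<Phi> (fst v))))))"
definition zb :: "tensor4 \<times> (real^2) \<Rightarrow> complex" where "zb v = z2 (fst (snd (snd (snd (snd (\<Phi> (fst v)))))))"
definition zh :: "tensor4 \<times> (real^2) \<Rightarrow> complex" where "zh v = z4 (snd (snd (snd (snd (snd (\<Phi> (fst v)))))))"
definition zx :: "tensor4 \<times> (real^2) \<Rightarrow> complex" where "zx v = z1 (snd v)"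

lemmas coordinate_defs = xi_def la_def mu_def za_def zb_def zh_def zx_def

lemma Phi_linear:
  "P \<in> Gel \<Longrightarrow> Q \<in> Gel \<Longrightarrow> \<Phi> (P + Q) = \<Phi> P + \<Phi> Q"
  "P \<in> Gel \<Longrightarrow> \<Phi> (c *\<^sub>R P) = c *\<^sub>R \<Phi> P"
  using decomposition by (simp_all add: harmonic_decomposition_def)

lemma Phi_bij: "bij_betw \<Phi> Gel Harm_sum"
  using decomposition by (simp add: harmonic_decomposition_def)

lemma Phi_in: "P \<in> Gel \<Longrightarrow> \<Phi> P \<in> Harm_sum"
  using Phi_bij by (auto simp: bij_betw_def)

lemma Phi_equivariant: "g \<in> O2 \<Longrightarrow> P \<in> Gel \<Longrightarrow> \<Phi> (act4 g P) = act_harm g (\<Phi> P)"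
  using decomposition by (simp add: harmonic_decomposition_def)

lemma Phi_coordinates:
  assumes "v \<in> W"
  shows "\<Phi> (fst v) = hcx (xi v) (la v) (mu v) (za v) (zb v) (zh v)"
proof -
  obtain \<xi> l m a b w where "\<Phi> (fst v) = hcx \<xi> l m a b w"
    using assms Phi_in[of "fst v"] Harm_sum_hcx by auto
  then show ?thesis by (simp add: coordinate_defs hcx_def)
qed

lemma coordinates_unique:
  assumes "\<Phi> (fst v) = hcx \<xi> l m a b w"
  shows "xi v = \<xi>" "la v = l" "mu v = m" "za v = a" "zb v = b" "zh v = w"
  using assms by (simp_all add: coordinate_defs hcx_def)

lemma Phi_act_rotation:
  assumes "v \<in> W" "norm u = 1"
  shows "\<Phi> (fst (act (rotation u) v)) =
      hcx (xi v) (la v) (mu v) (u^2 * za v) (u^2 * zb v) (u^4 * zh v)"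
    and "zx (act (rotation u) v) = u * zx v"
proof -
  obtain P x where v: "v = (P, x)" "P \<in> Gel" using assms by auto
  note r = act_cx_rotation[of "rotation u" u, unfolded rotation_def, simplified, folded rotation_def]
  show "\<Phi> (fst (act (rotation u) v)) =
      hcx (xi v) (la v) (mu v) (u^2 * za v) (u^2 * zb v) (u^4 * zh v)"
    using Phi_equivariant[OF rotation_reflection_O2(1)[OF assms(2)] v(2)] Phi_coordinates[OF assms(1)] assms(2)
    by (simp add: v act_def act_harm_def hcx_def r det_rotation)
  show "zx (act (rotation u) v) = u * zx v"
    by (simp add: zx_def v act_def r)
qed

lemma Phi_act_reflection:
  assumes "v \<in> W" "norm u = 1"
  shows "\<Phi> (fst (act (reflection u) v)) =
      hcx (- xi v) (la v) (mu v) (u^2 * cnj (za v)) (u^2 * cnj (zb v)) (u^4 * cnj (zh v))"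
    and "zx (act (reflection u) v) = u * cnj (zx v)"
proof -
  obtain P x where v: "v = (P, x)" "P \<in> Gel" using assms by auto
  note r = act_cx_reflection[of "reflection u" u, unfolded reflection_def, simplified, folded reflection_def]
  show "\<Phi> (fst (act (reflection u) v)) =
      hcx (- xi v) (la v) (mu v) (u^2 * cnj (za v)) (u^2 * cnj (zb v)) (u^4 * cnj (zh v))"
    using Phi_equivariant[OF rotation_reflection_O2(2)[OF assms(2)] v(2)] Phi_coordinates[OF assms(1)] assms(2)
    by (simp add: v act_def act_harm_def hcx_def r det_reflection)
  show "zx (act (reflection u) v) = u * cnj (zx v)"
    by (simp add: zx_def v act_def r)
qed

definition polyA :: "(tensor4 \<times> (real^2) \<Rightarrow> real) list" where
  "polyA = [la, mu,
     \<lambda>v. Re (za v * cnj (za v)), \<lambda>v. Re (zb v * cnj (zb v)), \<lambda>v. Re (zh v * cnj (zh v)),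
     \<lambda>v. Re (za v * cnj (zb v)),
     \<lambda>v. Re (za v ^ 2 * cnj (zh v)), \<lambda>v. Re (zb v ^ 2 * cnj (zh v)), \<lambda>v. Re (za v * zb v * cnj (zh v)),
     \<lambda>v. Re (zx v * cnj (zx v)), \<lambda>v. Re (cnj (za v) * zx v ^ 2), \<lambda>v. Re (cnj (zb v) * zx v ^ 2),
     \<lambda>v. Re (za v * cnj (zh v) * zx v ^ 2), \<lambda>v. Re (zb v * cnj (zh v) * zx v ^ 2),
     \<lambda>v. Re (cnj (zh v) * zx v ^ 4)]"

definition polyB :: "(tensor4 \<times> (real^2) \<Rightarrow> real) list" where
  "polyB = [xi, \<lambda>v. Im (za v * cnj (zb v)),
     \<lambda>v. Im (za v ^ 2 * cnj (zh v)), \<lambda>v. Im (zb v ^ 2 * cnj (zh v)), \<lambda>v. Im (za v * zb v * cnj (zh v)),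
     \<lambda>v. Im (cnj (za v) * zx v ^ 2), \<lambda>v. Im (cnj (zb v) * zx v ^ 2),
     \<lambda>v. Im (za v * cnj (zh v) * zx v ^ 2), \<lambda>v. Im (zb v * cnj (zh v) * zx v ^ 2),
     \<lambda>v. Im (cnj (zh v) * zx v ^ 4)]"

definition polyC :: "(tensor4 \<times> (real^2) \<Rightarrow> real) list" where
  "polyC = map (\<lambda>f v. xi v * f v) polyB"

lemma cplx_poly:
  "cplxA (\<Phi> (fst v)) (snd v) = map (\<lambda>f. f v) polyA"
  "cplxB (\<Phi> (fst v)) (snd v) = map (\<lambda>f. f v) polyB"
  "cplxC (\<Phi> (fst v)) (snd v) = map (\<lambda>f. f v) polyC"
  by (simp_all only: cplxC_def cplxA_def cplxB_def Let_def case_prod_unfold polyA_def polyB_def polyC_def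
      coordinate_defs list.map)

lemma cov_scaled:
  "covA \<Phi> = scaled W consts_A polyA"
  "covB \<Phi> = scaled W consts_B polyB"
  "covC \<Phi> = scaled W consts_B polyC"
proof -
  have *: "covariants n F \<Phi> = scaled W cs fs"
    if "length fs = n" "length cs = n"
      "\<And>h x. h \<in> Harm_sum \<Longrightarrow> form_values F h x = map2 (*) cs (Z h x)"
      "\<And>v. Z (\<Phi> (fst v)) (snd v) = map (\<lambda>f. f v) fs" for n F cs fs and Z :: "harm \<Rightarrow> real^2 \<Rightarrow> real list"
  proof (rule nth_equalityI)
    show "length (covariants n F \<Phi>) = length (scaled W cs fs)"
      using that by (simp add: covariants_def length_scaled)
    fix k assume "k < length (covariants n F \<Phi>)"
    then have k: "k < n" by (simp add: covariants_def)
    have "form_values F (\<Phi> P) x ! k = cs ! k * (fs ! k) (P, x)" if "P \<in> Gel" for P x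
      using \<open>k < n\<close> that(1) Phi_in[OF that] \<open>length fs = n\<close> \<open>length cs = n\<close>
      by (simp add: \<open>\<And>h x. h \<in> Harm_sum \<Longrightarrow> form_values F h x = map2 (*) cs (Z h x)\<close>
         \<open>\<And>v. Z (\<Phi> (fst v)) (snd v) = map (\<lambda>f. f v) fs\<close>[of "(P, x)", simplified])
    then show "covariants n F \<Phi> ! k = scaled W cs fs ! k"
      using k that(1,2) by (auto simp: covariants_def nth_scaled intro!: restrict_ext)
  qed
  show "covA \<Phi> = scaled W consts_A polyA"
    unfolding covA_def
    by (rule *[of _ _ _ _ cplxA]) (simp_all add: cx_forms cplx_poly, simp_all add: polyA_def consts_A_def)
  show "covB \<Phi> = scaled W consts_B polyB"
    unfolding covB_def
    by (rule *[of _ _ _ _ cplxB]) (simp_all add: cx_forms cplx_poly, simp_all add: polyB_def consts_B_def)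
  show "covC \<Phi> = scaled W consts_B polyC"
    unfolding covC_def
    by (rule *[of _ _ _ _ cplxC]) (simp_all add: cx_forms cplx_poly, simp_all add: polyB_def polyC_def consts_B_def)
qed

lemma lengths [simp]: "length consts_A = 15" "length consts_B = 10"
  "length polyA = 15" "length polyB = 10" "length polyC = 10"
  by (simp_all add: consts_A_def consts_B_def polyA_def polyB_def polyC_def)

lemma consts_nonzero: "0 \<notin> set consts_A" "0 \<notin> set consts_B"
  by (simp_all add: consts_A_def consts_B_def)

lemma coordinates_polynomial:
  shows "restrict xi W \<in> polynomials_on W" "restrict la W \<in> polynomials_on W" "restrict mu W \<in> polynomials_on W"
    and "za \<in> complex_part W (polynomials_on W)" "zb \<in> complex_part W (polynomials_on W)"
      "zh \<in> complex_part W (polynomials_on W)" "zx \<in> complex_part W (polynomials_on W)"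
proof -
  have *: "restrict f W \<in> polynomials_on W"
    if "linear p" "\<And>v. v \<in> W \<Longrightarrow> f v = p v" for f p
  proof -
    have "restrict f W = restrict p W" using that by (auto intro: restrict_ext)
    moreover have "real_polynomial_function p"
      using that(1) by (simp add: linear_conv_bounded_linear real_polynomial_function.intros(1))
    ultimately show ?thesis by (auto simp: polynomials_on_def)
  qed
  define T where "T v = \<Phi> (Gel_projection (fst v))" for v :: "tensor4 \<times> (real^2)"
  have T: "T (v + w) = T v + T w" "T (c *\<^sub>R v) = c *\<^sub>R T v" for v w c
    by (simp_all add: T_def Gel_projection_linear Gel_projection_in_Gel Phi_linear)
  have TW: "T v = hcx (xi v) (la v) (mu v) (za v) (zb v) (zh v)" if "v \<in> W" for v
    using that Phi_coordinates[OF that] by (auto simp: T_def Gel_projection_id)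
  show "restrict xi W \<in> polynomials_on W"
    by (rule *[of "\<lambda>v. fst (T v)"]) (rule linearI, simp_all add: T TW hcx_def)
  show "restrict la W \<in> polynomials_on W"
    by (rule *[of "\<lambda>v. fst (snd (T v))"]) (rule linearI, simp_all add: T TW hcx_def)
  show "restrict mu W \<in> polynomials_on W"
    by (rule *[of "\<lambda>v. fst (snd (snd (T v)))"]) (rule linearI, simp_all add: T TW hcx_def)
  note cx = hcx_def cx2_def cx4_def harm2_def harm4_def
  show "za \<in> complex_part W (polynomials_on W)"
    unfolding complex_part_def mem_Collect_eq
    by (intro conjI *[of "\<lambda>v. fst (snd (snd (snd (T v)))) $ 1 $ 1"]
        *[of "\<lambda>v. fst (snd (snd (snd (T v)))) $ 1 $ 2"] linearI) (simp_all add: T TW cx)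
  show "zb \<in> complex_part W (polynomials_on W)"
    unfolding complex_part_def mem_Collect_eq
    by (intro conjI *[of "\<lambda>v. fst (snd (snd (snd (snd (T v))))) $ 1 $ 1"]
        *[of "\<lambda>v. fst (snd (snd (snd (snd (T v))))) $ 1 $ 2"] linearI) (simp_all add: T TW cx)
  show "zh \<in> complex_part W (polynomials_on W)"
    unfolding complex_part_def mem_Collect_eq
    by (intro conjI *[of "\<lambda>v. snd (snd (snd (snd (snd (T v))))) $ 1 $ 1 $ 1 $ 1"]
        *[of "\<lambda>v. snd (snd (snd (snd (snd (T v))))) $ 1 $ 1 $ 1 $ 2"] linearI) (simp_all add: T TW cx)
  show "zx \<in> complex_part W (polynomials_on W)"
    unfolding complex_part_def mem_Collect_eq
    by (intro conjI *[of "\<lambda>v. snd v $ 1"] *[of "\<lambda>v. snd v $ 2"] linearI) (simp_all add: zx_def z1_def)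
qed

lemma poly_polynomial:
  "\<forall>f\<in>set polyA. restrict f W \<in> polynomials_on W"
  "\<forall>f\<in>set polyB. restrict f W \<in> polynomials_on W"
  "\<forall>f\<in>set polyC. restrict f W \<in> polynomials_on W"
proof -
  note [intro!] = complex_partD complex_part_mult[OF function_algebra_polynomials]
    complex_part_cnj[OF function_algebra_polynomials] complex_part_power[OF function_algebra_polynomials]
    coordinates_polynomial
  show "\<forall>f\<in>set polyA. restrict f W \<in> polynomials_on W"
    unfolding polyA_def list.set ball_simps by (intro conjI ballI TrueI) fast+
  show B: "\<forall>f\<in>set polyB. restrict f W \<in> polynomials_on W"
    unfolding polyB_def list.set ball_simps by (intro conjI ballI TrueI) fast+
  show "\<forall>f\<in>set polyC. restrict f W \<in> polynomials_on W"
    unfolding polyC_def set_map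
    using B alg_mult[OF function_algebra_polynomials coordinates_polynomial(1)] by blast
qed

lemma poly_rotation:
  assumes "v \<in> W" "norm u = 1"
  shows "\<forall>f\<in>set polyA. f (act (rotation u) v) = f v"
    and "\<forall>f\<in>set polyB. f (act (rotation u) v) = f v"
proof -
  have "z1 (snd (act (rotation u) v)) = u * z1 (snd v)"
    using Phi_act_rotation(2)[OF assms] by (simp add: zx_def)
  from cplx_rotation[OF assms(2) this] Phi_act_rotation(1)[OF assms] Phi_coordinates[OF assms(1)]
  have "cplxA (\<Phi> (fst (act (rotation u) v))) (snd (act (rotation u) v)) = cplxA (\<Phi> (fst v)) (snd v)"
    "cplxB (\<Phi> (fst (act (rotation u) v))) (snd (act (rotation u) v)) = cplxB (\<Phi> (fst v)) (snd v)"
    by simp_all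
  then show "\<forall>f\<in>set polyA. f (act (rotation u) v) = f v" "\<forall>f\<in>set polyB. f (act (rotation u) v) = f v"
    unfolding cplx_poly by simp_all
qed

lemma poly_reflection:
  assumes "v \<in> W" "norm u = 1"
  shows "\<forall>f\<in>set polyA. f (act (reflection u) v) = f v"
    and "\<forall>f\<in>set polyB. f (act (reflection u) v) = - f v"
proof -
  have "z1 (snd (act (reflection u) v)) = u * cnj (z1 (snd v))"
    using Phi_act_reflection(2)[OF assms] by (simp add: zx_def)
  from cplx_reflection[OF assms(2) this] Phi_act_reflection(1)[OF assms] Phi_coordinates[OF assms(1)]
  have "cplxA (\<Phi> (fst (act (reflection u) v))) (snd (act (reflection u) v)) = cplxA (\<Phi> (fst v)) (snd v)"
    "cplxB (\<Phi> (fst (act (reflection u) v))) (snd (act (reflection u) v)) = map uminus (cplxB (\<Phi> (fst v)) (snd v))"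
    by simp_all
  then show "\<forall>f\<in>set polyA. f (act (reflection u) v) = f v" "\<forall>f\<in>set polyB. f (act (reflection u) v) = - f v"
    unfolding cplx_poly by simp_all
qed

lemma xi_in_polyB: "xi \<in> set polyB"
  by (simp add: polyB_def)

lemma covs_SO2: "set (covA \<Phi>) \<union> set (covB \<Phi>) \<subseteq> Cov Gel act4 SO2"
proof -
  have "restrict f W \<in> Cov Gel act4 SO2" if "f \<in> set polyA \<union> set polyB" for f
    using that poly_polynomial poly_rotation
    by (auto simp: Cov_iff act_in_W dest!: SO2_rotation)
  then show ?thesis
    by (simp add: cov_scaled scaled_subset_iff[OF function_algebra_Cov] consts_nonzero)
qed

lemma covs_O2: "set (covA \<Phi>) \<union> set (covC \<Phi>) \<subseteq> Cov Gel act4 O2"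
proof -
  have "f (act g v) = f v" if f: "f \<in> set polyA \<union> set polyC" and "g \<in> O2" "v \<in> W" for f g v
  proof -
    obtain u where u: "norm u = 1" "g = rotation u \<or> g = reflection u"
      using O2_rotation_reflection \<open>g \<in> O2\<close> by blast
    then show ?thesis
      using f poly_rotation[OF \<open>v \<in> W\<close> u(1)] poly_reflection[OF \<open>v \<in> W\<close> u(1)]
        bspec[OF poly_rotation(2)[OF \<open>v \<in> W\<close> u(1)] xi_in_polyB]
        bspec[OF poly_reflection(2)[OF \<open>v \<in> W\<close> u(1)] xi_in_polyB]
      by (auto simp: polyC_def)
  qed
  then have "restrict f W \<in> Cov Gel act4 O2" if "f \<in> set polyA \<union> set polyC" for f
    using that poly_polynomial act_in_W unfolding Cov_iff by auto
  then show ?thesis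
    by (simp add: cov_scaled scaled_subset_iff[OF function_algebra_Cov] consts_nonzero)
qed

end

section \<open>Rotation-invariant polynomials\<close>

lemma poly_eq_on_circle:
  fixes P Q :: "complex poly"
  assumes "\<And>u. norm u = 1 \<Longrightarrow> poly P u = poly Q u"
  shows "P = Q"
proof (rule ccontr)
  assume "P \<noteq> Q"
  then have "finite {u. poly (P - Q) u = 0}" by (intro poly_roots_finite) simp
  moreover have "sphere 0 1 \<subseteq> {u. poly (P - Q) u = 0}" using assms by auto
  ultimately have "finite (sphere (0::complex) 1)" by (rule finite_subset[rotated])
  moreover have "infinite (sphere (0::complex) 1)"
  proof -
    have "connected (sphere (0::complex) 1)" by (rule connected_sphere) simp
    moreover have pm: "1 \<in> sphere (0::complex) 1" "-1 \<in> sphere (0::complex) 1" by simp_all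
    have "sphere (0::complex) 1 \<noteq> {z}" for z
    proof
      assume "sphere (0::complex) 1 = {z}"
      then have "1 = z" "-1 = z" using pm by blast+
      then show False by simp
    qed
    ultimately show ?thesis using connected_finite_iff_sing[of "sphere (0::complex) 1"] pm(1) by blast
  qed
  ultimately show False by simp
qed

context harmonic_coordinates
begin

abbreviation algSO2 :: "(tensor4 \<times> (real^2) \<Rightarrow> real) set" where
  "algSO2 \<equiv> generated_algebra W (set (covA \<Phi>) \<union> set (covB \<Phi>))"

abbreviation algO2 :: "(tensor4 \<times> (real^2) \<Rightarrow> real) set" where
  "algO2 \<equiv> generated_algebra W (set (covA \<Phi>) \<union> set (covC \<Phi>))"

abbreviation cSO2 :: "(tensor4 \<times> (real^2) \<Rightarrow> complex) set" where
  "cSO2 \<equiv> complex_part W algSO2"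

lemma generators_in:
  shows "set (covA \<Phi>) \<subseteq> S \<Longrightarrow> \<forall>f\<in>set polyA. restrict f W \<in> generated_algebra W S"
    and "set (covB \<Phi>) \<subseteq> S \<Longrightarrow> \<forall>f\<in>set polyB. restrict f W \<in> generated_algebra W S"
    and "set (covC \<Phi>) \<subseteq> S \<Longrightarrow> \<forall>f\<in>set polyC. restrict f W \<in> generated_algebra W S"
proof -
  have *: "S' \<subseteq> S \<Longrightarrow> S' \<subseteq> generated_algebra W S" for S' by (auto intro: generated_algebra.gen)
  show "set (covA \<Phi>) \<subseteq> S \<Longrightarrow> \<forall>f\<in>set polyA. restrict f W \<in> generated_algebra W S"
    "set (covB \<Phi>) \<subseteq> S \<Longrightarrow> \<forall>f\<in>set polyB. restrict f W \<in> generated_algebra W S"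
    "set (covC \<Phi>) \<subseteq> S \<Longrightarrow> \<forall>f\<in>set polyC. restrict f W \<in> generated_algebra W S"
    unfolding cov_scaled
    by (drule *, simp add: scaled_subset_iff[OF algebra_generated] consts_nonzero)+
qed

lemma algSO2_subset: "algSO2 \<subseteq> Cov Gel act4 SO2"
  by (rule generated_algebra_subset[OF function_algebra_Cov covs_SO2])

lemma algO2_subset: "algO2 \<subseteq> Cov Gel act4 O2"
  by (rule generated_algebra_subset[OF function_algebra_Cov covs_O2])

lemma cSO2_rotation:
  assumes "F \<in> cSO2" "v \<in> W" "norm u = 1"
  shows "F (act (rotation u) v) = F v"
proof -
  have "restrict (\<lambda>v. Re (F v)) W \<in> Cov Gel act4 SO2" "restrict (\<lambda>v. Im (F v)) W \<in> Cov Gel act4 SO2"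
    using complex_partD[OF assms(1)] algSO2_subset by auto
  then have "(restrict (\<lambda>v. Re (F v)) W) (act (rotation u) v) = (restrict (\<lambda>v. Re (F v)) W) v"
    "(restrict (\<lambda>v. Im (F v)) W) (act (rotation u) v) = (restrict (\<lambda>v. Im (F v)) W) v"
    using assms(2) rotation_SO2[OF assms(3)] unfolding Cov_iff by blast+
  then have "Re (F (act (rotation u) v)) = Re (F v)" "Im (F (act (rotation u) v)) = Im (F v)"
    using assms(2) act_in_W[OF assms(2)] by (simp_all only: restrict_apply')
  then show ?thesis by (rule complex_eqI)
qed

text \<open>The three quantities of rotation weight 2. The vector enters only through \<open>z\<^sup>2\<close> and
  \<open>z * cnj z\<close>: by parity of the weights, an invariant monomial contains \<open>z\<close> and its
  conjugate an even number of times in total.\<close>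

definition letters :: "(tensor4 \<times> (real^2) \<Rightarrow> complex) set" where
  "letters = {za, zb, \<lambda>v. zx v ^ 2}"

lemma basic_invariants:
  shows "(\<lambda>v. of_real (xi v)) \<in> cSO2" "(\<lambda>v. of_real (la v)) \<in> cSO2" "(\<lambda>v. of_real (mu v)) \<in> cSO2"
    and "(\<lambda>v. zh v * cnj (zh v)) \<in> cSO2" "(\<lambda>v. zx v * cnj (zx v)) \<in> cSO2"
    and "\<And>p q. p \<in> letters \<Longrightarrow> q \<in> letters \<Longrightarrow> (\<lambda>v. p v * cnj (q v)) \<in> cSO2"
    and "\<And>p q. p \<in> letters \<Longrightarrow> q \<in> letters \<Longrightarrow> (\<lambda>v. p v * q v * cnj (zh v)) \<in> cSO2"
proof -
  have A: "f \<in> set polyA \<Longrightarrow> restrict f W \<in> algSO2" and B: "f \<in> set polyB \<Longrightarrow> restrict f W \<in> algSO2" for f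
    using generators_in by auto
  have real: "(\<lambda>v. F v * cnj (F v)) \<in> cSO2" if "restrict (\<lambda>v. Re (F v * cnj (F v))) W \<in> algSO2" for F
  proof -
    have "Im (F v * cnj (F v)) = 0" for v by simp
    then show ?thesis using that alg_const[OF algebra_generated] unfolding complex_part_def by simp
  qed
  show "(\<lambda>v. of_real (xi v)) \<in> cSO2" "(\<lambda>v. of_real (la v)) \<in> cSO2" "(\<lambda>v. of_real (mu v)) \<in> cSO2"
    by (rule complex_part_of_real[OF algebra_generated], rule B, simp add: polyB_def)
       (rule complex_part_of_real[OF algebra_generated], rule A, simp add: polyA_def)+
  have aa: "(\<lambda>v. za v * cnj (za v)) \<in> cSO2" and bb: "(\<lambda>v. zb v * cnj (zb v)) \<in> cSO2"
    and hh: "(\<lambda>v. zh v * cnj (zh v)) \<in> cSO2" and xx: "(\<lambda>v. zx v * cnj (zx v)) \<in> cSO2"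
    by (rule real, rule A, simp add: polyA_def)+
  show "(\<lambda>v. zh v * cnj (zh v)) \<in> cSO2" "(\<lambda>v. zx v * cnj (zx v)) \<in> cSO2" by (fact hh xx)+
  have ab: "(\<lambda>v. za v * cnj (zb v)) \<in> cSO2"
    and ax: "(\<lambda>v. cnj (za v) * zx v ^ 2) \<in> cSO2"
    and bx: "(\<lambda>v. cnj (zb v) * zx v ^ 2) \<in> cSO2"
    and aah: "(\<lambda>v. za v ^ 2 * cnj (zh v)) \<in> cSO2"
    and bbh: "(\<lambda>v. zb v ^ 2 * cnj (zh v)) \<in> cSO2"
    and abh: "(\<lambda>v. za v * zb v * cnj (zh v)) \<in> cSO2"
    and axh: "(\<lambda>v. za v * cnj (zh v) * zx v ^ 2) \<in> cSO2"
    and bxh: "(\<lambda>v. zb v * cnj (zh v) * zx v ^ 2) \<in> cSO2"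
    and xxh: "(\<lambda>v. cnj (zh v) * zx v ^ 4) \<in> cSO2"
    unfolding complex_part_def mem_Collect_eq
    by (rule conjI, rule A, simp add: polyA_def, rule B, simp add: polyB_def)+
  have xx2: "(\<lambda>v. (zx v * cnj (zx v))^2) \<in> cSO2" by (rule complex_part_power[OF algebra_generated xx])
  note cnj = complex_part_cnj[OF algebra_generated]
  have pq_aa: "(\<lambda>v. za v * cnj (za v)) \<in> cSO2"
    using aa by (simp add: power_mult_distrib mult_ac)
  have pq_ab: "(\<lambda>v. za v * cnj (zb v)) \<in> cSO2"
    using ab by (simp add: power_mult_distrib mult_ac)
  have pq_ax: "(\<lambda>v. za v * cnj (zx v ^ 2)) \<in> cSO2"
    using cnj[OF ax] by (simp add: power_mult_distrib mult_ac)
  have pq_ba: "(\<lambda>v. zb v * cnj (za v)) \<in> cSO2"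
    using cnj[OF ab] by (simp add: power_mult_distrib mult_ac)
  have pq_bb: "(\<lambda>v. zb v * cnj (zb v)) \<in> cSO2"
    using bb by (simp add: power_mult_distrib mult_ac)
  have pq_bx: "(\<lambda>v. zb v * cnj (zx v ^ 2)) \<in> cSO2"
    using cnj[OF bx] by (simp add: power_mult_distrib mult_ac)
  have pq_xa: "(\<lambda>v. zx v ^ 2 * cnj (za v)) \<in> cSO2"
    using ax by (simp add: power_mult_distrib mult_ac)
  have pq_xb: "(\<lambda>v. zx v ^ 2 * cnj (zb v)) \<in> cSO2"
    using bx by (simp add: power_mult_distrib mult_ac)
  have pq_xx: "(\<lambda>v. zx v ^ 2 * cnj (zx v ^ 2)) \<in> cSO2"
    using xx2 by (simp add: power_mult_distrib mult_ac)
  show "(\<lambda>v. p v * cnj (q v)) \<in> cSO2" if "p \<in> letters" "q \<in> letters" for p q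
    using that unfolding letters_def by (elim insertE emptyE; simp only: pq_aa pq_ab pq_ax pq_ba pq_bb pq_bx pq_xa pq_xb pq_xx)
  have x4: "zx v ^ 4 = zx v ^ 2 * zx v ^ 2" for v by (simp flip: power_add)
  have pqh_aa: "(\<lambda>v. za v * za v * cnj (zh v)) \<in> cSO2"
    using aah by (simp add: power2_eq_square)
  have pqh_ab: "(\<lambda>v. za v * zb v * cnj (zh v)) \<in> cSO2"
    using abh by (simp add: mult_ac)
  have pqh_ax: "(\<lambda>v. za v * zx v ^ 2 * cnj (zh v)) \<in> cSO2"
    using axh by (simp add: mult_ac)
  have pqh_ba: "(\<lambda>v. zb v * za v * cnj (zh v)) \<in> cSO2"
    using abh by (simp add: mult_ac)
  have pqh_bb: "(\<lambda>v. zb v * zb v * cnj (zh v)) \<in> cSO2"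
    using bbh by (simp add: power2_eq_square)
  have pqh_bx: "(\<lambda>v. zb v * zx v ^ 2 * cnj (zh v)) \<in> cSO2"
    using bxh by (simp add: mult_ac)
  have pqh_xa: "(\<lambda>v. zx v ^ 2 * za v * cnj (zh v)) \<in> cSO2"
    using axh by (simp add: mult_ac)
  have pqh_xb: "(\<lambda>v. zx v ^ 2 * zb v * cnj (zh v)) \<in> cSO2"
    using bxh by (simp add: mult_ac)
  have pqh_xx: "(\<lambda>v. zx v ^ 2 * zx v ^ 2 * cnj (zh v)) \<in> cSO2"
    using xxh unfolding x4 by (simp add: mult_ac)
  show "(\<lambda>v. p v * q v * cnj (zh v)) \<in> cSO2" if "p \<in> letters" "q \<in> letters" for p q
    using that unfolding letters_def by (elim insertE emptyE; simp only: pqh_aa pqh_ab pqh_ax pqh_ba pqh_bb pqh_bx pqh_xa pqh_xb pqh_xx)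
qed

text \<open>Monomials in the coordinates whose coefficient is any element of \<open>cSO2\<close>. Admitting these
  coefficients absorbs constants, \<open>\<xi>\<close>, \<open>\<lambda>\<close> and \<open>\<mu>\<close>, all of
  weight 0.\<close>

definition monomials :: "(tensor4 \<times> (real^2) \<Rightarrow> complex) set" where
  "monomials = {F. \<exists>R a a' ps qs d e. R \<in> cSO2 \<and> set ps \<subseteq> {za, zb} \<and> set qs \<subseteq> {za, zb} \<and>
     F = (\<lambda>v. R v * zx v ^ a * cnj (zx v) ^ a' * (\<Prod>p\<leftarrow>ps. p v) * cnj (\<Prod>q\<leftarrow>qs. q v) * zh v ^ d * cnj (zh v) ^ e)}"

lemma monomialsI:
  assumes "R \<in> cSO2" "set ps \<subseteq> {za, zb}" "set qs \<subseteq> {za, zb}"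
    "\<And>v. F v = R v * zx v ^ a * cnj (zx v) ^ a' * (\<Prod>p\<leftarrow>ps. p v) * cnj (\<Prod>q\<leftarrow>qs. q v) * zh v ^ d * cnj (zh v) ^ e"
  shows "F \<in> monomials"
  using assms unfolding monomials_def mem_Collect_eq fun_eq_iff by blast

lemma monomials_mult:
  assumes "F \<in> monomials" "F' \<in> monomials"
  shows "(\<lambda>v. F v * F' v) \<in> monomials"
proof -
  obtain R a a' ps qs d e where F: "R \<in> cSO2" "set ps \<subseteq> {za, zb}" "set qs \<subseteq> {za, zb}"
    "F = (\<lambda>v. R v * zx v ^ a * cnj (zx v) ^ a' * (\<Prod>p\<leftarrow>ps. p v) * cnj (\<Prod>q\<leftarrow>qs. q v) * zh v ^ d * cnj (zh v) ^ e)"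
    using assms(1) unfolding monomials_def by blast
  obtain R' b b' ps' qs' d' e' where F': "R' \<in> cSO2" "set ps' \<subseteq> {za, zb}" "set qs' \<subseteq> {za, zb}"
    "F' = (\<lambda>v. R' v * zx v ^ b * cnj (zx v) ^ b' * (\<Prod>p\<leftarrow>ps'. p v) * cnj (\<Prod>q\<leftarrow>qs'. q v) * zh v ^ d' * cnj (zh v) ^ e')"
    using assms(2) unfolding monomials_def by blast
  show ?thesis
    by (rule monomialsI[of "\<lambda>v. R v * R' v" "ps @ ps'" "qs @ qs'" _ "a + b" "a' + b'" "d + d'" "e + e'"])
      (use F F' complex_part_mult[OF algebra_generated F(1) F'(1)] in \<open>auto simp: power_add mult_ac\<close>)
qed

text \<open>After removing factors \<open>z * cnj z\<close>, an even power of \<open>z\<close> or of its conjugate is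
  left, which is a power of a letter.\<close>

lemma balanced_in_cSO2:
  assumes R: "R \<in> cSO2" and ps: "set ps \<subseteq> {za, zb}" and qs: "set qs \<subseteq> {za, zb}"
    and bal: "a + 2 * length ps + 4 * d = a' + 2 * length qs + 4 * e"
  shows "(\<lambda>v. R v * zx v ^ a * cnj (zx v) ^ a' * (\<Prod>p\<leftarrow>ps. p v) * cnj (\<Prod>q\<leftarrow>qs. q v) *
     zh v ^ d * cnj (zh v) ^ e) \<in> cSO2" (is "?F \<in> _")
proof -
  define x2 where "x2 = (\<lambda>v. zx v ^ 2)"
  have L: "set ps \<subseteq> letters" "set qs \<subseteq> letters" "x2 \<in> letters"
    using ps qs by (auto simp: letters_def x2_def)
  note bm = balanced_monomial[OF algebra_generated basic_invariants(6,7,4)]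
  note mult = complex_part_mult[OF algebra_generated]
  have sq: "(z ^ 2) ^ n = (z ^ n) ^ 2" for z :: complex and n by (simp add: mult.commute flip: power_mult)
  show ?thesis
  proof (cases "a \<ge> a'")
    case True
    define c where "c = (length qs + 2 * e) - (length ps + 2 * d)"
    have c: "a = a' + 2 * c" using True bal by (simp add: c_def)
    have "(\<lambda>v. R v * (zx v * cnj (zx v)) ^ a' *
       ((\<Prod>p\<leftarrow>replicate c x2 @ ps. p v) * cnj (\<Prod>q\<leftarrow>qs. q v) * zh v ^ d * cnj (zh v) ^ e)) \<in> cSO2"
      by (intro mult R complex_part_power[OF algebra_generated] basic_invariants(5) bm) (use L bal c in \<open>auto simp: set_replicate_conv_if\<close>)
    also have "(\<lambda>v. R v * (zx v * cnj (zx v)) ^ a' *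
       ((\<Prod>p\<leftarrow>replicate c x2 @ ps. p v) * cnj (\<Prod>q\<leftarrow>qs. q v) * zh v ^ d * cnj (zh v) ^ e)) = ?F"
      by (rule ext) (simp add: c x2_def prod_list_replicate power_add power_mult power_mult_distrib mult_ac sq)
    finally show ?thesis .
  next
    case False
    define c where "c = (length ps + 2 * d) - (length qs + 2 * e)"
    have c: "a' = a + 2 * c" using False bal by (simp add: c_def)
    have "(\<lambda>v. R v * (zx v * cnj (zx v)) ^ a *
       ((\<Prod>p\<leftarrow>ps. p v) * cnj (\<Prod>q\<leftarrow>replicate c x2 @ qs. q v) * zh v ^ d * cnj (zh v) ^ e)) \<in> cSO2"
      by (intro mult R complex_part_power[OF algebra_generated] basic_invariants(5) bm) (use L bal c in \<open>auto simp: set_replicate_conv_if\<close>)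
    also have "(\<lambda>v. R v * (zx v * cnj (zx v)) ^ a *
       ((\<Prod>p\<leftarrow>ps. p v) * cnj (\<Prod>q\<leftarrow>replicate c x2 @ qs. q v) * zh v ^ d * cnj (zh v) ^ e)) = ?F"
      by (rule ext) (simp add: c x2_def prod_list_replicate power_add power_mult power_mult_distrib mult_ac sq)
    finally show ?thesis .
  qed
qed

lemma coordinates_rotation:
  assumes "v \<in> W" "norm u = 1"
  shows "za (act (rotation u) v) = u^2 * za v" "zb (act (rotation u) v) = u^2 * zb v"
    "zh (act (rotation u) v) = u^4 * zh v" "zx (act (rotation u) v) = u * zx v"
  using coordinates_unique[OF Phi_act_rotation(1)[OF assms]] Phi_act_rotation(2)[OF assms] by auto

text \<open>For fixed \<open>v\<close>, the value of \<open>F\<close> at the point rotated by \<open>u\<close> is a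
  Laurent polynomial in \<open>u\<close>, because \<open>cnj u\<close> is the inverse of \<open>u\<close>. Its
  constant coefficient is the sum of the monomials of weight 0, an element of \<open>cSO2\<close>. The factor
  \<open>u ^ N\<close> turns the Laurent polynomial into a polynomial; stating the claim for all large
  \<open>N\<close> makes it additive.\<close>

lemma weight_zero_part:
  assumes "F \<in> sums_of monomials"
  shows "\<exists>N0. \<exists>G\<in>cSO2. \<forall>v\<in>W. \<forall>N\<ge>N0. \<exists>Q.
     (\<forall>u. norm u = 1 \<longrightarrow> u ^ N * F (act (rotation u) v) = poly Q u) \<and> coeff Q N = G v"
  using assms
proof induction
  case (sums_of_base F)
  then obtain R a a' ps qs d e where R: "R \<in> cSO2" and ps: "set ps \<subseteq> {za, zb}" and qs: "set qs \<subseteq> {za, zb}"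
    and F: "F = (\<lambda>v. R v * zx v ^ a * cnj (zx v) ^ a' * (\<Prod>p\<leftarrow>ps. p v) * cnj (\<Prod>q\<leftarrow>qs. q v) * zh v ^ d * cnj (zh v) ^ e)"
    unfolding monomials_def by blast
  define x y where "x = a + 2 * length ps + 4 * d" and "y = a' + 2 * length qs + 4 * e"
  have prod: "(\<Prod>p\<leftarrow>rs. p (act (rotation u) v)) = u ^ (2 * length rs) * (\<Prod>p\<leftarrow>rs. p v)"
    if "set rs \<subseteq> {za, zb}" "v \<in> W" "norm u = 1" for rs v u
    using that(1) by (induction rs) (auto simp: coordinates_rotation[OF that(2,3)] power2_eq_square mult_ac)
  have act: "F (act (rotation u) v) = u ^ x * cnj u ^ y * F v" if "v \<in> W" "norm u = 1" for u v
    unfolding F prod[OF ps that] prod[OF qs that] coordinates_rotation[OF that] cSO2_rotation[OF R that] x_def y_def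
    by (simp add: power_mult_distrib power_add mult_ac flip: power_mult)
  have rot: "u ^ N * F (act (rotation u) v) = poly (monom (F v) (N + x - y)) u"
    if "v \<in> W" "norm u = 1" "y \<le> N" for u v N
  proof -
    have u: "u * cnj u = 1" using complex_norm_square[of u] that by simp
    have "u ^ N * F (act (rotation u) v) = u ^ (N + x - y + y) * cnj u ^ y * F v"
      using that by (simp add: act power_add)
    also have "\<dots> = u ^ (N + x - y) * (u * cnj u) ^ y * F v"
      by (simp add: power_add power_mult_distrib)
    finally show ?thesis by (simp add: u poly_monom)
  qed
  define G where "G = (if x = y then F else (\<lambda>_. 0))"
  have "G \<in> cSO2"
    using balanced_in_cSO2[OF R ps qs, of a d a' e] complex_part_const[OF algebra_generated]
    unfolding G_def x_def y_def F by auto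
  moreover have "\<forall>v\<in>W. \<forall>N\<ge>y. \<exists>Q.
     (\<forall>u. norm u = 1 \<longrightarrow> u ^ N * F (act (rotation u) v) = poly Q u) \<and> coeff Q N = G v"
  proof (intro ballI allI impI)
    fix v N assume "v \<in> W" "y \<le> N"
    then show "\<exists>Q. (\<forall>u. norm u = 1 \<longrightarrow> u ^ N * F (act (rotation u) v) = poly Q u) \<and> coeff Q N = G v"
      by (intro exI[of _ "monom (F v) (N + x - y)"]) (auto simp: rot G_def)
  qed
  ultimately show ?case by blast
next
  case (sums_of_add F F')
  from sums_of_add.IH obtain N0 G where 1: "G \<in> cSO2" "\<And>v N. v \<in> W \<Longrightarrow> N \<ge> N0 \<Longrightarrow> \<exists>Q.
     (\<forall>u. norm u = 1 \<longrightarrow> u ^ N * F (act (rotation u) v) = poly Q u) \<and> coeff Q N = G v" by blast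
  from sums_of_add.IH obtain N0' G' where 2: "G' \<in> cSO2" "\<And>v N. v \<in> W \<Longrightarrow> N \<ge> N0' \<Longrightarrow> \<exists>Q.
     (\<forall>u. norm u = 1 \<longrightarrow> u ^ N * F' (act (rotation u) v) = poly Q u) \<and> coeff Q N = G' v" by blast
  show ?case
  proof (intro exI[of _ "max N0 N0'"] bexI[of _ "\<lambda>v. G v + G' v"] ballI allI impI)
    show "(\<lambda>v. G v + G' v) \<in> cSO2" by (rule complex_part_add[OF algebra_generated 1(1) 2(1)])
    fix v N assume v: "v \<in> W" "max N0 N0' \<le> N"
    obtain Q Q' where "\<forall>u. norm u = 1 \<longrightarrow> u ^ N * F (act (rotation u) v) = poly Q u" "coeff Q N = G v"
      "\<forall>u. norm u = 1 \<longrightarrow> u ^ N * F' (act (rotation u) v) = poly Q' u" "coeff Q' N = G' v"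
      using 1(2)[of v N] 2(2)[of v N] v by auto
    then show "\<exists>Q. (\<forall>u. norm u = 1 \<longrightarrow> u ^ N * (F (act (rotation u) v) + F' (act (rotation u) v)) = poly Q u) \<and>
        coeff Q N = G v + G' v"
      by (intro exI[of _ "Q + Q'"]) (simp add: distrib_left)
  qed
qed

text \<open>For an invariant function the Laurent polynomial is constant on the circle, so it equals its constant
  coefficient. This replaces averaging over the group.\<close>

lemma invariant_in_cSO2:
  assumes "F \<in> sums_of monomials"
    and inv: "\<And>v u. v \<in> W \<Longrightarrow> norm u = 1 \<Longrightarrow> F (act (rotation u) v) = F v"
  shows "\<exists>G\<in>cSO2. \<forall>v\<in>W. F v = G v"
proof -
  obtain N G where G: "G \<in> cSO2" "\<forall>v\<in>W. \<exists>Q.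
     (\<forall>u. norm u = 1 \<longrightarrow> u ^ N * F (act (rotation u) v) = poly Q u) \<and> coeff Q N = G v"
    using weight_zero_part[OF assms(1)] by blast
  have "F v = G v" if v: "v \<in> W" for v
  proof -
    obtain Q where Q: "\<forall>u. norm u = 1 \<longrightarrow> u ^ N * F v = poly Q u" "coeff Q N = G v"
      using bspec[OF G(2) v] inv[OF v] by auto
    have "monom (F v) N = Q" by (rule poly_eq_on_circle) (use Q in \<open>simp add: poly_monom mult.commute\<close>)
    then show ?thesis using Q(2) by auto
  qed
  then show ?thesis using G(1) by blast
qed

lemma Phi_inverse:
  obtains \<Psi> where "\<And>h. h \<in> Harm_sum \<Longrightarrow> \<Psi> h \<in> Gel" "\<And>P. P \<in> Gel \<Longrightarrow> \<Psi> (\<Phi> P) = P"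
    "\<And>h. h \<in> Harm_sum \<Longrightarrow> \<Phi> (\<Psi> h) = h"
proof
  show "h \<in> Harm_sum \<Longrightarrow> inv_into Gel \<Phi> h \<in> Gel" for h using Phi_bij by (metis bij_betw_def inv_into_into)
  show "P \<in> Gel \<Longrightarrow> inv_into Gel \<Phi> (\<Phi> P) = P" for P using Phi_bij by (metis bij_betw_inv_into_left)
  show "h \<in> Harm_sum \<Longrightarrow> \<Phi> (inv_into Gel \<Phi> h) = h" for h using Phi_bij by (metis bij_betw_inv_into_right)
qed

text \<open>The inverse of the decomposition is linear, so linear functionals of the tensor are linear combinations of
  the coordinates. Together with closure under sums and products this expresses every polynomial by monomials.\<close>

lemma linear_in_coordinates:
  fixes L :: "tensor4 \<times> (real^2) \<Rightarrow> real"
  assumes "linear L"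
  obtains c1 c2 c3 c4 c5 c6 c7 c8 c9 c10 c11 where "\<forall>v\<in>W. L v =
    c1 * xi v + c2 * la v + c3 * mu v + c4 * Re (za v) + c5 * Im (za v) + c6 * Re (zb v) + c7 * Im (zb v) +
    c8 * Re (zh v) + c9 * Im (zh v) + c10 * Re (zx v) + c11 * Im (zx v)"
proof -
  obtain \<Psi> where \<Psi>: "\<And>h. h \<in> Harm_sum \<Longrightarrow> \<Psi> h \<in> Gel" "\<And>P. P \<in> Gel \<Longrightarrow> \<Psi> (\<Phi> P) = P"
    "\<And>h. h \<in> Harm_sum \<Longrightarrow> \<Phi> (\<Psi> h) = h" using Phi_inverse by blast
  have H: "hcx \<xi> l m a b w \<in> Harm_sum" for \<xi> l m a b w by (auto simp: Harm_sum_hcx)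
  have closed: "h \<in> Harm_sum \<Longrightarrow> h' \<in> Harm_sum \<Longrightarrow> h + h' \<in> Harm_sum"
    "h \<in> Harm_sum \<Longrightarrow> c *\<^sub>R h \<in> Harm_sum" for h h' c
    by (auto simp: Harm_sum_hcx hcx_linear)
  define M where "M h = L (\<Psi> h, 0)" for h
  have add: "M (h + h') = M h + M h'" if "h \<in> Harm_sum" "h' \<in> Harm_sum" for h h'
  proof -
    have "\<Psi> (h + h') = \<Psi> h + \<Psi> h'"
      using \<Psi>(2)[of "\<Psi> h + \<Psi> h'"] that \<Psi> by (simp add: Gel_subspace Phi_linear)
    then show ?thesis using linear_add[OF assms, of "(\<Psi> h, 0)" "(\<Psi> h', 0)"] by (simp add: M_def)
  qed
  have scale: "M (c *\<^sub>R h) = c * M h" if "h \<in> Harm_sum" for h c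
  proof -
    have "\<Psi> (c *\<^sub>R h) = c *\<^sub>R \<Psi> h"
      using \<Psi>(2)[of "c *\<^sub>R \<Psi> h"] that \<Psi> by (simp add: Gel_subspace Phi_linear)
    then show ?thesis using linear_scale[OF assms, of c "(\<Psi> h, 0)"] by (simp add: M_def)
  qed
  have "L v = M (hcx 1 0 0 0 0 0) * xi v + M (hcx 0 1 0 0 0 0) * la v + M (hcx 0 0 1 0 0 0) * mu v +
     M (hcx 0 0 0 1 0 0) * Re (za v) + M (hcx 0 0 0 \<i> 0 0) * Im (za v) +
     M (hcx 0 0 0 0 1 0) * Re (zb v) + M (hcx 0 0 0 0 \<i> 0) * Im (zb v) +
     M (hcx 0 0 0 0 0 1) * Re (zh v) + M (hcx 0 0 0 0 0 \<i>) * Im (zh v) +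
     L (0, axis 1 1) * Re (zx v) + L (0, axis 2 1) * Im (zx v)" if "v \<in> W" for v
  proof -
    obtain P x where v: "v = (P, x)" "P \<in> Gel" using \<open>v \<in> W\<close> by auto
    have "\<Phi> P = xi v *\<^sub>R hcx 1 0 0 0 0 0 + (la v *\<^sub>R hcx 0 1 0 0 0 0 + (mu v *\<^sub>R hcx 0 0 1 0 0 0 +
       (Re (za v) *\<^sub>R hcx 0 0 0 1 0 0 + (Im (za v) *\<^sub>R hcx 0 0 0 \<i> 0 0 +
       (Re (zb v) *\<^sub>R hcx 0 0 0 0 1 0 + (Im (zb v) *\<^sub>R hcx 0 0 0 0 \<i> 0 +
       (Re (zh v) *\<^sub>R hcx 0 0 0 0 0 1 + Im (zh v) *\<^sub>R hcx 0 0 0 0 0 \<i>)))))))"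
      using Phi_coordinates[OF that] by (simp add: v hcx_linear complex_eq_iff)
    then have "M (\<Phi> P) = M (hcx 1 0 0 0 0 0) * xi v + M (hcx 0 1 0 0 0 0) * la v + M (hcx 0 0 1 0 0 0) * mu v +
     M (hcx 0 0 0 1 0 0) * Re (za v) + M (hcx 0 0 0 \<i> 0 0) * Im (za v) +
     M (hcx 0 0 0 0 1 0) * Re (zb v) + M (hcx 0 0 0 0 \<i> 0) * Im (zb v) +
     M (hcx 0 0 0 0 0 1) * Re (zh v) + M (hcx 0 0 0 0 0 \<i>) * Im (zh v)"
      by (simp add: add scale H closed)
    moreover have "L (0, x) = L (0, axis 1 1) * Re (zx v) + L (0, axis 2 1) * Im (zx v)"
    proof -
      have "(0, x) = Re (zx v) *\<^sub>R (0, axis 1 1) + Im (zx v) *\<^sub>R (0::tensor4, axis 2 1)"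
        by (simp add: v zx_def z1_def vec_eq_iff forall_2 axis_def)
      then show ?thesis by (simp only: linear_add[OF assms] linear_scale[OF assms]) simp
    qed
    moreover have "L v = L (P, 0) + L (0, x)" using linear_add[OF assms, of "(P, 0)" "(0, x)"] by (simp add: v)
    ultimately show ?thesis using \<Psi>(2)[OF v(2)] by (simp add: M_def)
  qed
  then show ?thesis by (rule that[OF ballI])
qed

lemma coordinates_in_monomials:
  "R \<in> cSO2 \<Longrightarrow> R \<in> monomials"
  "za \<in> monomials" "(\<lambda>v. cnj (za v)) \<in> monomials" "zb \<in> monomials" "(\<lambda>v. cnj (zb v)) \<in> monomials"
  "zh \<in> monomials" "(\<lambda>v. cnj (zh v)) \<in> monomials" "zx \<in> monomials" "(\<lambda>v. cnj (zx v)) \<in> monomials"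
proof -
  note c = complex_part_const[OF algebra_generated, of 1]
  show "R \<in> cSO2 \<Longrightarrow> R \<in> monomials" by (rule monomialsI[of R "[]" "[]" _ 0 0 0 0]) auto
  show "za \<in> monomials" by (rule monomialsI[OF c, of "[za]" "[]" _ 0 0 0 0]) auto
  show "(\<lambda>v. cnj (za v)) \<in> monomials" by (rule monomialsI[OF c, of "[]" "[za]" _ 0 0 0 0]) auto
  show "zb \<in> monomials" by (rule monomialsI[OF c, of "[zb]" "[]" _ 0 0 0 0]) auto
  show "(\<lambda>v. cnj (zb v)) \<in> monomials" by (rule monomialsI[OF c, of "[]" "[zb]" _ 0 0 0 0]) auto
  show "zh \<in> monomials" by (rule monomialsI[OF c, of "[]" "[]" _ 0 0 1 0]) auto
  show "(\<lambda>v. cnj (zh v)) \<in> monomials" by (rule monomialsI[OF c, of "[]" "[]" _ 0 0 0 1]) auto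
  show "zx \<in> monomials" by (rule monomialsI[OF c, of "[]" "[]" _ 1 0 0 0]) auto
  show "(\<lambda>v. cnj (zx v)) \<in> monomials" by (rule monomialsI[OF c, of "[]" "[]" _ 0 1 0 0]) auto
qed

lemma polynomial_sum_of_monomials:
  assumes "real_polynomial_function p"
  shows "\<exists>F\<in>sums_of monomials. \<forall>v\<in>W. complex_of_real (p v) = F v"
  using assms
proof induction
  case (linear L)
  obtain c1 c2 c3 c4 c5 c6 c7 c8 c9 c10 c11 where L: "\<forall>v\<in>W. L v =
    c1 * xi v + c2 * la v + c3 * mu v + c4 * Re (za v) + c5 * Im (za v) + c6 * Re (zb v) + c7 * Im (zb v) +
    c8 * Re (zh v) + c9 * Im (zh v) + c10 * Re (zx v) + c11 * Im (zx v)"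
    by (rule linear_in_coordinates[OF bounded_linear.linear[OF linear]])
  have ri: "(\<lambda>v. of_real (c * Re (F v))) \<in> sums_of monomials" "(\<lambda>v. of_real (c * Im (F v))) \<in> sums_of monomials"
    if "F \<in> monomials" "(\<lambda>v. cnj (F v)) \<in> monomials" for c F
  proof -
    have m: "(\<lambda>v. k * F v) \<in> monomials" "(\<lambda>v. k * cnj (F v)) \<in> monomials" for k
      using monomials_mult[OF coordinates_in_monomials(1)[OF complex_part_const[OF algebra_generated]]] that by auto
    have "(\<lambda>v. k * F v + k' * cnj (F v)) \<in> sums_of monomials" for k k'
      by (rule sums_of_add; rule sums_of_base; rule m)
    moreover have "complex_of_real (c * Re z) = of_real c / 2 * z + of_real c / 2 * cnj z"
      "complex_of_real (c * Im z) = - \<i> * of_real c / 2 * z + \<i> * of_real c / 2 * cnj z" for z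
      by (simp_all add: complex_eq_iff)
    ultimately show "(\<lambda>v. of_real (c * Re (F v))) \<in> sums_of monomials"
      "(\<lambda>v. of_real (c * Im (F v))) \<in> sums_of monomials" by presburger+
  qed
  have r: "(\<lambda>v. of_real (c * f v)) \<in> sums_of monomials" if "(\<lambda>v. complex_of_real (f v)) \<in> cSO2" for c f
    using sums_of_base[OF monomials_mult[OF coordinates_in_monomials(1)[OF complex_part_const[OF algebra_generated, of "of_real c"]]
        coordinates_in_monomials(1)[OF that]]]
    by simp
  note c = r[OF basic_invariants(1), of c1] r[OF basic_invariants(2), of c2] r[OF basic_invariants(3), of c3]
    ri[OF coordinates_in_monomials(2,3)] ri[OF coordinates_in_monomials(4,5)]
    ri[OF coordinates_in_monomials(6,7)] ri[OF coordinates_in_monomials(8,9)]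
  show ?case
    by (rule bexI[of _ "\<lambda>v. of_real (c1 * xi v) + of_real (c2 * la v) + of_real (c3 * mu v) +
        of_real (c4 * Re (za v)) + of_real (c5 * Im (za v)) + of_real (c6 * Re (zb v)) + of_real (c7 * Im (zb v)) +
        of_real (c8 * Re (zh v)) + of_real (c9 * Im (zh v)) + of_real (c10 * Re (zx v)) + of_real (c11 * Im (zx v))"])
      (simp add: L, intro sums_of_add c)
next
  case (const c)
  show ?case
    by (rule bexI[of _ "\<lambda>_. of_real c"])
      (auto intro!: sums_of_base coordinates_in_monomials(1) complex_part_const[OF algebra_generated])
next
  case (add p q)
  then obtain F F' where "F \<in> sums_of monomials" "F' \<in> sums_of monomials"
    "\<forall>v\<in>W. complex_of_real (p v) = F v" "\<forall>v\<in>W. complex_of_real (q v) = F' v" by blast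
  then show ?case
    by (intro bexI[of _ "\<lambda>v. F v + F' v"] sums_of_add) simp_all
next
  case (mult p q)
  then obtain F F' where "F \<in> sums_of monomials" "F' \<in> sums_of monomials"
    "\<forall>v\<in>W. complex_of_real (p v) = F v" "\<forall>v\<in>W. complex_of_real (q v) = F' v" by blast
  then show ?case
    by (intro bexI[of _ "\<lambda>v. F v * F' v"] sums_of_mult_closed[OF monomials_mult]) simp_all
qed

text \<open>Any invariant polynomial is a sum of monomials in the complex coordinates; rotation invariance reduces it
  to monomials of weight 0, and these are products of the irreducible ones, whose real and imaginary parts are in (A)
  and (B).\<close>

theorem algSO2_eq: "algSO2 = Cov Gel act4 SO2"
proof (rule antisym[OF algSO2_subset], rule subsetI)
  fix f assume f: "f \<in> Cov Gel act4 SO2"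
  then obtain p where p: "real_polynomial_function p" "f = restrict p W"
    by (auto simp: Cov_iff polynomials_on_def)
  obtain F where F: "F \<in> sums_of monomials" "\<forall>v\<in>W. complex_of_real (p v) = F v"
    using polynomial_sum_of_monomials[OF p(1)] by blast
  have "F (act (rotation u) v) = F v" if "v \<in> W" "norm u = 1" for v u
  proof -
    have "f (act (rotation u) v) = f v" using f rotation_SO2 that unfolding Cov_iff by blast
    then have "p (act (rotation u) v) = p v"
      using that(1) act_in_W[OF that(1)] by (simp only: p(2) restrict_apply')
    then show ?thesis using bspec[OF F(2)] that(1) act_in_W[OF that(1)] by metis
  qed
  from invariant_in_cSO2[OF F(1) this] obtain G where G: "G \<in> cSO2" "\<forall>v\<in>W. F v = G v" by blast
  have "f = restrict (\<lambda>v. Re (G v)) W"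
    unfolding p(2)
  proof (rule restrict_ext)
    fix v assume "v \<in> W"
    then have "complex_of_real (p v) = G v" using bspec[OF F(2)] bspec[OF G(2)] by metis
    then show "p v = Re (G v)" by (metis Re_complex_of_real)
  qed
  then show "f \<in> algSO2" using complex_partD(1)[OF G(1)] by simp
qed

end

section \<open>Reflection-invariant polynomials\<close>

context harmonic_coordinates
begin

lemma letters_Re:
  shows "\<And>p q. p \<in> letters \<Longrightarrow> q \<in> letters \<Longrightarrow> restrict (\<lambda>v. Re (p v * cnj (q v))) W \<in> algO2"
    and "\<And>p q. p \<in> letters \<Longrightarrow> q \<in> letters \<Longrightarrow> restrict (\<lambda>v. Re (p v * q v * cnj (zh v))) W \<in> algO2"
    and "restrict (\<lambda>v. Re (zh v * cnj (zh v))) W \<in> algO2"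
proof -
  have A: "f \<in> set polyA \<Longrightarrow> restrict f W \<in> algO2" for f
    using generators_in by auto
  have zh: "restrict (\<lambda>v. Re (zh v * cnj (zh v))) W \<in> algO2"
    and xx: "restrict (\<lambda>v. Re (zx v * cnj (zx v))) W \<in> algO2"
    and aa: "restrict (\<lambda>v. Re (za v * cnj (za v))) W \<in> algO2"
    and bb: "restrict (\<lambda>v. Re (zb v * cnj (zb v))) W \<in> algO2"
    and ab: "restrict (\<lambda>v. Re (za v * cnj (zb v))) W \<in> algO2"
    and ax: "restrict (\<lambda>v. Re (cnj (za v) * zx v ^ 2)) W \<in> algO2"
    and bx: "restrict (\<lambda>v. Re (cnj (zb v) * zx v ^ 2)) W \<in> algO2"
    and aah: "restrict (\<lambda>v. Re (za v ^ 2 * cnj (zh v))) W \<in> algO2"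
    and bbh: "restrict (\<lambda>v. Re (zb v ^ 2 * cnj (zh v))) W \<in> algO2"
    and abh: "restrict (\<lambda>v. Re (za v * zb v * cnj (zh v))) W \<in> algO2"
    and axh: "restrict (\<lambda>v. Re (za v * cnj (zh v) * zx v ^ 2)) W \<in> algO2"
    and bxh: "restrict (\<lambda>v. Re (zb v * cnj (zh v) * zx v ^ 2)) W \<in> algO2"
    and xxh: "restrict (\<lambda>v. Re (cnj (zh v) * zx v ^ 4)) W \<in> algO2"
    by (rule A, simp add: polyA_def)+
  show "restrict (\<lambda>v. Re (zh v * cnj (zh v))) W \<in> algO2" by (fact zh)
  have swap: "Re (x * cnj y) = Re (y * cnj x)" for x y by simp
  have x2: "Re (zx v ^ 2 * cnj (zx v ^ 2)) = Re (zx v * cnj (zx v)) * Re (zx v * cnj (zx v))" for v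
    by (simp add: power2_eq_square algebra_simps)
  have pq_ax: "restrict (\<lambda>v. Re (za v * cnj (zx v ^ 2))) W \<in> algO2"
    using ax by (subst swap) (simp only: mult.commute)
  have pq_bx: "restrict (\<lambda>v. Re (zb v * cnj (zx v ^ 2))) W \<in> algO2"
    using bx by (subst swap) (simp only: mult.commute)
  have pq_xa: "restrict (\<lambda>v. Re (zx v ^ 2 * cnj (za v))) W \<in> algO2" using pq_ax by (subst swap)
  have pq_xb: "restrict (\<lambda>v. Re (zx v ^ 2 * cnj (zb v))) W \<in> algO2" using pq_bx by (subst swap)
  have pq_ba: "restrict (\<lambda>v. Re (zb v * cnj (za v))) W \<in> algO2" using ab by (subst swap)
  have pq_xx: "restrict (\<lambda>v. Re (zx v ^ 2 * cnj (zx v ^ 2))) W \<in> algO2"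
    unfolding x2 by (rule alg_mult[OF algebra_generated xx xx])
  show "restrict (\<lambda>v. Re (p v * cnj (q v))) W \<in> algO2" if "p \<in> letters" "q \<in> letters" for p q
    using that unfolding letters_def
    by (elim insertE emptyE; simp only: aa bb ab pq_ax pq_bx pq_xa pq_xb pq_ba pq_xx)
  have x4: "zx v ^ 4 = zx v ^ 2 * zx v ^ 2" for v by (simp flip: power_add)
  have h_ax: "restrict (\<lambda>v. Re (za v * zx v ^ 2 * cnj (zh v))) W \<in> algO2" using axh by (simp only: mult_ac)
  have h_bx: "restrict (\<lambda>v. Re (zb v * zx v ^ 2 * cnj (zh v))) W \<in> algO2" using bxh by (simp only: mult_ac)
  have h_xa: "restrict (\<lambda>v. Re (zx v ^ 2 * za v * cnj (zh v))) W \<in> algO2" using axh by (simp only: mult_ac)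
  have h_xb: "restrict (\<lambda>v. Re (zx v ^ 2 * zb v * cnj (zh v))) W \<in> algO2" using bxh by (simp only: mult_ac)
  have h_ba: "restrict (\<lambda>v. Re (zb v * za v * cnj (zh v))) W \<in> algO2" using abh by (simp only: mult_ac)
  have h_xx: "restrict (\<lambda>v. Re (zx v ^ 2 * zx v ^ 2 * cnj (zh v))) W \<in> algO2"
    using xxh unfolding x4 by (simp only: mult_ac)
  show "restrict (\<lambda>v. Re (p v * q v * cnj (zh v))) W \<in> algO2" if "p \<in> letters" "q \<in> letters" for p q
    using that unfolding letters_def
    by (elim insertE emptyE;
        simp only: aah[unfolded power2_eq_square] bbh[unfolded power2_eq_square] abh h_ax h_bx h_xa h_xb h_ba h_xx)
qed

text \<open>The product of imaginary parts \<open>Im m * Im n\<close> is \<open>Re (m * cnj n) - Re m * Re n\<close>.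
  If \<open>m\<close> and \<open>n\<close> share a letter, then \<open>m * cnj n\<close> is a squared modulus times a
  shorter monomial, and everything is expressed by real parts.\<close>

lemma Im_pair_pair_shared:
  assumes "p \<in> letters" "q \<in> letters" "r \<in> letters"
  shows "restrict (\<lambda>v. Im (p v * cnj (q v)) * Im (r v * cnj (q v))) W \<in> algO2"
proof -
  have "Im (x * cnj y) * Im (z * cnj y) =
      Re (y * cnj y) * Re (x * cnj z) - Re (x * cnj y) * Re (z * cnj y)" for x y z
    by (simp add: algebra_simps)
  then show ?thesis
    using assms by (simp only:) (intro alg_diff[OF algebra_generated] alg_mult[OF algebra_generated] letters_Re)
qed

text \<open>Two pairs out of three letters always share a letter or one of the imaginary parts is zero. Exchanging the
  members of a pair only changes the sign.\<close>

lemma Im_pair_pair: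
  assumes "p \<in> letters" "q \<in> letters" "r \<in> letters" "s \<in> letters"
  shows "restrict (\<lambda>v. Im (p v * cnj (q v)) * Im (r v * cnj (s v))) W \<in> algO2"
proof -
  have swap: "Im (x * cnj y) = - Im (y * cnj x)" for x y by simp
  consider "p = q" | "r = s" | "q = s" | "q = r" | "p = r" | "p = s"
    using assms unfolding letters_def by blast
  then show ?thesis
  proof cases
    case 1
    have "Im (q v * cnj (q v)) = 0" for v by simp
    then show ?thesis unfolding 1 by (simp only: mult_zero_left alg_const[OF algebra_generated])
  next
    case 2
    have "Im (s v * cnj (s v)) = 0" for v by simp
    then show ?thesis unfolding 2 by (simp only: mult_zero_right alg_const[OF algebra_generated])
  next
    case 3
    then show ?thesis using Im_pair_pair_shared assms by simp
  next
    case 4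
    have "Im (p v * cnj (q v)) * Im (r v * cnj (s v)) = - (Im (p v * cnj (q v)) * Im (s v * cnj (q v)))" for v
      unfolding 4 swap[of "r v" "s v"] by (simp add: algebra_simps)
    then show ?thesis by (simp only: alg_uminus[OF algebra_generated Im_pair_pair_shared] assms)
  next
    case 5
    have "Im (p v * cnj (q v)) * Im (r v * cnj (s v)) = Im (q v * cnj (p v)) * Im (s v * cnj (p v))" for v
      unfolding 5 swap[of "r v" "s v"] swap[of "r v" "q v"] by (simp add: algebra_simps)
    then show ?thesis by (simp only: Im_pair_pair_shared assms)
  next
    case 6
    have "Im (p v * cnj (q v)) * Im (r v * cnj (s v)) = - (Im (q v * cnj (p v)) * Im (r v * cnj (p v)))" for v
      unfolding 6 swap[of "s v" "q v"] by (simp add: algebra_simps)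
    then show ?thesis by (simp only: alg_uminus[OF algebra_generated Im_pair_pair_shared] assms)
  qed
qed

lemma Im_pair_triple_shared:
  assumes "p \<in> letters" "q \<in> letters" "s \<in> letters"
  shows "restrict (\<lambda>v. Im (p v * cnj (q v)) * Im (p v * s v * cnj (zh v))) W \<in> algO2"
proof -
  have "Im (x * cnj y) * Im (x * z * cnj w) =
      Re (x * cnj x) * Re (y * z * cnj w) - Re (x * cnj y) * Re (x * z * cnj w)" for x y z w
    by (simp add: algebra_simps)
  then show ?thesis
    using assms by (simp only:) (intro alg_diff[OF algebra_generated] alg_mult[OF algebra_generated] letters_Re)
qed

text \<open>With three letters, the pair and the triple can be disjoint only if the triple contains a letter
  \<open>r\<close> twice. Then \<open>(p * cnj q) * (r * r * cnj w) = (p * r * cnj w) * (r * cnj q)\<close> expresses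
  the product by the one of two monomials that share \<open>r\<close>.\<close>

lemma Im_pair_triple:
  assumes "p \<in> letters" "q \<in> letters" "r \<in> letters" "s \<in> letters"
  shows "restrict (\<lambda>v. Im (p v * cnj (q v)) * Im (r v * s v * cnj (zh v))) W \<in> algO2"
proof -
  have swap: "Im (x * cnj y) = - Im (y * cnj x)" for x y by simp
  consider "p = q" | "p = r" | "p = s" | "q = r" | "q = s" | "r = s"
    using assms unfolding letters_def by blast
  then show ?thesis
  proof cases
    case 1
    have "Im (q v * cnj (q v)) = 0" for v by simp
    then show ?thesis unfolding 1 by (simp only: mult_zero_left alg_const[OF algebra_generated])
  next
    case 2
    then show ?thesis using Im_pair_triple_shared assms by simp
  next
    case 3
    have "Im (p v * cnj (q v)) * Im (r v * s v * cnj (zh v)) =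
        Im (s v * cnj (q v)) * Im (s v * r v * cnj (zh v))" for v
      unfolding 3 by (simp add: algebra_simps)
    then show ?thesis by (simp only: Im_pair_triple_shared assms)
  next
    case 4
    have "Im (p v * cnj (q v)) * Im (r v * s v * cnj (zh v)) =
        - (Im (r v * cnj (p v)) * Im (r v * s v * cnj (zh v)))" for v
      unfolding 4 swap[of "p v" "r v"] by (simp add: algebra_simps)
    then show ?thesis by (simp only: alg_uminus[OF algebra_generated Im_pair_triple_shared] assms)
  next
    case 5
    have "Im (p v * cnj (q v)) * Im (r v * s v * cnj (zh v)) =
        - (Im (s v * cnj (p v)) * Im (s v * r v * cnj (zh v)))" for v
      unfolding 5 swap[of "p v" "s v"] by (simp add: algebra_simps)
    then show ?thesis by (simp only: alg_uminus[OF algebra_generated Im_pair_triple_shared] assms)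
  next
    case 6
    have "Im (x * cnj y) * Im (z * z * cnj w) =
        Re (x * cnj y) * Re (z * z * cnj w) - Re (x * z * cnj w) * Re (z * cnj y) +
        Im (z * cnj y) * Im (z * x * cnj w)" for x y z w
      by (simp add: algebra_simps)
    then show ?thesis
      using assms unfolding 6
      by (simp only:) (intro alg_add[OF algebra_generated] alg_diff[OF algebra_generated] alg_mult[OF algebra_generated letters_Re(1,2)]
          alg_mult[OF algebra_generated letters_Re(2,1)] Im_pair_triple_shared)
  qed
qed

text \<open>Here \<open>m * cnj n\<close> is the squared modulus of \<open>z\<^sub>4\<close> times two pairs, which
  reduces the claim to pairs.\<close>

lemma Im_triple_triple:
  assumes "p \<in> letters" "q \<in> letters" "r \<in> letters" "s \<in> letters"
  shows "restrict (\<lambda>v. Im (p v * q v * cnj (zh v)) * Im (r v * s v * cnj (zh v))) W \<in> algO2"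
proof -
  have "Im (x * y * cnj w) * Im (x' * y' * cnj w) =
      Re (w * cnj w) * (Re (x * cnj x') * Re (y * cnj y') - Im (x * cnj x') * Im (y * cnj y')) -
      Re (x * y * cnj w) * Re (x' * y' * cnj w)" for x y x' y' w
    by (simp add: algebra_simps)
  then show ?thesis
    using assms
    by (simp only:) (intro alg_diff[OF algebra_generated] alg_mult[OF algebra_generated letters_Re(3)] alg_mult[OF algebra_generated letters_Re(1,1)]
        alg_mult[OF algebra_generated letters_Re(2,2)] Im_pair_pair)
qed

definition odd_forms :: "(tensor4 \<times> (real^2) \<Rightarrow> real) set" where
  "odd_forms = {\<lambda>v. Im (p v * cnj (q v)) | p q. p \<in> letters \<and> q \<in> letters} \<union>
     {\<lambda>v. Im (p v * q v * cnj (zh v)) | p q. p \<in> letters \<and> q \<in> letters}"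

lemma odd_forms_mult:
  assumes "f \<in> odd_forms" "g \<in> odd_forms"
  shows "restrict (\<lambda>v. f v * g v) W \<in> algO2"
proof -
  have "restrict (\<lambda>v. Im (r v * s v * cnj (zh v)) * Im (p v * cnj (q v))) W \<in> algO2"
    if "p \<in> letters" "q \<in> letters" "r \<in> letters" "s \<in> letters" for p q r s
    using Im_pair_triple[OF that] by (simp only: mult.commute)
  with assms show ?thesis
    unfolding odd_forms_def by (elim UnE CollectE exE conjE; simp only: Im_pair_pair Im_pair_triple Im_triple_triple)
qed

lemma polyB_odd_forms: "set polyB \<subseteq> insert xi odd_forms"
proof -
  have L: "za \<in> letters" "zb \<in> letters" "(\<lambda>v. zx v ^ 2) \<in> letters" by (simp_all add: letters_def)
  have 1: "f \<in> odd_forms" if "p \<in> letters" "q \<in> letters" "\<And>v. f v = Im (p v * cnj (q v))" for f p q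
    using that unfolding odd_forms_def fun_eq_iff[symmetric] by blast
  have 2: "f \<in> odd_forms" if "p \<in> letters" "q \<in> letters" "\<And>v. f v = Im (p v * q v * cnj (zh v))" for f p q
    using that unfolding odd_forms_def fun_eq_iff[symmetric] by blast
  have x4: "zx v ^ 4 = zx v ^ 2 * zx v ^ 2" for v by (simp flip: power_add)
  have "(\<lambda>v. Im (za v * cnj (zb v))) \<in> odd_forms" by (rule 1[OF L(1,2)]) simp
  moreover have "(\<lambda>v. Im (cnj (za v) * zx v ^ 2)) \<in> odd_forms" by (rule 1[OF L(3,1)]) (simp only: mult.commute)
  moreover have "(\<lambda>v. Im (cnj (zb v) * zx v ^ 2)) \<in> odd_forms" by (rule 1[OF L(3,2)]) (simp only: mult.commute)
  moreover have "(\<lambda>v. Im (za v ^ 2 * cnj (zh v))) \<in> odd_forms" by (rule 2[OF L(1,1)]) (simp only: power2_eq_square)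
  moreover have "(\<lambda>v. Im (zb v ^ 2 * cnj (zh v))) \<in> odd_forms" by (rule 2[OF L(2,2)]) (simp only: power2_eq_square)
  moreover have "(\<lambda>v. Im (za v * zb v * cnj (zh v))) \<in> odd_forms" by (rule 2[OF L(1,2)]) simp
  moreover have "(\<lambda>v. Im (za v * cnj (zh v) * zx v ^ 2)) \<in> odd_forms" by (rule 2[OF L(1,3)]) (simp only: mult_ac)
  moreover have "(\<lambda>v. Im (zb v * cnj (zh v) * zx v ^ 2)) \<in> odd_forms" by (rule 2[OF L(2,3)]) (simp only: mult_ac)
  moreover have "(\<lambda>v. Im (cnj (zh v) * zx v ^ 4)) \<in> odd_forms" by (rule 2[OF L(3,3)]) (simp only: x4 mult_ac)
  ultimately show ?thesis
    unfolding polyB_def list.set by (intro insert_subsetI insertI1 insertI2 empty_subsetI)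
qed

text \<open>The key to reflections: the product of any two odd generators is generated by the even ones and the
  products with \<open>\<xi>\<close>.\<close>

lemma polyB_mult:
  assumes "f \<in> set polyB" "g \<in> set polyB"
  shows "restrict (\<lambda>v. f v * g v) W \<in> algO2"
proof -
  have xi: "restrict (\<lambda>v. xi v * f v) W \<in> algO2" if "f \<in> set polyB" for f
    using generators_in(3)[of "set (covA \<Phi>) \<union> set (covC \<Phi>)"] that unfolding polyC_def by auto
  have xi': "restrict (\<lambda>v. f v * xi v) W \<in> algO2" if "f \<in> set polyB" for f
    using xi[OF that] by (simp only: mult.commute)
  consider "f = xi" | "g = xi" | "f \<in> odd_forms" "g \<in> odd_forms"
    using assms polyB_odd_forms by blast
  then show ?thesis
    using xi xi' assms odd_forms_mult by cases simp_all
qed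

text \<open>The module generated by the odd generators over the algebra of \<open>O(2)\<close>-covariants generated by
  (A) and (C).\<close>

definition odd_part :: "(tensor4 \<times> (real^2) \<Rightarrow> real) set" where
  "odd_part = sums_of {\<lambda>v. e v * b v | e b. restrict e W \<in> algO2 \<and> b \<in> set polyB}"

lemma odd_partI: "restrict e W \<in> algO2 \<Longrightarrow> b \<in> set polyB \<Longrightarrow> (\<lambda>v. e v * b v) \<in> odd_part"
  unfolding odd_part_def by (intro sums_of_base CollectI exI[of _ e] exI[of _ b] conjI refl)

lemma odd_part_add: "o1 \<in> odd_part \<Longrightarrow> o2 \<in> odd_part \<Longrightarrow> (\<lambda>v. o1 v + o2 v) \<in> odd_part"
  unfolding odd_part_def by (rule sums_of_add)

lemma odd_part_induct [consumes 1, case_names base add]: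
  assumes "f \<in> odd_part"
    and "\<And>e b. restrict e W \<in> algO2 \<Longrightarrow> b \<in> set polyB \<Longrightarrow> P (\<lambda>v. e v * b v)"
    and "\<And>f g. f \<in> odd_part \<Longrightarrow> g \<in> odd_part \<Longrightarrow> P f \<Longrightarrow> P g \<Longrightarrow> P (\<lambda>v. f v + g v)"
  shows "P f"
  using assms(1) unfolding odd_part_def
proof induction
  case (sums_of_base f)
  then obtain e b where "f = (\<lambda>v. e v * b v)" "restrict e W \<in> algO2" "b \<in> set polyB"
    by (elim CollectE exE conjE)
  then show ?case using assms(2)[of e b] by (simp only:)
next
  case (sums_of_add f g)
  then show ?case by (intro assms(3)) (simp_all only: odd_part_def)
qed

lemma odd_part_even_mult:
  assumes "f \<in> odd_part" "restrict h W \<in> algO2"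
  shows "(\<lambda>v. h v * f v) \<in> odd_part"
  using assms(1)
proof (induction rule: odd_part_induct)
  case (base e b)
  show ?case using odd_partI[OF alg_mult[OF algebra_generated assms(2) base(1)] base(2)] by (simp only: mult.assoc)
next
  case (add f g)
  then show ?case using odd_part_add[OF add.IH] by (simp only: distrib_left)
qed

lemma odd_part_odd_mult:
  assumes "f \<in> odd_part" "g \<in> odd_part"
  shows "restrict (\<lambda>v. f v * g v) W \<in> algO2"
  using assms(1)
proof (induction rule: odd_part_induct)
  case (base e b)
  show ?case using assms(2)
  proof (induction rule: odd_part_induct)
    case base2: (base e' b')
    have "e v * b v * (e' v * b' v) = (e v * e' v) * (b v * b' v)" for v by simp
    then show ?case
      using alg_mult[OF algebra_generated alg_mult[OF algebra_generated base(1) base2(1)] polyB_mult[OF base(2) base2(2)]]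
      by (simp only:)
  next
    case (add f g)
    then show ?case using alg_add[OF algebra_generated add.IH] by (simp only: distrib_left)
  qed
next
  case (add f h)
  then show ?case using alg_add[OF algebra_generated add.IH] by (simp only: distrib_right)
qed

lemma algO2_invariant:
  assumes "restrict e W \<in> algO2" "v \<in> W" "g \<in> O2"
  shows "e (act g v) = e v"
proof -
  have "(restrict e W) (act g v) = (restrict e W) v"
    using subsetD[OF algO2_subset assms(1)] assms(2,3) unfolding Cov_iff by blast
  then show ?thesis using assms(2) act_in_W[OF assms(2)] by (simp only: restrict_apply')
qed

lemma odd_part_reflection:
  assumes "f \<in> odd_part" "v \<in> W"
  shows "f (act (reflection 1) v) = - f v"
  using assms(1)
proof (induction rule: odd_part_induct)
  case (base e b)
  have "reflection 1 \<in> O2" by (rule rotation_reflection_O2) simp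
  moreover have "b (act (reflection 1) v) = - b v" using poly_reflection(2)[OF assms(2), of 1] base(2) by simp
  ultimately show ?case using algO2_invariant[OF base(1) assms(2)] by simp
qed simp

lemma set_scaledE:
  assumes "f \<in> set (scaled V cs fs)"
  obtains c g where "g \<in> set fs" "f = restrict (\<lambda>v. c * g v) V"
  using assms unfolding scaled_def by (auto dest: set_zip_rightD)

text \<open>The sums of an even and an odd function are closed under multiplication, because odd times odd is even by
  \<open>polyB_mult\<close>.\<close>

lemma even_odd_decomposition:
  assumes "f \<in> algSO2"
  shows "\<exists>e h. restrict e W \<in> algO2 \<and> h \<in> odd_part \<and> (\<forall>v\<in>W. f v = e v + h v)"
  using assms
proof induction
  case (gen f)
  have zero: "(\<lambda>v. 0) \<in> odd_part"
    using odd_partI[OF alg_const[OF algebra_generated, of 0] xi_in_polyB] by simp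
  have A: "restrict g W \<in> algO2" if "g \<in> set polyA" for g
    using generators_in(1) that by auto
  from gen consider "f \<in> set (covA \<Phi>)" | "f \<in> set (covB \<Phi>)" by blast
  then show ?case
  proof cases
    case 1
    then obtain c g where "g \<in> set polyA" "f = restrict (\<lambda>v. c * g v) W"
      unfolding cov_scaled by (rule set_scaledE)
    then show ?thesis
      by (intro exI[of _ "\<lambda>v. c * g v"] exI[of _ "\<lambda>v. 0"] conjI zero alg_cmult[OF algebra_generated] A) simp_all
  next
    case 2
    then obtain c g where "g \<in> set polyB" "f = restrict (\<lambda>v. c * g v) W"
      unfolding cov_scaled by (rule set_scaledE)
    then show ?thesis
      by (intro exI[of _ "\<lambda>v. 0"] exI[of _ "\<lambda>v. c * g v"] conjI odd_partI alg_const[OF algebra_generated]) simp_all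
  qed
next
  case (const c)
  have zero: "(\<lambda>v. 0) \<in> odd_part"
    using odd_partI[OF alg_const[OF algebra_generated, of 0] xi_in_polyB] by simp
  then show ?case
    by (intro exI[of _ "\<lambda>v. c"] exI[of _ "\<lambda>v. 0"] conjI alg_const[OF algebra_generated]) simp_all
next
  case (add f g)
  then obtain e h e' h' where "restrict e W \<in> algO2" "h \<in> odd_part" "\<forall>v\<in>W. f v = e v + h v"
    "restrict e' W \<in> algO2" "h' \<in> odd_part" "\<forall>v\<in>W. g v = e' v + h' v" by blast
  then show ?case
    by (intro exI[of _ "\<lambda>v. e v + e' v"] exI[of _ "\<lambda>v. h v + h' v"] conjI alg_add[OF algebra_generated] odd_part_add) simp_all
next
  case (mult f g)
  then obtain e h e' h' where *: "restrict e W \<in> algO2" "h \<in> odd_part" "\<forall>v\<in>W. f v = e v + h v"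
    "restrict e' W \<in> algO2" "h' \<in> odd_part" "\<forall>v\<in>W. g v = e' v + h' v" by blast
  show ?case
    by (intro exI[of _ "\<lambda>v. e v * e' v + h v * h' v"] exI[of _ "\<lambda>v. e v * h' v + e' v * h v"] conjI
        alg_add[OF algebra_generated alg_mult[OF algebra_generated]] odd_part_odd_mult odd_part_add odd_part_even_mult *)
      (use * in \<open>simp add: algebra_simps\<close>)
qed

text \<open>A reflection-invariant function has no odd part, so only its even part remains.\<close>

theorem algO2_eq: "algO2 = Cov Gel act4 O2"
proof (rule antisym[OF algO2_subset], rule subsetI)
  fix f assume f: "f \<in> Cov Gel act4 O2"
  have "SO2 \<subseteq> O2" by (auto simp: SO2_def O2_def rotation_matrix_def)
  then have "f \<in> algSO2" using f unfolding algSO2_eq Cov_iff by blast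
  from even_odd_decomposition[OF this] obtain e h where
    e: "restrict e W \<in> algO2" and h: "h \<in> odd_part" and eh: "\<forall>v\<in>W. f v = e v + h v" by blast
  have r: "reflection 1 \<in> O2" by (rule rotation_reflection_O2) simp
  have "f v = e v" if v: "v \<in> W" for v
  proof -
    have "f (act (reflection 1) v) = f v" using f r v unfolding Cov_iff by blast
    then have "e v - h v = e v + h v"
      using bspec[OF eh v] bspec[OF eh act_in_W[OF v]] algO2_invariant[OF e v r] odd_part_reflection[OF h v] by simp
    then show ?thesis using bspec[OF eh v] by simp
  qed
  moreover obtain p where "f = restrict p W" using f by (auto simp: Cov_iff polynomials_on_def)
  ultimately have "f = restrict e W" by (auto intro: restrict_ext)
  then show "f \<in> algO2" using e by simp
qed

end

section \<open>Indecomposability of the generators\<close>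

lemma list_all2_has_order_nth:
  assumes "list_all2 (has_order V) ns fs" "k < length fs"
  shows "has_order V (ns ! k) (fs ! k)"
  using assms by (simp add: list_all2_conv_all_nth)

lemma all_less_25:
  "(\<forall>k<25::nat. P k) \<longleftrightarrow> P 0 \<and> P 1 \<and> P 2 \<and> P 3 \<and> P 4 \<and> P 5 \<and> P 6 \<and> P 7 \<and> P 8 \<and> P 9 \<and> P 10 \<and>
     P 11 \<and> P 12 \<and> P 13 \<and> P 14 \<and> P 15 \<and> P 16 \<and> P 17 \<and> P 18 \<and> P 19 \<and> P 20 \<and> P 21 \<and> P 22 \<and>
     P 23 \<and> P 24"
  by (simp add: eval_nat_numeral All_less_Suc) blast

lemma replicate_numerals:
  "replicate 9 x = [x, x, x, x, x, x, x, x, x]"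
  "replicate 10 x = [x, x, x, x, x, x, x, x, x, x]"
  "replicate 15 x = [x, x, x, x, x, x, x, x, x, x, x, x, x, x, x]"
  by (simp_all add: eval_nat_numeral)

text \<open>The exponents of the generators along the curve below generate a submonoid of this one. No exponent of a
  generator is a sum of two nonzero elements: a sum of two nonzero even elements is at least 40, and any other sum of
  two nonzero elements is at least 55, whereas the even exponents are below 40 and the odd ones below 55.\<close>

definition curve_monoid :: "nat set" where
  "curve_monoid = {n. n = 0 \<or> even n \<and> n \<ge> 20 \<or> odd n \<and> n \<ge> 35}"

lemma curve_monoid_atom:
  assumes "n \<noteq> 0" "even n \<and> n < 40 \<or> odd n \<and> n < 55"
    and "x \<in> curve_monoid - {n}" "y \<in> curve_monoid - {n}"
  shows "x + y \<in> curve_monoid - {n}"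
proof -
  have "x + y \<in> curve_monoid"
    using assms(3,4) unfolding curve_monoid_def by auto
  moreover have "x + y \<noteq> n"
  proof (cases "x = 0 \<or> y = 0")
    case False
    then show ?thesis using assms unfolding curve_monoid_def by auto
  qed (use assms in auto)
  ultimately show ?thesis by simp
qed

context harmonic_coordinates
begin

lemma poly_scaling:
  assumes "xi v' = c0 * xi v" "la v' = c1 * la v" "mu v' = c2 * mu v"
    and "za v' = of_real a * za v" "zb v' = of_real b * zb v" "zh v' = of_real h * zh v" "zx v' = of_real x * zx v"
  shows "map (\<lambda>f. f v') polyA = map2 (\<lambda>c f. c * f v)
      [c1, c2, a * a, b * b, h * h, a * b, a\<^sup>2 * h, b\<^sup>2 * h, a * b * h,
       x * x, a * x\<^sup>2, b * x\<^sup>2, a * h * x\<^sup>2, b * h * x\<^sup>2, h * x^4] polyA"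
    and "map (\<lambda>f. f v') polyB = map2 (\<lambda>c f. c * f v)
      [c0, a * b, a\<^sup>2 * h, b\<^sup>2 * h, a * b * h,
       a * x\<^sup>2, b * x\<^sup>2, a * h * x\<^sup>2, b * h * x\<^sup>2, h * x^4] polyB"
proof -
  have Re: "Re (complex_of_real r * z) = r * Re z" and Im: "Im (complex_of_real r * z) = r * Im z" for r z
    by simp_all
  have m: "(of_real r * y) * cnj (of_real s * z) = of_real (r * s) * (y * cnj z)"
    "(of_real r * y)^2 * cnj (of_real s * z) = of_real (r^2 * s) * (y^2 * cnj z)"
    "(of_real r * y) * (of_real r' * y') * cnj (of_real s * z) = of_real (r * r' * s) * (y * y' * cnj z)"
    "cnj (of_real s * z) * (of_real r * y)^2 = of_real (s * r^2) * (cnj z * y^2)"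
    "(of_real r' * y') * cnj (of_real s * z) * (of_real r * y)^2 = of_real (r' * s * r^2) * (y' * cnj z * y^2)"
    "cnj (of_real s * z) * (of_real r * y)^4 = of_real (s * r^4) * (cnj z * y^4)"
    for r r' s :: real and y y' z
    by (simp_all add: power_mult_distrib mult_ac)
  show "map (\<lambda>f. f v') polyA = map2 (\<lambda>c f. c * f v)
      [c1, c2, a * a, b * b, h * h, a * b, a\<^sup>2 * h, b\<^sup>2 * h, a * b * h,
       x * x, a * x\<^sup>2, b * x\<^sup>2, a * h * x\<^sup>2, b * h * x\<^sup>2, h * x^4] polyA"
    unfolding polyA_def list.map zip_Cons_Cons prod.case zip_Nil assms
    unfolding m(5)
    unfolding m Re by (rule refl)
  show "map (\<lambda>f. f v') polyB = map2 (\<lambda>c f. c * f v)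
      [c0, a * b, a\<^sup>2 * h, b\<^sup>2 * h, a * b * h,
       a * x\<^sup>2, b * x\<^sup>2, a * h * x\<^sup>2, b * h * x\<^sup>2, h * x^4] polyB"
    unfolding polyB_def list.map zip_Cons_Cons prod.case zip_Nil assms
    unfolding m(5)
    unfolding m Im by (rule refl)
qed

text \<open>The point with prescribed coordinates; the vector may be taken real.\<close>

definition point :: "real \<Rightarrow> real \<Rightarrow> real \<Rightarrow> complex \<Rightarrow> complex \<Rightarrow> complex \<Rightarrow> real \<Rightarrow> tensor4 \<times> (real^2)" where
  "point \<xi> l m a b w x = (inv_into Gel \<Phi> (hcx \<xi> l m a b w), vector [x, 0])"

lemma point:
  "point \<xi> l m a b w x \<in> W"
  "xi (point \<xi> l m a b w x) = \<xi>" "la (point \<xi> l m a b w x) = l" "mu (point \<xi> l m a b w x) = m"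
  "za (point \<xi> l m a b w x) = a" "zb (point \<xi> l m a b w x) = b" "zh (point \<xi> l m a b w x) = w"
  "zx (point \<xi> l m a b w x) = of_real x"
proof -
  have h: "hcx \<xi> l m a b w \<in> Harm_sum" by (auto simp: Harm_sum_hcx)
  have "inv_into Gel \<Phi> (hcx \<xi> l m a b w) \<in> Gel"
    using h Phi_bij by (metis bij_betw_def inv_into_into)
  then show "point \<xi> l m a b w x \<in> W" by (simp add: point_def)
  have "\<Phi> (fst (point \<xi> l m a b w x)) = hcx \<xi> l m a b w"
    using bij_betw_inv_into_right[OF Phi_bij h] by (simp add: point_def)
  from coordinates_unique[OF this]
  show "xi (point \<xi> l m a b w x) = \<xi>" "la (point \<xi> l m a b w x) = l" "mu (point \<xi> l m a b w x) = m"
    "za (point \<xi> l m a b w x) = a" "zb (point \<xi> l m a b w x) = b" "zh (point \<xi> l m a b w x) = w" .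
  show "zx (point \<xi> l m a b w x) = of_real x"
    by (simp add: zx_def point_def z1_def vector_2 complex_eq_iff)
qed

text \<open>The weights 30, 36, 12, 14, 11, 10 of the variables give exponents between 20 and 51 to the generators
  other than \<open>\<xi>\<close>, which are distinct except that \<open>Re m\<close> and \<open>Im m\<close> share
  the one of \<open>m\<close>. An odd power of \<open>z\<^sub>4\<close> makes the exponent odd. The phases
  \<open>a, b, w\<close> decide which real and imaginary parts vanish.\<close>

definition curve :: "real \<Rightarrow> complex \<Rightarrow> complex \<Rightarrow> complex \<Rightarrow> real \<Rightarrow> tensor4 \<times> (real^2)" where
  "curve \<xi> a b w t = point \<xi> (t^30) (t^36) (of_real (t^12) * a) (of_real (t^14) * b) (of_real (t^11) * w) (t^10)"

definition expsA :: "nat list" where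
  "expsA = [30, 36, 24, 28, 22, 26, 35, 39, 37, 20, 32, 34, 43, 45, 51]"

definition expsB :: "nat list" where
  "expsB = [0, 26, 35, 39, 37, 32, 34, 43, 45, 51]"

lemma curve_values:
  "map (\<lambda>f. f (curve \<xi> a b w t)) polyA = map2 (\<lambda>n f. f (curve \<xi> a b w 1) * t ^ n) expsA polyA"
  "map (\<lambda>f. f (curve \<xi> a b w t)) polyB = map2 (\<lambda>n f. f (curve \<xi> a b w 1) * t ^ n) expsB polyB"
proof -
  have sc: "xi (curve \<xi> a b w t) = 1 * xi (curve \<xi> a b w 1)"
    "la (curve \<xi> a b w t) = t^30 * la (curve \<xi> a b w 1)"
    "mu (curve \<xi> a b w t) = t^36 * mu (curve \<xi> a b w 1)"
    "za (curve \<xi> a b w t) = of_real (t^12) * za (curve \<xi> a b w 1)"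
    "zb (curve \<xi> a b w t) = of_real (t^14) * zb (curve \<xi> a b w 1)"
    "zh (curve \<xi> a b w t) = of_real (t^11) * zh (curve \<xi> a b w 1)"
    "zx (curve \<xi> a b w t) = of_real (t^10) * zx (curve \<xi> a b w 1)"
    by (simp_all add: curve_def point)
  have swap: "map2 (\<lambda>c f. c * f v) (map ((^) t) ns) fs = map2 (\<lambda>n f. f v * t ^ n) ns fs"
    for v :: "tensor4 \<times> (real^2)" and ns and fs :: "(tensor4 \<times> (real^2) \<Rightarrow> real) list"
    by (rule nth_equalityI) (simp_all add: mult.commute)
  show "map (\<lambda>f. f (curve \<xi> a b w t)) polyA = map2 (\<lambda>n f. f (curve \<xi> a b w 1) * t ^ n) expsA polyA"
    unfolding poly_scaling(1)[OF sc] swap[symmetric]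
    by (rule arg_cong[of _ _ "\<lambda>cs. map2 _ cs polyA"])
      (simp add: expsA_def flip: power_mult power_add)
  show "map (\<lambda>f. f (curve \<xi> a b w t)) polyB = map2 (\<lambda>n f. f (curve \<xi> a b w 1) * t ^ n) expsB polyB"
    unfolding poly_scaling(2)[OF sc] swap[symmetric]
    by (rule arg_cong[of _ _ "\<lambda>cs. map2 _ cs polyB"])
      (simp add: expsB_def flip: power_mult power_add)
qed

lemma curve_start:
  "map (\<lambda>f. f (curve \<xi> a b w 1)) polyA = [1, 1, Re (a * cnj a), Re (b * cnj b), Re (w * cnj w), Re (a * cnj b),
     Re (a\<^sup>2 * cnj w), Re (b\<^sup>2 * cnj w), Re (a * b * cnj w), 1, Re (cnj a), Re (cnj b),
     Re (a * cnj w), Re (b * cnj w), Re (cnj w)]"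
  "map (\<lambda>f. f (curve \<xi> a b w 1)) polyB = [\<xi>, Im (a * cnj b),
     Im (a\<^sup>2 * cnj w), Im (b\<^sup>2 * cnj w), Im (a * b * cnj w), Im (cnj a), Im (cnj b),
     Im (a * cnj w), Im (b * cnj w), Im (cnj w)]"
  by (simp_all add: polyA_def polyB_def curve_def point)

text \<open>With real phases and \<open>\<xi> = 0\<close> all of (B) and (C) vanishes, and each element of (A) is a
  nonzero monomial with an exponent of its own. For \<open>\<xi> = 1\<close> the families (B) and (C) take the same
  values, and an imaginary part is separated by choosing one phase \<open>\<i>\<close> such that the corresponding
  real part vanishes. The remaining generator, \<open>\<xi>\<close> or its square, is the only one that does not
  vanish on the line where all other coordinates are zero.\<close>

lemma independent_generators:
  assumes X: "X = polyB \<or> X = polyC" and s: "s < 25"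
  defines "fs \<equiv> scaled W (consts_A @ consts_B) (polyA @ X)"
  shows "fs ! s \<notin> generated_algebra W {fs ! k | k. k < length fs \<and> k \<noteq> s}"
proof -
  have len: "length X = 10" using X by auto
  then have fs: "length fs = 25" "\<And>k v. k < 25 \<Longrightarrow> v \<in> W \<Longrightarrow> (fs ! k) v = (consts_A @ consts_B) ! k * ((polyA @ X) ! k) v"
    by (auto simp: fs_def length_scaled nth_scaled)
  have nz: "(consts_A @ consts_B) ! k \<noteq> 0" if "k < 25" for k
  proof -
    have "(consts_A @ consts_B) ! k \<in> set (consts_A @ consts_B)" using that by (intro nth_mem) simp
    then show ?thesis using consts_nonzero by auto
  qed
  define ns where "ns = expsA @ expsB"
  have ns: "k < 25 \<Longrightarrow> ns ! k \<in> curve_monoid" for k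
  proof -
    assume "k < 25"
    then have "ns ! k \<in> set ns" by (intro nth_mem) (simp add: ns_def expsA_def expsB_def)
    then show ?thesis by (auto simp: ns_def expsA_def expsB_def curve_monoid_def)
  qed
  have atom: "x + y \<in> curve_monoid - {ns ! s}" if "ns ! s \<noteq> 0" "x \<in> curve_monoid - {ns ! s}" "y \<in> curve_monoid - {ns ! s}" for x y
  proof (rule curve_monoid_atom[OF that(1) _ that(2,3)])
    have "ns ! s \<in> set ns" using s by (intro nth_mem) (simp add: ns_def expsA_def expsB_def)
    then show "even (ns ! s) \<and> ns ! s < 40 \<or> odd (ns ! s) \<and> ns ! s < 55"
      by (auto simp: ns_def expsA_def expsB_def)
  qed
  have Xval: "map (\<lambda>f. f (curve \<xi> a b w t)) X = map2 (\<lambda>n f. f (curve \<xi> a b w 1) * t ^ n) expsB X"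
    if "\<xi> = 0 \<or> \<xi> = 1" for \<xi> a b w t
  proof -
    have "xi (curve \<xi> a b w t) = \<xi>" for t by (simp add: curve_def point)
    then have "map (\<lambda>f. f (curve \<xi> a b w t)) polyC = map ((*) \<xi>) (map (\<lambda>f. f (curve \<xi> a b w t)) polyB)"
      "map (\<lambda>f. f (curve \<xi> a b w 1)) polyC = map ((*) \<xi>) (map (\<lambda>f. f (curve \<xi> a b w 1)) polyB)"
      by (simp_all add: polyC_def)
    then show ?thesis using X that curve_values(2)
      by (auto simp: polyC_def expsB_def polyB_def curve_def point)
  qed
  have val: "(fs ! k) (curve \<xi> a b w t) =
      ((consts_A @ consts_B) ! k * ((polyA @ X) ! k) (curve \<xi> a b w 1)) * t ^ (ns ! k)"
    if "\<xi> = 0 \<or> \<xi> = 1" "k < 25" for \<xi> a b w t k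
  proof -
    have "map (\<lambda>f. f (curve \<xi> a b w t)) (polyA @ X) =
        map2 (\<lambda>n f. f (curve \<xi> a b w 1) * t ^ n) ns (polyA @ X)"
      unfolding ns_def map_append curve_values(1) Xval[OF that(1)]
      by (subst zip_append) (simp_all add: expsA_def)
    then have "map (\<lambda>f. f (curve \<xi> a b w t)) (polyA @ X) ! k =
       map2 (\<lambda>n f. f (curve \<xi> a b w 1) * t ^ n) ns (polyA @ X) ! k" by simp
    then have "((polyA @ X) ! k) (curve \<xi> a b w t) = ((polyA @ X) ! k) (curve \<xi> a b w 1) * t ^ (ns ! k)"
      using that len by (simp add: ns_def expsA_def expsB_def del: nth_append map_append)
    then show ?thesis using that fs(2) by (simp add: curve_def point)
  qed
  have nth_values: "((polyA @ X) ! k) v = L ! k" if "map (\<lambda>f. f v) (polyA @ X) = L" "k < 25" for v L k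
    unfolding that(1)[symmetric] by (rule nth_map[symmetric]) (use that(2) len in simp)
  have sep: ?thesis
    if "\<xi> = 0 \<or> \<xi> = 1" "map (\<lambda>f. f (curve \<xi> a b w 1)) (polyA @ X) = L" "ns ! s \<noteq> 0" "L ! s \<noteq> 0"
      "\<forall>k<25. k = s \<or> ns ! k \<noteq> ns ! s \<or> L ! k = 0" for \<xi> a b w L
  proof (rule curve_separates[where \<gamma> = "curve \<xi> a b w" and M = "curve_monoid - {ns ! s}" and ns = ns and
        cs = "map (\<lambda>k. (consts_A @ consts_B) ! k * L ! k) [0..<25]"])
    show "curve \<xi> a b w t \<in> W" for t by (simp only: curve_def point)
    show "0 \<in> curve_monoid - {ns ! s}" using that by (simp add: curve_monoid_def)
    show "x + y \<in> curve_monoid - {ns ! s}" if "x \<in> curve_monoid - {ns ! s}" "y \<in> curve_monoid - {ns ! s}" for x y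
      using atom \<open>ns ! s \<noteq> 0\<close> that by blast
    show "(fs ! k) (curve \<xi> a b w t) =
        map (\<lambda>k. (consts_A @ consts_B) ! k * L ! k) [0..<25] ! k * t ^ (ns ! k)" if "k < length fs" for k t
      using that fs(1) val[OF \<open>\<xi> = 0 \<or> \<xi> = 1\<close>] nth_values[OF \<open>map _ _ = L\<close>] by simp
    show "map (\<lambda>k. (consts_A @ consts_B) ! k * L ! k) [0..<25] ! s \<noteq> 0"
      using that s nz by simp
    show "map (\<lambda>k. (consts_A @ consts_B) ! k * L ! k) [0..<25] ! k = 0 \<or> ns ! k \<in> curve_monoid - {ns ! s}"
      if "k < length fs" "k \<noteq> s" for k
      using that fs(1) ns \<open>\<forall>k<25. k = s \<or> _ k\<close> by auto
  qed (use s fs(1) in auto)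
  have "\<forall>k<25. k < 15 \<or> k = 15 \<or> k \<in> {16, 19, 20, 22} \<or> k \<in> {21, 23} \<or> k \<in> {17, 18, 24 :: nat}"
    unfolding all_less_25 by simp
  \<comment> \<open>Turning the phase of \<open>z\<^sub>2\<^sub>a\<close>, \<open>z\<^sub>2\<^sub>b\<close> or \<open>z\<^sub>4\<close> from 1 to \<open>\<i>\<close> makes exactly the
    monomials of odd degree in it imaginary. Each odd generator other than the first one is of odd degree in one of these coordinates.\<close>
  then consider (A) "s < 15" | (xi) "s = 15" | (a) "s \<in> {16, 19, 20, 22}" | (b) "s \<in> {21, 23}" | (w) "s \<in> {17, 18, 24}"
    using s by blast
  then show ?thesis
  proof cases
    case A
    have "map (\<lambda>f. f (curve 0 1 1 1 1)) X = replicate 10 0"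
      using X by (elim disjE) (simp_all add: polyC_def polyB_def curve_def point replicate_numerals)
    then have "map (\<lambda>f. f (curve 0 1 1 1 1)) (polyA @ X) = replicate 15 1 @ replicate 10 0"
      by (simp only: map_append curve_start) (simp add: replicate_numerals)
    note L = this
    have "distinct expsA" by (simp add: expsA_def)
    then have "ns ! k \<noteq> ns ! s" if "k < 15" "k \<noteq> s" for k
      using that A by (simp add: ns_def nth_append expsA_def[THEN arg_cong[of _ _ length], simplified] nth_eq_iff_index_eq)
    moreover have "ns ! s \<noteq> 0"
    proof -
      have "ns ! s \<in> set expsA" using A by (simp add: ns_def nth_append expsA_def[THEN arg_cong[of _ _ length], simplified])
      then show ?thesis by (auto simp: expsA_def)
    qed
    ultimately show ?thesis
      using A s by (intro sep[OF _ L]) (auto simp: nth_append)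
  next
    case xi
    define \<delta> where "\<delta> t = point t 0 0 0 0 0 0" for t
    obtain n where n: "n > 0" "\<And>t. map (\<lambda>f. f (\<delta> t)) (polyA @ X) = replicate 15 0 @ [t ^ n] @ replicate 9 0"
    proof -
      have "map (\<lambda>f. f (\<delta> t)) polyA = replicate 15 0" "map (\<lambda>f. f (\<delta> t)) polyB = t ^ 1 # replicate 9 0"
        "map (\<lambda>f. f (\<delta> t)) polyC = t ^ 2 # replicate 9 0" for t
        by (simp_all add: polyA_def polyB_def polyC_def \<delta>_def point replicate_numerals power2_eq_square)
      then show ?thesis using that[of 1] that[of 2] X by auto
    qed
    have vals: "((polyA @ X) ! k) (\<delta> t) = (if k = s then t ^ n else 0)" if "k < 25" for k t
    proof -
      have "((polyA @ X) ! k) (\<delta> t) = map (\<lambda>f. f (\<delta> t)) (polyA @ X) ! k"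
        using that len by (subst nth_map) auto
      also have "\<dots> = (if k = s then t ^ n else 0)"
        unfolding n(2) using that xi by (auto simp: nth_append nth_Cons' split: if_splits)
      finally show ?thesis .
    qed
    show ?thesis
    proof (rule curve_separates[where \<gamma> = \<delta> and M = "{0}" and ns = "replicate 25 n" and
        cs = "map (\<lambda>k. if k = s then (consts_A @ consts_B) ! k else 0) [0..<25]"])
      show "\<delta> t \<in> W" for t by (simp only: \<delta>_def point)
      then show "(fs ! k) (\<delta> t) = map (\<lambda>k. if k = s then (consts_A @ consts_B) ! k else 0) [0..<25] ! k * t ^ (replicate 25 n ! k)"
        if "k < length fs" for k t
        using that fs vals by simp
    qed (use s fs(1) nz n(1) in auto)
  next
    case a
    have "map (\<lambda>f. f (curve 1 \<i> 1 1 1)) X = map (\<lambda>f. f (curve 1 \<i> 1 1 1)) polyB"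
      using X by (auto simp: polyC_def curve_def point)
    then have "map (\<lambda>f. f (curve 1 \<i> 1 1 1)) (polyA @ X) =
        [1,1,1,1,1,0,-1,1,0,1,0,1,0,1,1, 1,1,0,0,1,-1,0,1,0,0]"
      by (simp only: map_append curve_start) simp
    then show ?thesis
      by (rule sep[rotated], unfold all_less_25)
        (use a in \<open>auto simp: ns_def expsA_def expsB_def\<close>)
  next
    case b
    have "map (\<lambda>f. f (curve 1 1 \<i> 1 1)) X = map (\<lambda>f. f (curve 1 1 \<i> 1 1)) polyB"
      using X by (auto simp: polyC_def curve_def point)
    then have "map (\<lambda>f. f (curve 1 1 \<i> 1 1)) (polyA @ X) =
        [1,1,1,1,1,0,1,-1,0,1,1,0,1,0,1, 1,-1,0,0,1,0,-1,0,1,0]"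
      by (simp only: map_append curve_start) simp
    then show ?thesis
      by (rule sep[rotated], unfold all_less_25)
        (use b in \<open>auto simp: ns_def expsA_def expsB_def\<close>)
  next
    case w
    have "map (\<lambda>f. f (curve 1 1 1 \<i> 1)) X = map (\<lambda>f. f (curve 1 1 1 \<i> 1)) polyB"
      using X by (auto simp: polyC_def curve_def point)
    then have "map (\<lambda>f. f (curve 1 1 1 \<i> 1)) (polyA @ X) =
        [1,1,1,1,1,1,0,0,0,1,1,1,0,0,0, 1,0,-1,-1,-1,0,0,-1,-1,-1]"
      by (simp only: map_append curve_start) simp
    then show ?thesis
      by (rule sep[rotated], unfold all_less_25)
        (use w in \<open>auto simp: ns_def expsA_def expsB_def\<close>)
  qed
qed

end

section \<open>Orders, degrees and the minimal bases\<close>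

lemma scaled_append:
  assumes "length cs = length fs"
  shows "scaled V (cs @ ds) (fs @ gs) = scaled V cs fs @ scaled V ds gs"
  using assms by (simp add: scaled_def)

lemma nth_scaling:
  assumes "map (\<lambda>f. f v') fs = map2 (\<lambda>c f. c * f v) (map ((^) t) ns) fs"
    and "length ns = length fs" "k < length fs"
  shows "(fs ! k) v' = (t::real) ^ (ns ! k) * (fs ! k) v"
  using arg_cong[OF assms(1), of "\<lambda>xs. xs ! k"] assms(2,3) by simp

context harmonic_coordinates
begin

definition order_A :: "nat list" where
  "order_A = replicate 9 0 @ replicate 5 2 @ replicate 1 4"

definition order_B :: "nat list" where
  "order_B = replicate 5 0 @ replicate 4 2 @ replicate 1 4"

lemma order_lists: "order_A = [0, 0, 0, 0, 0, 0, 0, 0, 0, 2, 2, 2, 2, 2, 4]"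
  "order_B = [0, 0, 0, 0, 0, 2, 2, 2, 2, 4]"
  by (simp_all add: order_A_def order_B_def eval_nat_numeral)

lemma poly_orders:
  assumes "P \<in> Gel"
  shows "k < 15 \<Longrightarrow> (polyA ! k) (P, t *\<^sub>R x) = t ^ (order_A ! k) * (polyA ! k) (P, x)"
    and "k < 10 \<Longrightarrow> (polyB ! k) (P, t *\<^sub>R x) = t ^ (order_B ! k) * (polyB ! k) (P, x)"
    and "k < 10 \<Longrightarrow> (polyC ! k) (P, t *\<^sub>R x) = t ^ (order_B ! k) * (polyC ! k) (P, x)"
proof -
  have sc: "xi (P, t *\<^sub>R x) = 1 * xi (P, x)" "la (P, t *\<^sub>R x) = 1 * la (P, x)" "mu (P, t *\<^sub>R x) = 1 * mu (P, x)"
    "za (P, t *\<^sub>R x) = of_real 1 * za (P, x)" "zb (P, t *\<^sub>R x) = of_real 1 * zb (P, x)"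
    "zh (P, t *\<^sub>R x) = of_real 1 * zh (P, x)" "zx (P, t *\<^sub>R x) = of_real t * zx (P, x)"
    by (simp_all add: coordinate_defs z1_def complex_eq_iff)
  show "(polyA ! k) (P, t *\<^sub>R x) = t ^ (order_A ! k) * (polyA ! k) (P, x)" if "k < 15"
    by (rule nth_scaling[OF poly_scaling(1)[OF sc, THEN trans]])
      (use that in \<open>simp_all add: order_lists power2_eq_square\<close>)
  show B: "(polyB ! k) (P, t *\<^sub>R x) = t ^ (order_B ! k) * (polyB ! k) (P, x)" if "k < 10"
    by (rule nth_scaling[OF poly_scaling(2)[OF sc, THEN trans]])
      (use that in \<open>simp_all add: order_lists\<close>)
  show "(polyC ! k) (P, t *\<^sub>R x) = t ^ (order_B ! k) * (polyC ! k) (P, x)" if "k < 10"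
    using that B sc(1) by (simp add: polyC_def)
qed

lemma cov_orders:
  "list_all2 (has_order Gel) order_A (covA \<Phi>)"
  "list_all2 (has_order Gel) order_B (covB \<Phi>)"
  "list_all2 (has_order Gel) order_B (covC \<Phi>)"
  unfolding cov_scaled list_all2_conv_all_nth has_order_def
  by (simp_all add: length_scaled nth_scaled poly_orders order_lists(1)[THEN arg_cong, of length, simplified]
    order_lists(2)[THEN arg_cong, of length, simplified])

definition degree_A :: "nat list" where
  "degree_A = [1, 1, 2, 2, 2, 2, 3, 3, 3, 2, 3, 3, 4, 4, 5]"

definition degree_B :: "nat list" where
  "degree_B = [1, 2, 3, 3, 3, 3, 3, 4, 4, 5]"

lemma poly_homogeneous:
  assumes "v \<in> W"
  shows "k < 15 \<Longrightarrow> (polyA ! k) (t *\<^sub>R v) = t ^ (degree_A ! k) * (polyA ! k) v"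
    and "k < 10 \<Longrightarrow> (polyB ! k) (t *\<^sub>R v) = t ^ (degree_B ! k) * (polyB ! k) v"
    and "k < 10 \<Longrightarrow> (polyC ! k) (t *\<^sub>R v) = t ^ Suc (degree_B ! k) * (polyC ! k) v"
proof -
  have "\<Phi> (fst (t *\<^sub>R v)) = t *\<^sub>R \<Phi> (fst v)" using assms by (auto simp: Phi_linear)
  also have "\<dots> = hcx (t * xi v) (t * la v) (t * mu v) (t *\<^sub>R za v) (t *\<^sub>R zb v) (t *\<^sub>R zh v)"
    unfolding Phi_coordinates[OF assms] hcx_linear(2) by (rule refl)
  finally have eq: "\<Phi> (fst (t *\<^sub>R v)) =
    hcx (t * xi v) (t * la v) (t * mu v) (t *\<^sub>R za v) (t *\<^sub>R zb v) (t *\<^sub>R zh v)" .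
  have sc: "xi (t *\<^sub>R v) = t * xi v" "la (t *\<^sub>R v) = t * la v" "mu (t *\<^sub>R v) = t * mu v"
    "za (t *\<^sub>R v) = of_real t * za v" "zb (t *\<^sub>R v) = of_real t * zb v" "zh (t *\<^sub>R v) = of_real t * zh v"
    using coordinates_unique[OF eq] by (simp_all add: scaleR_conv_of_real)
  have "zx (t *\<^sub>R v) = of_real t * zx v" by (simp add: zx_def z1_def complex_eq_iff)
  note sc = sc this
  show "(polyA ! k) (t *\<^sub>R v) = t ^ (degree_A ! k) * (polyA ! k) v" if "k < 15"
    by (rule nth_scaling[OF poly_scaling(1)[OF sc, THEN trans]])
      (use that in \<open>simp_all add: degree_A_def eval_nat_numeral mult.assoc\<close>)
  show B: "(polyB ! k) (t *\<^sub>R v) = t ^ (degree_B ! k) * (polyB ! k) v" if "k < 10"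
    by (rule nth_scaling[OF poly_scaling(2)[OF sc, THEN trans]])
      (use that in \<open>simp_all add: degree_B_def eval_nat_numeral mult.assoc\<close>)
  show "(polyC ! k) (t *\<^sub>R v) = t ^ Suc (degree_B ! k) * (polyC ! k) v" if "k < 10"
    using that B sc(1) by (simp add: polyC_def)
qed

lemma cov_homogeneous: "f \<in> set (covA \<Phi>) \<union> set (covB \<Phi>) \<union> set (covC \<Phi>) \<Longrightarrow> homogeneous_on W f"
proof -
  have *: "homogeneous_on W f" if f: "f \<in> set (scaled W cs fs)" and len: "length cs = length fs"
    and hom: "\<And>k v t. k < length fs \<Longrightarrow> v \<in> W \<Longrightarrow> (fs ! k) (t *\<^sub>R v) = t ^ ds k * (fs ! k) v" for f cs fs ds
  proof -
    obtain k where k: "k < length fs" "f = scaled W cs fs ! k"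
      using f len by (metis in_set_conv_nth length_scaled)
    have "f (t *\<^sub>R v) = t ^ ds k * f v" if v: "v \<in> W" for v t
    proof -
      have "t *\<^sub>R v \<in> W" using v by (auto simp: Gel_subspace)
      then show ?thesis
        unfolding k(2) nth_scaled[OF len k(1)] using v by (simp only: restrict_apply' hom[OF k(1) v]) simp
    qed
    then show ?thesis unfolding homogeneous_on_def by blast
  qed
  show "homogeneous_on W f" if "f \<in> set (covA \<Phi>) \<union> set (covB \<Phi>) \<union> set (covC \<Phi>)"
    using that *[of f consts_A polyA "(!) degree_A"] *[of f consts_B polyB "(!) degree_B"]
      *[of f consts_B polyC "\<lambda>k. Suc (degree_B ! k)"] poly_homogeneous
    unfolding cov_scaled by (elim UnE) simp_all
qed

text \<open>Indecomposability makes the 25 members distinct, and shows that no member is constant, in particular none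
  is zero. Hence each has exactly one order, and the invariants are the members listed with order 0.\<close>

lemma minimal_family:
  assumes cov: "cov = scaled W consts_B X" "X = polyB \<or> X = polyC"
    and sub: "set (covA \<Phi>) \<union> set cov \<subseteq> A"
    and gen: "generated_algebra W (set (covA \<Phi>) \<union> set cov) = A"
    and order: "list_all2 (has_order Gel) order_B cov"
    and hom: "\<And>f. f \<in> set cov \<Longrightarrow> homogeneous_on W f"
  shows "minimal_integrity_basis W A (set (covA \<Phi>) \<union> set cov)"
    and "card (set (covA \<Phi>) \<union> set cov) = 25"
    and "card {c \<in> set (covA \<Phi>) \<union> set cov. has_order Gel 0 c} = 14"
proof -
  define fs where "fs = covA \<Phi> @ cov"
  have len: "length X = 10" using cov(2) by auto
  have fs: "fs = scaled W (consts_A @ consts_B) (polyA @ X)"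
    unfolding fs_def cov_scaled cov by (simp add: scaled_append)
  have fsl: "length fs = 25" unfolding fs using len by (simp add: length_scaled)
  have set: "set fs = set (covA \<Phi>) \<union> set cov" by (simp add: fs_def)
  have ind: "fs ! s \<notin> generated_algebra W {fs ! k | k. k < length fs \<and> k \<noteq> s}" if "s < length fs" for s
    using independent_generators[OF cov(2), of s] that unfolding fs[symmetric] fsl by blast
  have dist: "distinct fs" and min: "\<And>T. T \<subset> set fs \<Longrightarrow> generated_algebra W T \<noteq> generated_algebra W (set fs)"
    and const: "\<And>c. restrict (\<lambda>_. c) W \<notin> set fs"
    using independent_list[of fs W, OF ind] by blast+
  show "minimal_integrity_basis W A (set (covA \<Phi>) \<union> set cov)"
    using min gen sub hom cov_homogeneous
    unfolding minimal_integrity_basis_def integrity_basis_def set by auto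
  show "card (set (covA \<Phi>) \<union> set cov) = 25"
    using distinct_card[OF dist] fsl set by simp
  have ord: "list_all2 (has_order Gel) (order_A @ order_B) fs"
    unfolding fs_def by (intro list_all2_appendI cov_orders order)
  have "has_order Gel 0 (fs ! k) \<longleftrightarrow> (order_A @ order_B) ! k = 0" if k: "k < length fs" for k
  proof
    have o: "has_order Gel ((order_A @ order_B) ! k) (fs ! k)" by (rule list_all2_has_order_nth[OF ord k])
    then show "has_order Gel 0 (fs ! k)" if "(order_A @ order_B) ! k = 0" using that by simp
    show "(order_A @ order_B) ! k = 0" if "has_order Gel 0 (fs ! k)"
    proof (rule ccontr)
      assume "(order_A @ order_B) ! k \<noteq> 0"
      then have z: "(fs ! k) (P, x) = 0" if "P \<in> Gel" for P x
        using has_order_unique[OF o \<open>has_order Gel 0 (fs ! k)\<close> _ that] by blast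
      have "fs ! k = restrict (fs ! k) W"
        using k fsl len unfolding fs by (simp add: nth_scaled)
      also have "\<dots> = restrict (\<lambda>_. 0) W" using z by (auto intro: restrict_ext)
      finally show False using const[of 0] k nth_mem by metis
    qed
  qed
  from card_filter_nth[where P = "has_order Gel 0" and Q = "\<lambda>n. n = 0" and ns = "order_A @ order_B", OF dist this]
  have "card {c \<in> set fs. has_order Gel 0 c} = length (filter (\<lambda>n. n = 0) (order_A @ order_B))"
    using fsl by (simp add: order_lists)
  then show "card {c \<in> set (covA \<Phi>) \<union> set cov. has_order Gel 0 c} = 14"
    unfolding set by (simp add: order_lists)
qed

lemma complex_forms:
  "complex_form (covA \<Phi>) cplxA \<Phi>" "complex_form (covB \<Phi>) cplxB \<Phi>" "complex_form (covC \<Phi>) cplxC \<Phi>"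
proof -
  have *: "complex_form (scaled W cs fs) Z \<Phi>"
    if len: "length cs = length fs" "0 \<notin> set cs" and Z: "\<And>v. Z (\<Phi> (fst v)) (snd v) = map (\<lambda>f. f v) fs" for cs fs Z
    unfolding complex_form_def
  proof (intro allI impI exI[of _ "cs ! k" for k] conjI ballI)
    fix k assume "k < length (scaled W cs fs)"
    then have k: "k < length fs" using len by (simp add: length_scaled)
    show "cs ! k \<noteq> 0" using len k by (metis nth_mem)
    fix P x assume "P \<in> Gel"
    then show "(scaled W cs fs ! k) (P, x) = cs ! k * Z (\<Phi> P) x ! k"
      using Z[of "(P, x)"] len k by (simp add: nth_scaled)
  qed
  show "complex_form (covA \<Phi>) cplxA \<Phi>" "complex_form (covB \<Phi>) cplxB \<Phi>" "complex_form (covC \<Phi>) cplxC \<Phi>"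
    unfolding cov_scaled by (rule *; simp add: cplx_poly consts_nonzero)+
qed

end

theorem corollary8p7:
  fixes \<Phi> :: "tensor4 \<Rightarrow> harm"
  assumes "harmonic_decomposition \<Phi>"
  shows
    "minimal_integrity_basis (Gel \<times> UNIV) (Cov Gel act4 SO2) (set (covA \<Phi>) \<union> set (covB \<Phi>)) \<and>
     card (set (covA \<Phi>) \<union> set (covB \<Phi>)) = 25 \<and>
     card {c \<in> set (covA \<Phi>) \<union> set (covB \<Phi>). has_order Gel 0 c} = 14 \<and>
     minimal_integrity_basis (Gel \<times> UNIV) (Cov Gel act4 O2) (set (covA \<Phi>) \<union> set (covC \<Phi>)) \<and>
     card (set (covA \<Phi>) \<union> set (covC \<Phi>)) = 25 \<and>
     card {c \<in> set (covA \<Phi>) \<union> set (covC \<Phi>). has_order Gel 0 c} = 14 \<and>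
     list_all2 (has_order Gel) (replicate 9 0 @ replicate 5 2 @ replicate 1 4) (covA \<Phi>) \<and>
     list_all2 (has_order Gel) (replicate 5 0 @ replicate 4 2 @ replicate 1 4) (covB \<Phi>) \<and>
     list_all2 (has_order Gel) (replicate 5 0 @ replicate 4 2 @ replicate 1 4) (covC \<Phi>) \<and>
     complex_form (covA \<Phi>) cplxA \<Phi> \<and>
     complex_form (covB \<Phi>) cplxB \<Phi> \<and>
     complex_form (covC \<Phi>) cplxC \<Phi>"
proof -
  interpret harmonic_coordinates \<Phi> by unfold_locales (fact assms)
  note B = minimal_family[OF cov_scaled(2) disjI1[OF refl] covs_SO2 algSO2_eq cov_orders(2) cov_homogeneous]
  note C = minimal_family[OF cov_scaled(3) disjI2[OF refl] covs_O2 algO2_eq cov_orders(3) cov_homogeneous]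
  show ?thesis
    using B C cov_orders complex_forms unfolding order_A_def order_B_def by simp
qed

end
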